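(* Let $M$ be an ideal hyperbolic $4$-simplex, i.e. the convex hull in hyperbolic space $\mathbb{H}^4$ (sectional curvature $-1$) of five ideal points in general position, so that all five vertices of $M$ lie on the sphere at infinity. Then $$\mathrm{vol}(M)=-2\pi^2+\frac{\pi}{3}\sum_{Y\in\mathcal{F}^{(2)}(M)}\angle^{\mathrm{out}}(Y),$$ where $\mathcal{F}^{(2)}(M)$ is the set of the codimension $2$ faces of $M$ (which are ideal triangles) and $\angle^{\mathrm{out}}(Y)$ is the outer dihedral angle of $M$ at $Y$.
   Context: The outer dihedral angle $\angle^{\mathrm{out}}(Y)$ at a $2$-dimensional face $Y$ is the angle in $(0,\pi)$ between the outer unit normals to the two hyperfaces ($3$-dimensional faces) of $M$ containing $Y$; that is, $\pi$ minus the interior dihedral angle. *)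

theory Defs
  imports "HOL-Analysis.Analysis"
begin

text \<open>
  Hyperbolic space of curvature -1 in the Klein (projective) model: the open unit ball, with
  geodesic segments being straight segments and ideal points being the points of the unit sphere.
  Hence hyperbolic convexity, affine hulls, faces and dimensions of faces are the Euclidean ones.
\<close>

definition hyp_space :: "(real ^ 'n) set" where
  "hyp_space = ball 0 1"

definition ideal_points :: "(real ^ 'n) set" where
  "ideal_points = sphere 0 1"

text \<open>The Riemannian metric at \<open>x\<close> of the Klein model, evaluated on tangent vectors \<open>u\<close>, \<open>v\<close>.\<close>

definition klein_metric :: "real ^ 'n \<Rightarrow> real ^ 'n \<Rightarrow> real ^ 'n \<Rightarrow> real" where
  "klein_metric x u v =
     (u \<bullet> v) / (1 - (norm x)\<^sup>2) + (x \<bullet> u) * (x \<bullet> v) / (1 - (norm x)\<^sup>2)\<^sup>2"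

definition hyp_measure :: "(real ^ 'n) measure" where
  "hyp_measure = density (restrict_space lborel hyp_space)
     (\<lambda>x. ennreal (sqrt (det (\<chi> i j. klein_metric x (axis i 1) (axis j 1)))))"

text \<open>
  General position of the \<open>n + 1\<close> vertices means that they do not lie on a common hyperplane.
  The vertices themselves are not points of the simplex.
\<close>

definition ideal_simplex :: "(real ^ 'n) set \<Rightarrow> bool" where
  "ideal_simplex M \<longleftrightarrow>
     (\<exists>V. V \<subseteq> ideal_points \<and> card V = CARD('n) + 1 \<and> \<not> affine_dependent V \<and>
          M = convex hull V \<inter> hyp_space)"

definition codim2_faces :: "(real ^ 'n) set \<Rightarrow> (real ^ 'n) set set" where
  "codim2_faces M = {Y. Y face_of M \<and> Y \<noteq> {} \<and> aff_dim Y = aff_dim M - 2}"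

text \<open>
  The vector \<open>n\<close> is an outer unit normal at \<open>x\<close> to the hyperface \<open>F\<close> of \<open>M\<close>; in the Klein model
  the direction at \<open>x\<close> of the geodesic towards \<open>y\<close> is that of \<open>y - x\<close>.
\<close>

definition outer_unit_normal ::
    "(real ^ 'n) set \<Rightarrow> (real ^ 'n) set \<Rightarrow> real ^ 'n \<Rightarrow> real ^ 'n \<Rightarrow> bool" where
  "outer_unit_normal M F x n \<longleftrightarrow>
     klein_metric x n n = 1 \<and>
     (\<forall>y\<in>F. klein_metric x n (y - x) = 0) \<and>
     (\<forall>y\<in>M. klein_metric x n (y - x) \<le> 0)"

text \<open>The angle does not depend on the point \<open>x\<close> of \<open>Y\<close> at which it is measured.\<close>

definition outer_dihedral_angle :: "(real ^ 'n) set \<Rightarrow> (real ^ 'n) set \<Rightarrow> real" where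
  "outer_dihedral_angle M Y =
     (THE \<theta>. \<exists>x\<in>Y. \<exists>F\<^sub>1 F\<^sub>2 n\<^sub>1 n\<^sub>2.
        F\<^sub>1 facet_of M \<and> F\<^sub>2 facet_of M \<and> F\<^sub>1 \<noteq> F\<^sub>2 \<and> Y \<subseteq> F\<^sub>1 \<and> Y \<subseteq> F\<^sub>2 \<and>
        outer_unit_normal M F\<^sub>1 x n\<^sub>1 \<and> outer_unit_normal M F\<^sub>2 x n\<^sub>2 \<and>
        \<theta> = arccos (klein_metric x n\<^sub>1 n\<^sub>2))"

end

theory Submission imports Defs "HOL-Probability.Distributions" begin

text \<open>
  Let \<open>g\<^sub>i\<^sub>j = 1 - u\<^sub>i \<bullet> u\<^sub>j\<close> for the vertices \<open>u\<^sub>i\<close> on the unit sphere. Integrating over the cone above the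
  simplex, the volume of the simplex is a constant times \<open>W(g) = sqrt (det g) * I(g)\<close>, where \<open>I(g)\<close> is the
  Gaussian integral of \<open>exp (- \<Sum> g\<^sub>i\<^sub>j a\<^sub>i a\<^sub>j)\<close> over the positive orthant. Integrating by parts twice expresses
  the second order moments of this Gaussian through \<open>I(g)\<close> and the Gaussian integrals over the three-dimensional
  faces of the orthant. The latter are explicit, because an ideal triangle has area \<open>pi\<close>. Along a
  segment of matrices \<open>g\<close> this gives Schlaefli's formula \<open>dW = c * d(\<Sum> outer angles)\<close>. The segment is taken
  from \<open>g\<close> to a degenerate configuration, where \<open>W = 0\<close> and the ten outer angles add up to \<open>6 pi\<close>.
\<close>

section \<open>Gaussian integrals over orthants\<close>

text \<open>In Schlaefli's formula the coefficients are the areas of the 2-faces, which are constant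
  for ideal triangles; so the differential of the volume integrates to an affine function of the
  angles, and one configuration of known volume fixes the constant. Matrices are deformed instead of
  vertices because a straight segment then serves as path: positivity off the diagonal and
  \<open>cnd\<close> are convex conditions once row 0 is held fixed. Seen from vertex 0 in the upper
  half space, only the squared distances of four points in Euclidean 3-space vary.

  The form \<open>g\<close> is Lorentzian, and its zero diagonal, the mark of ideal vertices, leaves
  no decay along the axes of the orthant. Moments of order p still converge when there are at least
  p + 3 coordinates: just enough for order 2 on the whole orthant and order 1 on its facets. The
  zero diagonal also makes the form affine in each coordinate, so that integration by parts involves
  only exponentials. At the degenerate end the angles reach 0 and \<open>pi\<close>, where arccos is
  not differentiable; only continuity is used there.\<close>

definition hl :: "real measure" where "hl = restrict_space lborel {0<..}"

definition qf :: "(nat \<Rightarrow> nat \<Rightarrow> real) \<Rightarrow> nat set \<Rightarrow> (nat \<Rightarrow> real) \<Rightarrow> real" where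
  "qf g J a = (\<Sum>i\<in>J. \<Sum>j\<in>J. g i j * a i * a j)"

lemma space_hl [simp]: "space hl = {0<..}"
  by (simp add: hl_def space_restrict_space)

lemma measurable_hl [measurable]: "f \<in> borel_measurable borel \<Longrightarrow> f \<in> borel_measurable hl"
  by (simp add: hl_def measurable_restrict_space1)

lemma nn_integral_hl:
  assumes "f \<in> borel_measurable borel"
  shows "(\<integral>\<^sup>+x. f x \<partial>hl) = (\<integral>\<^sup>+x. f x * indicator {0<..} x \<partial>lborel)"
proof -
  have "{0<..} \<in> sets (lborel :: real measure)" by measurable
  then show ?thesis unfolding hl_def by (subst nn_integral_restrict_space) auto
qed

lemma sigma_finite_hl: "sigma_finite_measure hl"
proof -
  have "{0<..} \<in> sets (lborel :: real measure)" by measurable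
  from sigma_finite_measure_restrict_space[OF lborel.sigma_finite_measure_axioms this]
  show ?thesis unfolding hl_def .
qed

interpretation hlP: product_sigma_finite "\<lambda>_::nat. hl"
  by (simp add: product_sigma_finite_def sigma_finite_hl)

abbreviation orthant :: "nat set \<Rightarrow> (nat \<Rightarrow> real) measure" where
  "orthant J \<equiv> PiM J (\<lambda>_. hl)"

lemma qf_measurable [measurable]: "qf g J \<in> borel_measurable (orthant J)"
  unfolding qf_def[abs_def] by measurable

lemma exp_qf_measurable [measurable]: "(\<lambda>a. exp (- qf g J a)) \<in> borel_measurable (orthant J)"
proof -
  have "(\<lambda>x::real. exp (- x)) \<in> borel_measurable borel" by measurable
  from measurable_compose[OF qf_measurable this] show ?thesis .
qed

lemma nn_integral_hl_power_exp:
  assumes "c > 0"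
  shows "(\<integral>\<^sup>+x. ennreal (x ^ k * exp (- c * x)) \<partial>hl) = ennreal (fact k / c ^ Suc k)"
proof -
  let ?f = "\<lambda>x::real. ennreal (x^k * exp (-x)) * indicator {0 ..} x"
  have "ennreal (fact k) = (\<integral>\<^sup>+x. ?f x \<partial>lborel)"
    by (subst nn_intergal_power_times_exp_Ici) (simp add: ennreal_of_nat_eq_real_of_nat)
  also have "\<dots> = ennreal \<bar>c\<bar> * (\<integral>\<^sup>+x. ?f (0 + c * x) \<partial>lborel)"
    using assms by (intro nn_integral_real_affine) auto
  also have "(\<integral>\<^sup>+x. ?f (0 + c * x) \<partial>lborel) = (\<integral>\<^sup>+x. ennreal (c ^ k) * (ennreal (x ^ k * exp (- c * x)) * indicator {0<..} x) \<partial>lborel)"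
    by (intro nn_integral_cong_AE AE_I[where N="{0}"])
       (use assms in \<open>auto simp: indicator_def ennreal_mult'[symmetric] power_mult_distrib zero_le_mult_iff mult_ac\<close>)
  also have "\<dots> = ennreal (c ^ k) * (\<integral>\<^sup>+x. ennreal (x ^ k * exp (- c * x)) \<partial>hl)"
    by (subst nn_integral_cmult) (auto simp: nn_integral_hl)
  finally have "ennreal (fact k) = ennreal (c ^ Suc k) * (\<integral>\<^sup>+x. ennreal (x ^ k * exp (- c * x)) \<partial>hl)"
    using assms by (simp add: ennreal_mult mult.assoc)
  then have "ennreal (inverse (c ^ Suc k)) * ennreal (fact k) =
     (ennreal (inverse (c ^ Suc k)) * ennreal (c ^ Suc k)) * (\<integral>\<^sup>+x. ennreal (x ^ k * exp (- c * x)) \<partial>hl)"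
    by (simp add: mult.assoc)
  also have "ennreal (inverse (c ^ Suc k)) * ennreal (c ^ Suc k) = 1"
    using assms by (subst ennreal_mult'[symmetric]) (auto simp del: power_Suc)
  finally show ?thesis
    using assms by (simp add: ennreal_mult'[symmetric] divide_inverse mult.commute del: power_Suc)
qed

lemma has_bochner_integral_hl_power_exp:
  assumes "c > 0"
  shows "has_bochner_integral hl (\<lambda>x. x ^ k * exp (- c * x)) (fact k / c ^ Suc k)"
  using assms by (intro has_bochner_integral_nn_integral nn_integral_hl_power_exp AE_I2) auto

text \<open>No term in the square of \<open>y\<close> arises, because the diagonal vanishes. In a
  single coordinate the weight \<open>exp (- qf g J a)\<close> is therefore a pure exponential whose
  rate is twice a linear form in the other coordinates.\<close>

lemma qf_upd:
  assumes "finite J" "i \<notin> J" and sym: "\<And>i j. g i j = g j i" and diag: "\<And>i. g i i = 0"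
  shows "qf g (insert i J) (x(i:=y)) = 2 * y * (\<Sum>j\<in>J. g i j * x j) + qf g J x"
proof -
  have ni: "j \<noteq> i" if "j \<in> J" for j using assms(2) that by auto
  have "qf g (insert i J) (x(i:=y)) = (\<Sum>j\<in>J. g i j * y * x j) + (\<Sum>k\<in>J. g k i * x k * y + (\<Sum>j\<in>J. g k j * x k * x j))"
    unfolding qf_def using assms(1,2) by (simp add: diag ni cong: sum.cong)
  also have "\<dots> = 2 * y * (\<Sum>j\<in>J. g i j * x j) + qf g J x"
    unfolding qf_def sum.distrib by (simp add: sum_distrib_left sum_distrib_right sym[of _ i] mult_ac flip: sum.distrib)
  finally show ?thesis .
qed


section \<open>Integrability of moments over an orthant\<close>

lemma nn_integral_inverse_square_finite:
  "(\<integral>\<^sup>+y. ennreal (inverse (y\<^sup>2)) * indicator {1..} y \<partial>lborel) < \<infinity>"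
proof -
  have "(\<integral>\<^sup>+y. ennreal (inverse (y\<^sup>2)) * indicator {1..} y \<partial>lborel) = ennreal (0 - (- inverse 1))"
  proof (rule nn_integral_FTC_atLeast[where F="\<lambda>y. - inverse y"])
    show "((\<lambda>y::real. - inverse y) \<longlongrightarrow> 0) at_top"
      using tendsto_minus[OF tendsto_inverse_0_at_top[OF filterlim_ident]] by simp
  qed (auto intro!: derivative_eq_intros simp: power2_eq_square)
  then show ?thesis by simp
qed

text \<open>
  A majorant of the Gaussian moments on the part of the orthant where \<open>a i\<close> is the largest coordinate. For
  large \<open>a i\<close> only the terms \<open>a i * a j\<close> are kept: they decay in every direction except along the axis.
\<close>

definition cube_or_star :: "nat set \<Rightarrow> nat \<Rightarrow> real \<Rightarrow> nat \<Rightarrow> (nat \<Rightarrow> real) \<Rightarrow> real" where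
  "cube_or_star J p m i a = real (card J) ^ p *
     (if a i \<le> 1 then \<Prod>j\<in>J-{i}. indicator {..1} (a j) else a i ^ p * (\<Prod>j\<in>J-{i}. exp (- (m * a i) * a j)))"

lemma cube_or_star_measurable [measurable]:
  "i \<in> J \<Longrightarrow> cube_or_star J p m i \<in> borel_measurable (orthant J)"
  unfolding cube_or_star_def[abs_def] by measurable

text \<open>The other coordinates are integrated first; for \<open>y > 1\<close> each of them
  contributes a factor \<open>1 / (m * y)\<close>. Against \<open>y ^ p\<close> this leaves at most
  a multiple of \<open>inverse (y\<^sup>2)\<close>, and this is where
  \<open>card J \<ge> p + 3\<close> enters.\<close>

lemma nn_integral_cube_or_star_finite:
  assumes J: "finite J" "i \<in> J" "card J \<ge> p + 3" and m: "m > 0"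
  shows "(\<integral>\<^sup>+a. ennreal (cube_or_star J p m i a) \<partial>orthant J) < \<infinity>"
proof -
  define I where "I = J - {i}"
  have J_eq: "J = insert i I" and I: "finite I" "i \<notin> I" and cI: "card I \<ge> p + 2"
    using J by (auto simp: I_def card_Diff_singleton)
  define c where "c = real (card J) ^ p"
  have c0: "c \<ge> 0" by (simp add: c_def)
  have ni: "j \<noteq> i" if "j \<in> I" for j using I that by auto
  have inner: "(\<integral>\<^sup>+x. ennreal (cube_or_star J p m i (x(i:=y))) \<partial>orthant I) \<le>
     ennreal c * indicator {0..1} y + ennreal (c / m ^ card I) * (ennreal (inverse (y\<^sup>2)) * indicator {1..} y)"
    if y: "y > 0" for y
  proof (cases "y \<le> 1")
    case True
    have "(\<integral>\<^sup>+x. ennreal (cube_or_star J p m i (x(i:=y))) \<partial>orthant I) =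
       (\<integral>\<^sup>+x. ennreal c * (\<Prod>j\<in>I. indicator {..1} (x j)) \<partial>orthant I)"
      using True c0 by (intro nn_integral_cong)
        (simp add: cube_or_star_def I_def[symmetric] c_def[symmetric] ennreal_mult prod_nonneg ni ennreal_indicator flip: prod_ennreal cong: prod.cong)
    also have "\<dots> = ennreal c * (\<integral>\<^sup>+x. (\<Prod>j\<in>I. indicator {..1} (x j)) \<partial>orthant I)"
      by (intro nn_integral_cmult borel_measurable_prod_ennreal) auto
    also have "(\<integral>\<^sup>+x. (\<Prod>j\<in>I. indicator {..1} (x j)) \<partial>orthant I) = (\<Prod>j\<in>I. (\<integral>\<^sup>+x. indicator {..1} x \<partial>hl))"
      using I by (intro hlP.product_nn_integral_prod) auto
    also have "(\<integral>\<^sup>+x. indicator {..1} x \<partial>hl) = (\<integral>\<^sup>+x. indicator {0<..1::real} x \<partial>lborel)"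
    proof -
      have *: "(\<lambda>x::real. indicator {..1} x * indicator {0<..} x :: ennreal) = indicator {0<..1}"
        by (auto simp: fun_eq_iff indicator_def)
      show ?thesis by (rule trans[OF nn_integral_hl], simp) (simp only: *)
    qed
    also have "\<dots> = 1" by simp
    finally have "(\<integral>\<^sup>+x. ennreal (cube_or_star J p m i (x(i:=y))) \<partial>orthant I) = ennreal c" by (simp del: fun_upd_apply)
    then show ?thesis using True y by (simp del: fun_upd_apply)
  next
    case False
    \<comment> \<open>The factor \<open>x j ^ 0\<close> brings each one-dimensional integral into
      the shape of \<open>nn_integral_hl_power_exp\<close>.\<close>
    have "(\<integral>\<^sup>+x. ennreal (cube_or_star J p m i (x(i:=y))) \<partial>orthant I) =
       (\<integral>\<^sup>+x. ennreal (c * y ^ p) * (\<Prod>j\<in>I. ennreal (x j ^ 0 * exp (- (m * y) * x j))) \<partial>orthant I)"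
    proof (rule nn_integral_cong)
      fix x :: "nat \<Rightarrow> real"
      have "cube_or_star J p m i (x(i:=y)) = c * y ^ p * (\<Prod>j\<in>I. x j ^ 0 * exp (- (m * y) * x j))"
        using False by (simp add: cube_or_star_def I_def[symmetric] c_def[symmetric] ni cong: prod.cong)
      then show "ennreal (cube_or_star J p m i (x(i:=y))) = ennreal (c * y ^ p) * (\<Prod>j\<in>I. ennreal (x j ^ 0 * exp (- (m * y) * x j)))"
        using c0 y by (subst prod_ennreal) (auto simp: ennreal_mult' prod_nonneg)
    qed
    also have "\<dots> = ennreal (c * y ^ p) * (\<integral>\<^sup>+x. (\<Prod>j\<in>I. ennreal (x j ^ 0 * exp (- (m * y) * x j))) \<partial>orthant I)"
      by (intro nn_integral_cmult borel_measurable_prod_ennreal) auto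
    also have "(\<integral>\<^sup>+x. (\<Prod>j\<in>I. ennreal (x j ^ 0 * exp (- (m * y) * x j))) \<partial>orthant I) =
        (\<Prod>j\<in>I. (\<integral>\<^sup>+x. ennreal (x ^ 0 * exp (- (m * y) * x)) \<partial>hl))"
      using I by (intro hlP.product_nn_integral_prod) auto
    also have "\<dots> = ennreal (inverse (m * y) ^ card I)"
      using m y by (subst nn_integral_hl_power_exp) (auto simp: ennreal_power inverse_eq_divide)
    also have "ennreal (c * y ^ p) * \<dots> = ennreal (c / m ^ card I * (y ^ p * inverse y ^ card I))"
      using c0 y m by (subst ennreal_mult'[symmetric]) (auto simp: power_mult_distrib field_simps)
    also have "\<dots> \<le> ennreal (c / m ^ card I * inverse (y\<^sup>2))"
    proof (intro ennreal_leI mult_left_mono)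
      have "y ^ p * inverse y ^ card I \<le> y ^ p * inverse y ^ (p + 2)"
        using False cI by (intro mult_left_mono power_decreasing) (auto simp: field_simps)
      also have "\<dots> = inverse (y\<^sup>2)" using y by (simp add: power_add field_simps power2_eq_square)
      finally show "y ^ p * inverse y ^ card I \<le> inverse (y\<^sup>2)" .
    qed (use c0 m in auto)
    also have "\<dots> = ennreal (c / m ^ card I) * ennreal (inverse (y\<^sup>2))"
      using c0 m by (intro ennreal_mult) auto
    finally show ?thesis using False y by (simp del: fun_upd_apply)
  qed
  have meas: "(\<lambda>a. ennreal (cube_or_star J p m i a)) \<in> borel_measurable (orthant J)"
    using measurable_compose[OF cube_or_star_measurable[OF J(2)] measurable_ennreal] .
  have "(\<integral>\<^sup>+a. ennreal (cube_or_star J p m i a) \<partial>orthant J) =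
      (\<integral>\<^sup>+y. (\<integral>\<^sup>+x. ennreal (cube_or_star J p m i (x(i:=y))) \<partial>orthant I) \<partial>hl)"
    by (rule hlP.product_nn_integral_insert_rev[OF I meas[unfolded J_eq], folded J_eq])
  also have "\<dots> \<le> (\<integral>\<^sup>+y. ennreal c * indicator {0..1} y + ennreal (c / m ^ card I) * (ennreal (inverse (y\<^sup>2)) * indicator {1..} y) \<partial>hl)"
    using inner by (intro nn_integral_mono) auto
  also have "\<dots> \<le> (\<integral>\<^sup>+y. ennreal c * indicator {0..1} y + ennreal (c / m ^ card I) * (ennreal (inverse (y\<^sup>2)) * indicator {1..} y) \<partial>lborel)"
    by (subst nn_integral_hl) (auto intro!: nn_integral_mono simp: indicator_def)
  also have "\<dots> = ennreal c + ennreal (c / m ^ card I) * (\<integral>\<^sup>+y. ennreal (inverse (y\<^sup>2)) * indicator {1..} y \<partial>lborel)"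
    by (subst nn_integral_add) (auto simp: nn_integral_cmult)
  also have "\<dots> < \<infinity>"
    using nn_integral_inverse_square_finite by (auto simp: ennreal_mult_less_top)
  finally show ?thesis .
qed

text \<open>With \<open>a i\<close> the largest coordinate, the sum of all coordinates is at most
  \<open>card J * a i\<close>, which explains the leading factor of \<open>cube_or_star\<close>.
  Summing the majorants over every \<open>i\<close> avoids splitting the domain of integration by
  the position of the maximum.\<close>

lemma exp_le_cube_or_star:
  fixes J :: "nat set"
  assumes J: "finite J" "J \<noteq> {}" and m: "m > 0" and a: "\<And>j. j \<in> J \<Longrightarrow> a j > 0"
  shows "(\<Sum>j\<in>J. a j) ^ p * exp (- m * (\<Sum>i\<in>J. \<Sum>j\<in>J-{i}. a i * a j)) \<le> (\<Sum>i\<in>J. cube_or_star J p m i a)"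
proof -
  have "Max (a ` J) \<in> a ` J" using J by (intro Max_in) auto
  then obtain i where i: "i \<in> J" "a i = Max (a ` J)" by (metis imageE)
  have le: "a j \<le> a i" if "j \<in> J" for j using J that i by auto
  have nn: "0 \<le> cube_or_star J p m k a" if "k \<in> J" for k
    unfolding cube_or_star_def using a[OF that] by (auto intro!: prod_nonneg mult_nonneg_nonneg)
  have s: "(\<Sum>j\<in>J. a j) ^ p \<le> (real (card J) * a i) ^ p"
    using sum_bounded_above[of J a "a i"] le a by (intro power_mono sum_nonneg) (auto simp: less_imp_le)
  have ss: "(\<Sum>j\<in>J-{i}. a i * a j) \<le> (\<Sum>i\<in>J. \<Sum>j\<in>J-{i}. a i * a j)"
  proof (rule member_le_sum[of i J "\<lambda>i. \<Sum>j\<in>J-{i}. a i * a j"])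
    show "0 \<le> (\<Sum>j\<in>J-{k}. a k * a j)" if "k \<in> J - {i}" for k
      using a that by (intro sum_nonneg mult_nonneg_nonneg) (auto simp: less_imp_le)
  qed (use i(1) J in auto)
  have ss0: "0 \<le> (\<Sum>j\<in>J-{i}. a i * a j)"
    using i(1) a by (intro sum_nonneg mult_nonneg_nonneg) (auto simp: less_imp_le)
  have "(\<Sum>j\<in>J. a j) ^ p * exp (- m * (\<Sum>i\<in>J. \<Sum>j\<in>J-{i}. a i * a j)) \<le> cube_or_star J p m i a"
  proof (cases "a i \<le> 1")
    case True
    have "(\<Sum>j\<in>J. a j) ^ p * exp (- m * (\<Sum>i\<in>J. \<Sum>j\<in>J-{i}. a i * a j)) \<le> (real (card J) * a i) ^ p * 1"
      using s ss ss0 m a[OF i(1)] by (intro mult_mono) auto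
    also have "\<dots> \<le> real (card J) ^ p"
      using True a[OF i(1)] by (simp add: power_mult_distrib mult_left_le power_le_one)
    also have "\<dots> = cube_or_star J p m i a"
    proof -
      have "(\<Prod>j\<in>J-{i}. indicator {..1} (a j)) = (1::real)"
        using True le by (intro prod.neutral) (force simp: indicator_def)
      then show ?thesis using True by (simp add: cube_or_star_def)
    qed
    finally show ?thesis .
  next
    case False
    have "(\<Sum>j\<in>J. a j) ^ p * exp (- m * (\<Sum>i\<in>J. \<Sum>j\<in>J-{i}. a i * a j)) \<le> (real (card J) * a i) ^ p * exp (- m * (\<Sum>j\<in>J-{i}. a i * a j))"
      using s ss m a[OF i(1)] by (intro mult_mono) auto
    also have "\<dots> = cube_or_star J p m i a"
    proof -
      have "- m * (\<Sum>j\<in>J-{i}. a i * a j) = (\<Sum>j\<in>J-{i}. - (m * a i) * a j)"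
        by (simp add: sum_distrib_left mult.assoc)
      then have "exp (- m * (\<Sum>j\<in>J-{i}. a i * a j)) = (\<Prod>j\<in>J-{i}. exp (- (m * a i) * a j))"
        using J exp_sum[of "J - {i}"] by simp
      then show ?thesis using False by (simp add: cube_or_star_def power_mult_distrib)
    qed
    finally show ?thesis .
  qed
  also have "\<dots> \<le> (\<Sum>i\<in>J. cube_or_star J p m i a)"
    by (rule member_le_sum[of i J "\<lambda>i. cube_or_star J p m i a"]) (use J i(1) nn in auto)
  finally show ?thesis .
qed

lemma integrable_power_sum_exp:
  fixes J :: "nat set"
  assumes J: "finite J" "card J \<ge> p + 3" and m: "m > 0"
  shows "integrable (orthant J) (\<lambda>a. (\<Sum>j\<in>J. a j) ^ p * exp (- m * (\<Sum>i\<in>J. \<Sum>j\<in>J-{i}. a i * a j)))"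
proof (rule integrableI_bounded)
  show "(\<lambda>a. (\<Sum>j\<in>J. a j) ^ p * exp (- m * (\<Sum>i\<in>J. \<Sum>j\<in>J-{i}. a i * a j))) \<in> borel_measurable (orthant J)"
    by measurable
  have ne: "J \<noteq> {}" using J by auto
  have "(\<integral>\<^sup>+a. ennreal (norm ((\<Sum>j\<in>J. a j) ^ p * exp (- m * (\<Sum>i\<in>J. \<Sum>j\<in>J-{i}. a i * a j)))) \<partial>orthant J)
      \<le> (\<integral>\<^sup>+a. (\<Sum>i\<in>J. ennreal (cube_or_star J p m i a)) \<partial>orthant J)"
  proof (rule nn_integral_mono)
    fix a assume a: "a \<in> space (orthant J)"
    then have pos: "a j > 0" if "j \<in> J" for j using that by (auto simp: space_PiM)
    have nn: "0 \<le> cube_or_star J p m k a" if "k \<in> J" for k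
      unfolding cube_or_star_def using pos[OF that] by (auto intro!: prod_nonneg mult_nonneg_nonneg)
    have "0 \<le> (\<Sum>j\<in>J. a j)" using pos by (intro sum_nonneg) (auto simp: less_imp_le)
    then have "0 \<le> (\<Sum>j\<in>J. a j) ^ p * exp (- m * (\<Sum>i\<in>J. \<Sum>j\<in>J-{i}. a i * a j))" by simp
    then have "norm ((\<Sum>j\<in>J. a j) ^ p * exp (- m * (\<Sum>i\<in>J. \<Sum>j\<in>J-{i}. a i * a j))) \<le> (\<Sum>i\<in>J. cube_or_star J p m i a)"
      using exp_le_cube_or_star[where p=p and a=a, OF J(1) ne m] pos by auto
    from ennreal_leI[OF this] sum_ennreal[of J "\<lambda>i. cube_or_star J p m i a", OF nn]
    show "ennreal (norm ((\<Sum>j\<in>J. a j) ^ p * exp (- m * (\<Sum>i\<in>J. \<Sum>j\<in>J-{i}. a i * a j)))) \<le> (\<Sum>i\<in>J. ennreal (cube_or_star J p m i a))"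
      by (simp only:)
  qed
  also have "\<dots> = (\<Sum>i\<in>J. \<integral>\<^sup>+a. ennreal (cube_or_star J p m i a) \<partial>orthant J)"
    by (intro nn_integral_sum measurable_compose[OF cube_or_star_measurable measurable_ennreal])
  also have "\<dots> < \<infinity>"
    using nn_integral_cube_or_star_finite[OF J(1) _ J(2) m] J(1) by (simp add: less_top)
  finally show "(\<integral>\<^sup>+a. ennreal (norm ((\<Sum>j\<in>J. a j) ^ p * exp (- m * (\<Sum>i\<in>J. \<Sum>j\<in>J-{i}. a i * a j)))) \<partial>orthant J) < \<infinity>" .
qed


text \<open>All matrices with the common lower bound \<open>m\<close> are compared with one constant
  matrix; along a segment of matrices this yields a majorant independent of the parameter.\<close>

lemma qf_ge:
  fixes J :: "nat set"
  assumes g: "\<And>i j. i \<in> J \<Longrightarrow> j \<in> J \<Longrightarrow> i \<noteq> j \<Longrightarrow> m \<le> g i j" and diag: "\<And>i. g i i = 0"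
    and J: "finite J" and a: "\<And>j. j \<in> J \<Longrightarrow> a j > 0"
  shows "m * (\<Sum>i\<in>J. \<Sum>j\<in>J-{i}. a i * a j) \<le> qf g J a"
proof -
  have "m * (\<Sum>i\<in>J. \<Sum>j\<in>J-{i}. a i * a j) = (\<Sum>i\<in>J. \<Sum>j\<in>J-{i}. m * a i * a j)"
    by (simp add: sum_distrib_left mult_ac)
  also have "\<dots> \<le> (\<Sum>i\<in>J. \<Sum>j\<in>J-{i}. g i j * a i * a j)"
    using g a by (intro sum_mono mult_right_mono) (auto simp: less_imp_le)
  also have "\<dots> = qf g J a"
    unfolding qf_def using J by (intro sum.cong refl sum.mono_neutral_left) (auto simp: diag)
  finally show ?thesis .
qed

lemma integrable_moment_bound:
  fixes J :: "nat set"
  assumes J: "finite J" "card J \<ge> p + 3" and m: "m > 0"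
    and g: "\<And>i j. i \<in> J \<Longrightarrow> j \<in> J \<Longrightarrow> i \<noteq> j \<Longrightarrow> m \<le> g i j" and diag: "\<And>i. g i i = 0"
    and f: "f \<in> borel_measurable (orthant J)"
    and le: "\<And>a. (\<And>j. j \<in> J \<Longrightarrow> a j > 0) \<Longrightarrow> \<bar>f a\<bar> \<le> K * (\<Sum>j\<in>J. a j) ^ p"
  shows "integrable (orthant J) (\<lambda>a. f a * exp (- qf g J a))"
proof -
  have int: "integrable (orthant J) (\<lambda>a. K * ((\<Sum>j\<in>J. a j) ^ p * exp (- m * (\<Sum>i\<in>J. \<Sum>j\<in>J-{i}. a i * a j))))"
    using integrable_power_sum_exp[OF J m] by (rule integrable_mult_right)
  have bound: "norm (f a * exp (- qf g J a)) \<le> norm (K * ((\<Sum>j\<in>J. a j) ^ p * exp (- m * (\<Sum>i\<in>J. \<Sum>j\<in>J-{i}. a i * a j))))"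
    if "a \<in> space (orthant J)" for a
  proof -
    have pos: "a j > 0" if "j \<in> J" for j using that \<open>a \<in> space _\<close> by (auto simp: space_PiM)
    have "norm (f a * exp (- qf g J a)) = \<bar>f a\<bar> * exp (- qf g J a)" by (simp add: abs_mult)
    also have "\<dots> \<le> (K * (\<Sum>j\<in>J. a j) ^ p) * exp (- m * (\<Sum>i\<in>J. \<Sum>j\<in>J-{i}. a i * a j))"
      using le[of a] qf_ge[where a=a and m=m and g=g, OF g diag J(1)] pos by (intro mult_mono) auto
    also have "\<dots> \<le> norm \<dots>" by simp
    finally show ?thesis by (simp only: mult.assoc)
  qed
  have meas: "(\<lambda>a. f a * exp (- qf g J a)) \<in> borel_measurable (orthant J)"
    by (rule borel_measurable_times[OF f exp_qf_measurable])
  show ?thesis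
    by (rule Bochner_Integration.integrable_bound[OF int meas AE_I2[OF bound]])
qed

section \<open>Moments of order at most two and their linear relations\<close>

definition mom0 :: "(nat \<Rightarrow> nat \<Rightarrow> real) \<Rightarrow> nat set \<Rightarrow> real" where
  "mom0 g J = (\<integral>a. exp (- qf g J a) \<partial>orthant J)"

definition mom1 :: "(nat \<Rightarrow> nat \<Rightarrow> real) \<Rightarrow> nat set \<Rightarrow> nat \<Rightarrow> real" where
  "mom1 g J j = (\<integral>a. a j * exp (- qf g J a) \<partial>orthant J)"

definition mom2 :: "(nat \<Rightarrow> nat \<Rightarrow> real) \<Rightarrow> nat set \<Rightarrow> nat \<Rightarrow> nat \<Rightarrow> real" where
  "mom2 g J k j = (\<integral>a. a k * a j * exp (- qf g J a) \<partial>orthant J)"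

text \<open>Minus the Lorentz products of light-like vectors in one half of the light cone form such
  a matrix. The conditions range over all indices, so a matrix that is meaningful only below 5 has
  to be padded, as \<open>gram\<close> is.\<close>

locale pos_off_diag =
  fixes g :: "nat \<Rightarrow> nat \<Rightarrow> real"
  assumes sym: "g i j = g j i" and diag: "g i i = 0" and pos: "i \<noteq> j \<Longrightarrow> g i j > 0"
begin

lemma lower_bound:
  assumes "finite J"
  obtains m where "m > 0" "\<And>i j. i \<in> J \<Longrightarrow> j \<in> J \<Longrightarrow> i \<noteq> j \<Longrightarrow> m \<le> g i j"
proof -
  \<comment> \<open>The element 1 keeps \<open>S\<close> nonempty when \<open>J\<close> has fewer
    than two elements.\<close>
  define S where "S = insert 1 ((\<lambda>(i,j). g i j) ` {(i,j) \<in> J \<times> J. i \<noteq> j})"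
  have "finite {(i,j) \<in> J \<times> J. i \<noteq> j}"
    by (rule finite_subset[of _ "J \<times> J"]) (use assms in auto)
  then have S: "finite S" "S \<noteq> {}" by (auto simp: S_def)
  have "\<forall>s\<in>S. s > 0" using pos by (auto simp: S_def)
  then have "Min S > 0" using S by simp
  moreover have "Min S \<le> g i j" if "i \<in> J" "j \<in> J" "i \<noteq> j" for i j
    using S that by (intro Min_le) (auto simp: S_def)
  ultimately show ?thesis using that by blast
qed

lemma integrable_moment:
  assumes J: "finite J" "card J \<ge> p + 3"
    and f: "f \<in> borel_measurable (orthant J)"
    and le: "\<And>a. (\<And>j. j \<in> J \<Longrightarrow> a j > 0) \<Longrightarrow> \<bar>f a\<bar> \<le> K * (\<Sum>j\<in>J. a j) ^ p"
  shows "integrable (orthant J) (\<lambda>a. f a * exp (- qf g J a))"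
proof -
  obtain m where "m > 0" "\<And>i j. i \<in> J \<Longrightarrow> j \<in> J \<Longrightarrow> i \<noteq> j \<Longrightarrow> m \<le> g i j"
    using lower_bound[OF J(1)] by blast
  then show ?thesis by (intro integrable_moment_bound[where m=m and K=K, OF J _ _ diag f le])
qed

lemma integrable_mom0:
  assumes "finite J" "card J \<ge> 3"
  shows "integrable (orthant J) (\<lambda>a. exp (- qf g J a))"
proof -
  have "integrable (orthant J) (\<lambda>a. 1 * exp (- qf g J a))"
    by (rule integrable_moment[where p=0 and K=1]) (use assms in auto)
  then show ?thesis by simp
qed

lemma integrable_mom1:
  assumes "finite J" "card J \<ge> 4" "j \<in> J"
  shows "integrable (orthant J) (\<lambda>a. a j * exp (- qf g J a))"
proof (rule integrable_moment[of J 1 "\<lambda>a. a j" 1])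
  fix a :: "nat \<Rightarrow> real" assume "\<And>j. j \<in> J \<Longrightarrow> a j > 0"
  then show "\<bar>a j\<bar> \<le> 1 * (\<Sum>j\<in>J. a j) ^ 1"
    using assms member_le_sum[of j J a] by (auto simp: less_imp_le)
next
  show "(\<lambda>a. a j) \<in> borel_measurable (orthant J)"
    using assms by measurable
qed (use assms in simp_all)

lemma integrable_mom2:
  assumes "finite J" "card J \<ge> 5" "j \<in> J" "k \<in> J"
  shows "integrable (orthant J) (\<lambda>a. a k * a j * exp (- qf g J a))"
proof (rule integrable_moment[of J 2 "\<lambda>a. a k * a j" 1])
  fix a :: "nat \<Rightarrow> real" assume a: "\<And>j. j \<in> J \<Longrightarrow> a j > 0"
  have "a k \<le> sum a J" "a j \<le> sum a J"
    using assms member_le_sum[of j J a] member_le_sum[of k J a] a by (auto simp: less_imp_le)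
  then have "a k * a j \<le> sum a J * sum a J"
    using a[OF assms(3)] a[OF assms(4)] by (intro mult_mono) auto
  then show "\<bar>a k * a j\<bar> \<le> 1 * (\<Sum>j\<in>J. a j) ^ 2"
    using a[OF assms(3)] a[OF assms(4)] by (simp add: power2_eq_square)
next
  show "(\<lambda>a. a k * a j) \<in> borel_measurable (orthant J)"
    using assms by measurable
qed (use assms in simp_all)

lemma linear_form_pos:
  assumes "finite J" "J \<noteq> {}" "i \<notin> J" "x \<in> space (orthant J)"
  shows "(\<Sum>j\<in>J. g i j * x j) > 0"
proof (intro sum_pos mult_pos_pos)
  fix j assume j: "j \<in> J"
  then have "i \<noteq> j" using assms by auto
  then show "g i j > 0" by (rule pos)
  show "x j > 0" using assms(4) j by (auto simp: space_PiM)
qed (use assms in auto)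

text \<open>In coordinate \<open>i\<close> the integrand is \<open>2 * L * exp (- 2 * L * y)\<close>
  times a constant, with \<open>L\<close> the linear form in the other coordinates. Its integral is
  the boundary value at \<open>y = 0\<close>, so coordinate \<open>i\<close> disappears and the
  facet of the orthant remains.\<close>

lemma integral_by_parts:
  assumes J: "finite J" "J \<noteq> {}" "i \<notin> J" and f: "\<And>x y. f (x(i:=y)) = f x"
    and int: "integrable (orthant (insert i J)) (\<lambda>a. f a * (2 * (\<Sum>j\<in>J. g i j * a j)) * exp (- qf g (insert i J) a))"
  shows "(\<integral>a. f a * (2 * (\<Sum>j\<in>J. g i j * a j)) * exp (- qf g (insert i J) a) \<partial>orthant (insert i J)) =
         (\<integral>a. f a * exp (- qf g J a) \<partial>orthant J)"
proof -
  have ni: "j \<noteq> i" if "j \<in> J" for j using J that by auto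
  have "(\<integral>y. f (x(i:=y)) * (2 * (\<Sum>j\<in>J. g i j * (x(i:=y)) j)) * exp (- qf g (insert i J) (x(i:=y))) \<partial>hl) = f x * exp (- qf g J x)"
    if x: "x \<in> space (orthant J)" for x
  proof -
    define L where "L = (\<Sum>j\<in>J. g i j * x j)"
    have L: "L > 0" unfolding L_def using J x by (intro linear_form_pos)
    have eq: "(\<lambda>y. f (x(i:=y)) * (2 * (\<Sum>j\<in>J. g i j * (x(i:=y)) j)) * exp (- qf g (insert i J) (x(i:=y)))) =
          (\<lambda>y. (f x * (2 * L) * exp (- qf g J x)) * (y ^ 0 * exp (- (2 * L) * y)))"
    proof
      fix y
      have "(\<Sum>j\<in>J. g i j * (x(i:=y)) j) = L" unfolding L_def using ni by (intro sum.cong) auto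
      moreover have "qf g (insert i J) (x(i:=y)) = 2 * y * L + qf g J x"
        unfolding L_def by (rule qf_upd[OF J(1,3) sym diag])
      ultimately show "f (x(i:=y)) * (2 * (\<Sum>j\<in>J. g i j * (x(i:=y)) j)) * exp (- qf g (insert i J) (x(i:=y))) =
        (f x * (2 * L) * exp (- qf g J x)) * (y ^ 0 * exp (- (2 * L) * y))"
        unfolding f by (simp add: exp_diff exp_minus field_simps)
    qed
    have "(\<integral>y. (f x * (2 * L) * exp (- qf g J x)) * (y ^ 0 * exp (- (2 * L) * y)) \<partial>hl) = (f x * (2 * L) * exp (- qf g J x)) * (fact 0 / (2 * L) ^ Suc 0)"
      using L by (subst integral_mult_right_zero, subst has_bochner_integral_integral_eq[OF has_bochner_integral_hl_power_exp]) auto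
    also have "\<dots> = f x * exp (- qf g J x)" using L by simp
    finally show ?thesis unfolding eq .
  qed
  then show ?thesis
    by (subst hlP.product_integral_insert[OF J(1,3) int]) (intro Bochner_Integration.integral_cong refl)
qed


text \<open>The extra factor \<open>a i\<close> kills the boundary term; what remains is its
  derivative 1 under the integral.\<close>

lemma integral_by_parts_same:
  assumes J: "finite J" "i \<notin> J" "card J \<ge> 4"
  shows "(\<integral>a. a i * (2 * (\<Sum>j\<in>J. g i j * a j)) * exp (- qf g (insert i J) a) \<partial>orthant (insert i J)) =
         mom0 g (insert i J)"
proof -
  have ni: "j \<noteq> i" if "j \<in> J" for j using J that by auto
  have ne: "J \<noteq> {}" using J by auto
  have card: "card (insert i J) \<ge> 5" using J by simp
  have "integrable (orthant (insert i J)) (\<lambda>a. \<Sum>j\<in>J. 2 * g i j * (a i * a j * exp (- qf g (insert i J) a)))"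
    using J card by (intro Bochner_Integration.integrable_sum integrable_mult_right integrable_mom2) auto
  also have "(\<lambda>a. \<Sum>j\<in>J. 2 * g i j * (a i * a j * exp (- qf g (insert i J) a))) =
     (\<lambda>a. a i * (2 * (\<Sum>j\<in>J. g i j * a j)) * exp (- qf g (insert i J) a))"
    by (simp add: sum_distrib_left sum_distrib_right mult_ac)
  finally have int1: "integrable (orthant (insert i J)) (\<lambda>a. a i * (2 * (\<Sum>j\<in>J. g i j * a j)) * exp (- qf g (insert i J) a))" .
  have int0: "integrable (orthant (insert i J)) (\<lambda>a. exp (- qf g (insert i J) a))"
    using J card by (intro integrable_mom0) auto
  have eq: "(\<integral>y. (x(i:=y)) i * (2 * (\<Sum>j\<in>J. g i j * (x(i:=y)) j)) * exp (- qf g (insert i J) (x(i:=y))) \<partial>hl) =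
        (\<integral>y. exp (- qf g (insert i J) (x(i:=y))) \<partial>hl)"
    if x: "x \<in> space (orthant J)" for x
  proof -
    define L where "L = (\<Sum>j\<in>J. g i j * x j)"
    have L: "L > 0" unfolding L_def using J ne x by (intro linear_form_pos)
    have q: "qf g (insert i J) (x(i:=y)) = 2 * y * L + qf g J x" for y
      unfolding L_def by (rule qf_upd[OF J(1,2) sym diag])
    have s: "(\<Sum>j\<in>J. g i j * (x(i:=y)) j) = L" for y unfolding L_def using ni by (intro sum.cong) auto
    have "(\<integral>y. (x(i:=y)) i * (2 * (\<Sum>j\<in>J. g i j * (x(i:=y)) j)) * exp (- qf g (insert i J) (x(i:=y))) \<partial>hl) =
        (\<integral>y. (2 * L * exp (- qf g J x)) * (y ^ 1 * exp (- (2 * L) * y)) \<partial>hl)"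
      unfolding q s by (intro Bochner_Integration.integral_cong refl) (simp add: exp_diff exp_minus field_simps)
    also have "\<dots> = (2 * L * exp (- qf g J x)) * (fact 1 / (2 * L) ^ Suc 1)"
      using L by (subst integral_mult_right_zero, subst has_bochner_integral_integral_eq[OF has_bochner_integral_hl_power_exp]) auto
    also have "\<dots> = exp (- qf g J x) * (fact 0 / (2 * L) ^ Suc 0)" using L by simp
    also have "\<dots> = (\<integral>y. exp (- qf g J x) * (y ^ 0 * exp (- (2 * L) * y)) \<partial>hl)"
      using L by (subst integral_mult_right_zero, subst has_bochner_integral_integral_eq[OF has_bochner_integral_hl_power_exp]) auto
    also have "\<dots> = (\<integral>y. exp (- qf g (insert i J) (x(i:=y))) \<partial>hl)"
      unfolding q by (intro Bochner_Integration.integral_cong refl) (simp add: exp_diff exp_minus field_simps)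
    finally show ?thesis .
  qed
  show ?thesis
    unfolding mom0_def hlP.product_integral_insert[OF J(1,2) int0] hlP.product_integral_insert[OF J(1,2) int1]
    by (intro Bochner_Integration.integral_cong refl eq)
qed

text \<open>Together with \<open>mom2_row_other\<close> this is a complete linear system for the
  second moments: \<open>2 * g\<close> times their matrix equals the scalar matrix
  \<open>mom0 g J\<close> plus the matrix of first moments of the facets.\<close>

lemma mom2_row_same:
  assumes J: "finite J" "card J \<ge> 5" "i \<in> J"
  shows "(\<Sum>k\<in>J. 2 * g i k * mom2 g J k i) = mom0 g J"
proof -
  define I where "I = J - {i}"
  have I: "J = insert i I" "finite I" "i \<notin> I" "card I \<ge> 4" using J by (auto simp: I_def)
  have "(\<Sum>k\<in>J. 2 * g i k * mom2 g J k i) = (\<Sum>k\<in>J. (\<integral>a. 2 * g i k * (a k * a i * exp (- qf g J a)) \<partial>orthant J))"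
    by (simp add: mom2_def)
  also have "\<dots> = (\<integral>a. (\<Sum>k\<in>J. 2 * g i k * (a k * a i * exp (- qf g J a))) \<partial>orthant J)"
    using J by (intro Bochner_Integration.integral_sum[symmetric] integrable_mult_right integrable_mom2) auto
  also have "\<dots> = (\<integral>a. a i * (2 * (\<Sum>k\<in>I. g i k * a k)) * exp (- qf g J a) \<partial>orthant J)"
    using I(2,3) by (intro Bochner_Integration.integral_cong refl)
      (simp add: I(1) diag sum_distrib_left sum_distrib_right mult_ac)
  also have "\<dots> = mom0 g J"
    using integral_by_parts_same[OF I(2,3,4)] I(1) by simp
  finally show ?thesis .
qed

lemma mom2_row_other:
  assumes J: "finite J" "card J \<ge> 5" "i \<in> J" "l \<in> J" "l \<noteq> i"
  shows "(\<Sum>k\<in>J. 2 * g i k * mom2 g J k l) = mom1 g (J - {i}) l"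
proof -
  define I where "I = J - {i}"
  have I: "J = insert i I" "finite I" "i \<notin> I" using J by (auto simp: I_def)
  then have ne: "I \<noteq> {}" using J by auto
  have eq: "(\<lambda>a. \<Sum>k\<in>J. 2 * g i k * (a k * a l * exp (- qf g J a))) = (\<lambda>a. a l * (2 * (\<Sum>k\<in>I. g i k * a k)) * exp (- qf g J a))"
    using I(2,3) by (simp add: I(1) diag sum_distrib_left sum_distrib_right mult_ac)
  have int: "integrable (orthant J) (\<lambda>a. \<Sum>k\<in>J. 2 * g i k * (a k * a l * exp (- qf g J a)))"
    using J by (intro Bochner_Integration.integrable_sum integrable_mult_right integrable_mom2) auto
  have "(\<Sum>k\<in>J. 2 * g i k * mom2 g J k l) = (\<Sum>k\<in>J. (\<integral>a. 2 * g i k * (a k * a l * exp (- qf g J a)) \<partial>orthant J))"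
    by (simp add: mom2_def)
  also have "\<dots> = (\<integral>a. (\<Sum>k\<in>J. 2 * g i k * (a k * a l * exp (- qf g J a))) \<partial>orthant J)"
    using J by (intro Bochner_Integration.integral_sum[symmetric] integrable_mult_right integrable_mom2) auto
  also have "\<dots> = (\<integral>a. a l * exp (- qf g I a) \<partial>orthant I)"
    unfolding eq using integral_by_parts[OF I(2) ne I(3), of "\<lambda>a. a l"] int[unfolded eq] J(5) I(1) by simp
  finally show ?thesis by (simp add: mom1_def I_def)
qed

text \<open>Applied to a facet \<open>{..<5} - {i}\<close>, this supplies only the four equations
  with index different from \<open>i\<close>. The five-dimensional system is thus one equation
  short, which \<open>schlaefli_algebra\<close> makes up for.\<close>

lemma mom1_row:
  assumes J: "finite J" "card J \<ge> 4" "i \<in> J"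
  shows "(\<Sum>k\<in>J. 2 * g i k * mom1 g J k) = mom0 g (J - {i})"
proof -
  define I where "I = J - {i}"
  have I: "J = insert i I" "finite I" "i \<notin> I" "card I \<ge> 3" using J by (auto simp: I_def)
  then have ne: "I \<noteq> {}" by auto
  have eq: "(\<lambda>a. \<Sum>k\<in>J. 2 * g i k * (a k * exp (- qf g J a))) = (\<lambda>a. 1 * (2 * (\<Sum>k\<in>I. g i k * a k)) * exp (- qf g J a))"
    using I(2,3) by (simp add: I(1) diag sum_distrib_left sum_distrib_right mult_ac)
  have int: "integrable (orthant J) (\<lambda>a. \<Sum>k\<in>J. 2 * g i k * (a k * exp (- qf g J a)))"
    using J by (intro Bochner_Integration.integrable_sum integrable_mult_right integrable_mom1) auto
  have "(\<Sum>k\<in>J. 2 * g i k * mom1 g J k) = (\<Sum>k\<in>J. (\<integral>a. 2 * g i k * (a k * exp (- qf g J a)) \<partial>orthant J))"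
    by (simp add: mom1_def)
  also have "\<dots> = (\<integral>a. (\<Sum>k\<in>J. 2 * g i k * (a k * exp (- qf g J a))) \<partial>orthant J)"
    using J by (intro Bochner_Integration.integral_sum[symmetric] integrable_mult_right integrable_mom1) auto
  also have "\<dots> = (\<integral>a. 1 * exp (- qf g I a) \<partial>orthant I)"
    unfolding eq using integral_by_parts[OF I(2) ne I(3), of "\<lambda>a. 1"] int[unfolded eq] I(1) by simp
  finally show ?thesis by (simp add: mom0_def I_def)
qed

end

section \<open>The Gaussian integral over a three-dimensional orthant\<close>

lemma nn_integral_hl_scale:
  assumes f: "f \<in> borel_measurable borel" and c: "c > 0"
  shows "(\<integral>\<^sup>+x. f x \<partial>hl) = ennreal c * (\<integral>\<^sup>+x. f (c * x) \<partial>hl)"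
proof -
  have f': "(\<lambda>x. f (c * x)) \<in> borel_measurable borel"
    by (rule measurable_compose[OF _ f]) simp
  have f'': "(\<lambda>x. f x * indicator {0<..} x) \<in> borel_measurable borel"
    by (rule borel_measurable_times_ennreal[OF f]) simp
  have "(\<integral>\<^sup>+x. f x \<partial>hl) = (\<integral>\<^sup>+x. f x * indicator {0<..} x \<partial>lborel)"
    by (rule nn_integral_hl[OF f])
  also have "\<dots> = ennreal \<bar>c\<bar> * (\<integral>\<^sup>+x. f (0 + c * x) * indicator {0<..} (0 + c * x) \<partial>lborel)"
    by (rule nn_integral_real_affine[OF f'']) (use c in simp)
  also have "(\<integral>\<^sup>+x. f (0 + c * x) * indicator {0<..} (0 + c * x) \<partial>lborel) = (\<integral>\<^sup>+x. f (c * x) * indicator {0<..} x \<partial>lborel)"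
  proof (rule nn_integral_cong)
    fix x :: real
    have 1: "(0 + c * x \<in> {0<..}) = (x \<in> {0<..})" using c by (simp add: zero_less_mult_iff)
    have 2: "indicator {0<..} (0 + c * x) = (indicator {0<..} x :: ennreal)"
      unfolding indicator_def using 1 by (rule arg_cong)
    show "f (0 + c * x) * indicator {0<..} (0 + c * x) = f (c * x) * indicator {0<..} x"
      unfolding 2 by (simp only: add_0)
  qed
  also have "\<dots> = (\<integral>\<^sup>+x. f (c * x) \<partial>hl)"
    by (rule nn_integral_hl[OF f', symmetric])
  finally show ?thesis using c by simp
qed

text \<open>Two cases occur: \<open>k = 0\<close> in \<open>nn_integral_triple\<close> and
  \<open>k = 2\<close> in the radial integral of \<open>hyp_volume\<close>.\<close>

lemma nn_integral_hl_gaussian_moment: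
  assumes c: "c > 0"
  shows "(\<integral>\<^sup>+x. ennreal (x ^ (2 * k) * exp (- c * x\<^sup>2)) \<partial>hl) =
     ennreal (sqrt pi / 2 * (fact (2 * k) / (2 ^ (2 * k) * fact k)) / sqrt c ^ (2 * k + 1))"
proof -
  define v where "v = sqrt pi / 2 * (fact (2 * k) / (2 ^ (2 * k) * fact k))"
  have "(\<integral>\<^sup>+x. ennreal (indicator {0..} x *\<^sub>R (exp (-x\<^sup>2)*x^(2 * k))) \<partial>lborel) = ennreal v"
  proof -
    note m = gaussian_moment_even_pos[of k, folded v_def]
    have "(\<integral>\<^sup>+x. ennreal (indicator {0..} x *\<^sub>R (exp (-x\<^sup>2)*x^(2 * k))) \<partial>lborel) =
        ennreal (\<integral>x. indicator {0..} x *\<^sub>R (exp (-x\<^sup>2)*x^(2 * k)) \<partial>lborel)"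
      by (rule nn_integral_eq_integral) (use m in \<open>auto simp: has_bochner_integral_iff indicator_def\<close>)
    then show ?thesis using has_bochner_integral_integral_eq[OF m] by simp
  qed
  then have "ennreal v = (\<integral>\<^sup>+x. ennreal (x ^ (2 * k) * exp (- x\<^sup>2)) * indicator {0<..} x \<partial>lborel)"
    by (subst (asm) nn_integral_cong_AE[where v="\<lambda>x. ennreal (x ^ (2 * k) * exp (- x\<^sup>2)) * indicator {0<..} x"])
       (auto intro!: AE_I[where N="{0}"] simp: indicator_def mult_ac split: if_splits)
  also have "\<dots> = (\<integral>\<^sup>+x. ennreal (x ^ (2 * k) * exp (- x\<^sup>2)) \<partial>hl)"
    by (rule nn_integral_hl[symmetric]) simp
  also have "\<dots> = ennreal (sqrt c) * (\<integral>\<^sup>+x. ennreal ((sqrt c * x) ^ (2 * k) * exp (- (sqrt c * x)\<^sup>2)) \<partial>hl)"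
    using c by (intro nn_integral_hl_scale) auto
  also have "(\<integral>\<^sup>+x. ennreal ((sqrt c * x) ^ (2 * k) * exp (- (sqrt c * x)\<^sup>2)) \<partial>hl) =
     (\<integral>\<^sup>+x. ennreal (sqrt c ^ (2 * k)) * ennreal (x ^ (2 * k) * exp (- c * x\<^sup>2)) \<partial>hl)"
    using c by (intro nn_integral_cong) (simp add: power_mult_distrib ennreal_mult'[symmetric] mult_ac)
  also have "\<dots> = ennreal (sqrt c ^ (2 * k)) * (\<integral>\<^sup>+x. ennreal (x ^ (2 * k) * exp (- c * x\<^sup>2)) \<partial>hl)"
    by (rule nn_integral_cmult) (intro measurable_hl, measurable)
  finally have eq: "ennreal v = ennreal (sqrt c ^ (2 * k + 1)) * (\<integral>\<^sup>+x. ennreal (x ^ (2 * k) * exp (- c * x\<^sup>2)) \<partial>hl)"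
    using c by (simp add: ennreal_mult' mult_ac)
  have "ennreal (v / sqrt c ^ (2 * k + 1)) = ennreal (inverse (sqrt c ^ (2 * k + 1))) * ennreal v"
    using c by (subst ennreal_mult'[symmetric]) (auto simp: divide_inverse mult_ac)
  also have "\<dots> = (ennreal (inverse (sqrt c ^ (2 * k + 1))) * ennreal (sqrt c ^ (2 * k + 1))) * (\<integral>\<^sup>+x. ennreal (x ^ (2 * k) * exp (- c * x\<^sup>2)) \<partial>hl)"
    unfolding eq by (simp only: mult.assoc)
  also have "ennreal (inverse (sqrt c ^ (2 * k + 1))) * ennreal (sqrt c ^ (2 * k + 1)) = 1"
  proof -
    have "inverse (sqrt c ^ (2 * k + 1)) * sqrt c ^ (2 * k + 1) = 1" using c by (intro left_inverse) auto
    then show ?thesis using c by (subst ennreal_mult'[symmetric]) (auto simp del: power_Suc)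
  qed
  finally show ?thesis by (simp add: v_def)
qed

text \<open>The antiderivative is an arctangent that runs from 0 to \<open>pi / 2\<close> whatever
  \<alpha> and \<beta> are; this is the analytic source of the constant area of ideal
  triangles.\<close>

lemma nn_integral_hl_arctan:
  fixes \<alpha> \<beta> :: real
  assumes ab: "\<alpha> > 0" "\<beta> > 0"
  shows "(\<integral>\<^sup>+x. ennreal (1 / ((\<alpha> * x + \<beta>) * sqrt x)) \<partial>hl) = ennreal (pi / sqrt (\<alpha> * \<beta>))"
proof -
  define f where "f x = 1 / ((\<alpha> * x + \<beta>) * sqrt x)" for x
  define F where "F x = 2 / sqrt (\<alpha> * \<beta>) * arctan (sqrt (\<alpha> / \<beta>) * sqrt x)" for x
  have sab: "sqrt \<alpha> > 0" "sqrt \<beta> > 0" "sqrt \<alpha> * sqrt \<alpha> = \<alpha>" "sqrt \<beta> * sqrt \<beta> = \<beta>" using ab by auto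
  have deriv: "DERIV F x :> f x" if "x > 0" for x
  proof -
    have sx: "sqrt x > 0" "sqrt x * sqrt x = x" using that by auto
    have "DERIV F x :> 2 / sqrt (\<alpha> * \<beta>) * (inverse (1 + (sqrt (\<alpha> / \<beta>) * sqrt x)\<^sup>2) * (sqrt (\<alpha> / \<beta>) * (inverse (sqrt x) / 2)))"
    proof -
      have "DERIV (\<lambda>x. sqrt (\<alpha> / \<beta>) * sqrt x) x :> sqrt (\<alpha> / \<beta>) * (inverse (sqrt x) / 2)"
        by (intro DERIV_cmult DERIV_real_sqrt that)
      from DERIV_cmult[OF DERIV_chain2[OF DERIV_arctan this]] show ?thesis
        unfolding F_def[abs_def] .
    qed
    also have "2 / sqrt (\<alpha> * \<beta>) * (inverse (1 + (sqrt (\<alpha> / \<beta>) * sqrt x)\<^sup>2) * (sqrt (\<alpha> / \<beta>) * (inverse (sqrt x) / 2))) =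
       (sqrt (\<alpha> / \<beta>) / sqrt (\<alpha> * \<beta>)) * inverse (1 + \<alpha> / \<beta> * x) * inverse (sqrt x)"
      using ab that by (simp add: power_mult_distrib)
    also have "sqrt (\<alpha> / \<beta>) / sqrt (\<alpha> * \<beta>) = inverse \<beta>"
      using sab ab by (simp add: real_sqrt_mult real_sqrt_divide field_simps)
    also have "inverse \<beta> * inverse (1 + \<alpha> / \<beta> * x) * inverse (sqrt x) = f x"
      unfolding f_def using ab that by (simp add: field_simps)
    finally show ?thesis .
  qed
  have "((\<lambda>x. F x) \<longlongrightarrow> 2 / sqrt (\<alpha> * \<beta>) * arctan (sqrt (\<alpha> / \<beta>) * sqrt 0)) (at_right 0)"
    unfolding F_def by (intro tendsto_intros)
  then have "((\<lambda>x. F x) \<longlongrightarrow> 0) (at_right 0)" by simp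
  then have A: "((F \<circ> real_of_ereal) \<longlongrightarrow> 0) (at_right 0)"
    unfolding zero_ereal_def by (subst ereal_tendsto_simps1) auto
  have "filterlim (\<lambda>x. sqrt (\<alpha> / \<beta>) * sqrt x) at_top at_top"
    using ab by (intro filterlim_tendsto_pos_mult_at_top[OF tendsto_const]) (auto intro: sqrt_at_top)
  then have "((\<lambda>x. arctan (sqrt (\<alpha> / \<beta>) * sqrt x)) \<longlongrightarrow> pi / 2) at_top"
    by (rule filterlim_compose[OF tendsto_arctan_at_top])
  then have "((\<lambda>x. F x) \<longlongrightarrow> 2 / sqrt (\<alpha> * \<beta>) * (pi / 2)) at_top"
    unfolding F_def by (intro tendsto_intros)
  then have B: "((F \<circ> real_of_ereal) \<longlongrightarrow> pi / sqrt (\<alpha> * \<beta>)) (at_left \<infinity>)"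
    by (subst ereal_tendsto_simps1) auto
  have ei: "einterval 0 \<infinity> = {0<..}" by (auto simp: einterval_def)
  have nn: "0 \<le> f x" if "x > 0" for x using that ab by (simp add: f_def)
  have cont: "isCont f x" if "x > 0" for x
    unfolding f_def[abs_def] using that ab by (intro continuous_intros) (auto simp: add_pos_pos less_imp_neq[symmetric])
  note FTC = interval_integral_FTC_nonneg[where f=f and F=F and a=0 and b="\<infinity>", OF _ _ _ _ A B]
  have int: "set_integrable lborel {0<..} f" and val: "(LBINT x=0..\<infinity>. f x) = pi / sqrt (\<alpha> * \<beta>)"
    using FTC(1) FTC(2) deriv cont nn by (auto simp: ei)
  have val': "(\<integral>x. indicator {0<..} x *\<^sub>R f x \<partial>lborel) = pi / sqrt (\<alpha> * \<beta>)"
    using val by (simp add: interval_lebesgue_integral_def set_lebesgue_integral_def ei)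
  have "(\<integral>\<^sup>+x. ennreal (f x) \<partial>hl) = (\<integral>\<^sup>+x. ennreal (f x) * indicator {0<..} x \<partial>lborel)"
    unfolding f_def by (rule nn_integral_hl) measurable
  also have "\<dots> = (\<integral>\<^sup>+x. ennreal (indicator {0<..} x *\<^sub>R f x) \<partial>lborel)"
    by (intro nn_integral_cong) (auto simp: indicator_def)
  also have "\<dots> = ennreal (\<integral>x. indicator {0<..} x *\<^sub>R f x \<partial>lborel)"
    using int unfolding set_integrable_def by (intro nn_integral_eq_integral) (auto simp: indicator_def nn)
  finally show ?thesis using val' by (simp only: f_def)
qed

text \<open>The innermost integral is exponential and leaves a rational factor homogeneous in
  \<open>x\<close> and \<open>y\<close>. Substituting \<open>y = x * t\<close> moves that factor to
  \<open>t\<close> alone, and \<open>x\<close> is left in a Gaussian; after exchanging the order of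
  integration the integral over \<open>t\<close> is \<open>nn_integral_hl_arctan\<close>.\<close>

lemma nn_integral_triple:
  fixes \<alpha> \<beta> \<gamma> :: real
  assumes p: "\<alpha> > 0" "\<beta> > 0" "\<gamma> > 0"
  shows "(\<integral>\<^sup>+x. (\<integral>\<^sup>+y. (\<integral>\<^sup>+z. ennreal (exp (- (2 * (\<alpha> * (y * z) + \<beta> * (x * z) + \<gamma> * (x * y))))) \<partial>hl) \<partial>hl) \<partial>hl) =
     ennreal (pi * sqrt pi / (4 * sqrt (2 * (\<alpha> * \<beta> * \<gamma>))))"
proof -
  have inner: "(\<integral>\<^sup>+z. ennreal (exp (- (2 * (\<alpha> * (y * z) + \<beta> * (x * z) + \<gamma> * (x * y))))) \<partial>hl) =
      ennreal (exp (- (2 * \<gamma> * x * y)) / (2 * (\<alpha> * y + \<beta> * x)))" if "x > 0" "y > 0" for x y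
  proof -
    have c: "2 * (\<alpha> * y + \<beta> * x) > 0" using that p by (simp add: add_pos_pos)
    have "(\<integral>\<^sup>+z. ennreal (exp (- (2 * (\<alpha> * (y * z) + \<beta> * (x * z) + \<gamma> * (x * y))))) \<partial>hl) =
        (\<integral>\<^sup>+z. ennreal (exp (- (2 * \<gamma> * x * y))) * ennreal (z ^ 0 * exp (- (2 * (\<alpha> * y + \<beta> * x)) * z)) \<partial>hl)"
      by (intro nn_integral_cong) (simp add: ennreal_mult'[symmetric] exp_add[symmetric] algebra_simps)
    also have "\<dots> = ennreal (exp (- (2 * \<gamma> * x * y))) * (\<integral>\<^sup>+z. ennreal (z ^ 0 * exp (- (2 * (\<alpha> * y + \<beta> * x)) * z)) \<partial>hl)"
      by (rule nn_integral_cmult) (rule measurable_hl, simp)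
    also have "\<dots> = ennreal (exp (- (2 * \<gamma> * x * y)) / (2 * (\<alpha> * y + \<beta> * x)))"
      using c by (subst nn_integral_hl_power_exp[OF c]) (simp add: ennreal_mult'[symmetric])
    finally show ?thesis .
  qed
  have middle: "(\<integral>\<^sup>+y. ennreal (exp (- (2 * \<gamma> * x * y)) / (2 * (\<alpha> * y + \<beta> * x))) \<partial>hl) =
      (\<integral>\<^sup>+t. ennreal (1 / (2 * (\<alpha> * t + \<beta>))) * ennreal (x ^ (2 * 0) * exp (- (2 * \<gamma> * t) * x\<^sup>2)) \<partial>hl)" if x: "x > 0" for x
  proof -
    have "(\<integral>\<^sup>+y. ennreal (exp (- (2 * \<gamma> * x * y)) / (2 * (\<alpha> * y + \<beta> * x))) \<partial>hl) =
      ennreal x * (\<integral>\<^sup>+t. ennreal (exp (- (2 * \<gamma> * x * (x * t))) / (2 * (\<alpha> * (x * t) + \<beta> * x))) \<partial>hl)"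
      by (rule nn_integral_hl_scale[OF _ x]) measurable
    also have "\<dots> = (\<integral>\<^sup>+t. ennreal x * ennreal (exp (- (2 * \<gamma> * x * (x * t))) / (2 * (\<alpha> * (x * t) + \<beta> * x))) \<partial>hl)"
      by (rule nn_integral_cmult[symmetric]) (rule measurable_hl, measurable)
    also have "\<dots> = (\<integral>\<^sup>+t. ennreal (1 / (2 * (\<alpha> * t + \<beta>))) * ennreal (x ^ (2 * 0) * exp (- (2 * \<gamma> * t) * x\<^sup>2)) \<partial>hl)"
    proof (rule nn_integral_cong)
      fix t assume "t \<in> space hl"
      then have t: "t > 0" by simp
      have d: "\<alpha> * t + \<beta> > 0" using t p by (simp add: add_pos_pos)
      have "x * (exp (- (2 * \<gamma> * x * (x * t))) / (2 * (\<alpha> * (x * t) + \<beta> * x))) =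
        (1 / (2 * (\<alpha> * t + \<beta>))) * (x ^ (2 * 0) * exp (- (2 * \<gamma> * t) * x\<^sup>2))"
      proof -
        have "2 * (\<alpha> * (x * t) + \<beta> * x) = x * (2 * (\<alpha> * t + \<beta>))" by (simp add: algebra_simps)
        moreover have "- (2 * \<gamma> * x * (x * t)) = - (2 * \<gamma> * t) * x\<^sup>2" by (simp add: power2_eq_square)
        ultimately show ?thesis using x by simp
      qed
      then show "ennreal x * ennreal (exp (- (2 * \<gamma> * x * (x * t))) / (2 * (\<alpha> * (x * t) + \<beta> * x))) =
        ennreal (1 / (2 * (\<alpha> * t + \<beta>))) * ennreal (x ^ (2 * 0) * exp (- (2 * \<gamma> * t) * x\<^sup>2))"
        using x d by (simp add: ennreal_mult'[symmetric])
    qed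
    finally show ?thesis .
  qed
  have outer: "(\<integral>\<^sup>+x. ennreal (1 / (2 * (\<alpha> * t + \<beta>))) * ennreal (x ^ (2 * 0) * exp (- (2 * \<gamma> * t) * x\<^sup>2)) \<partial>hl) =
      ennreal (sqrt (pi / (2 * \<gamma>)) / 4) * ennreal (1 / ((\<alpha> * t + \<beta>) * sqrt t))" if t: "t > 0" for t
  proof -
    have c: "2 * \<gamma> * t > 0" using t p by simp
    have "(\<integral>\<^sup>+x. ennreal (1 / (2 * (\<alpha> * t + \<beta>))) * ennreal (x ^ (2 * 0) * exp (- (2 * \<gamma> * t) * x\<^sup>2)) \<partial>hl) =
      ennreal (1 / (2 * (\<alpha> * t + \<beta>))) * (\<integral>\<^sup>+x. ennreal (x ^ (2 * 0) * exp (- (2 * \<gamma> * t) * x\<^sup>2)) \<partial>hl)"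
      by (rule nn_integral_cmult) (rule measurable_hl, measurable)
    also have "\<dots> = ennreal (1 / (2 * (\<alpha> * t + \<beta>))) * ennreal (sqrt pi / 2 / sqrt (2 * \<gamma> * t))"
      by (subst nn_integral_hl_gaussian_moment[OF c]) simp
    also have "\<dots> = ennreal (sqrt (pi / (2 * \<gamma>)) / 4) * ennreal (1 / ((\<alpha> * t + \<beta>) * sqrt t))"
      using t p by (simp add: ennreal_mult'[symmetric] real_sqrt_mult real_sqrt_divide add_pos_pos mult_ac)
    finally show ?thesis .
  qed
  have meas: "(\<lambda>(x, t). ennreal (1 / (2 * (\<alpha> * t + \<beta>))) * ennreal (x ^ (2 * 0) * exp (- (2 * \<gamma> * t) * x\<^sup>2))) \<in> borel_measurable (hl \<Otimes>\<^sub>M hl)"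
  proof -
    have 1: "fst \<in> borel_measurable (hl \<Otimes>\<^sub>M hl)"
      using measurable_compose[OF measurable_fst measurable_hl[of "\<lambda>x. x"]] by simp
    have 2: "snd \<in> borel_measurable (hl \<Otimes>\<^sub>M hl)"
      using measurable_compose[OF measurable_snd measurable_hl[of "\<lambda>x. x"]] by simp
    have "(\<lambda>z. ennreal (1 / (2 * (\<alpha> * snd z + \<beta>))) * ennreal (fst z ^ (2 * 0) * exp (- (2 * \<gamma> * snd z) * (fst z)\<^sup>2))) \<in> borel_measurable (hl \<Otimes>\<^sub>M hl)"
      using 1 2 by (intro borel_measurable_times_ennreal measurable_compose[OF _ measurable_ennreal] borel_measurable_divide borel_measurable_times
        borel_measurable_add borel_measurable_const borel_measurable_power measurable_compose[OF _ borel_measurable_exp] borel_measurable_uminus)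
    then show ?thesis unfolding case_prod_beta' .
  qed
  interpret hl2: pair_sigma_finite hl hl
    by (simp add: pair_sigma_finite_def sigma_finite_hl)
  have "(\<integral>\<^sup>+x. (\<integral>\<^sup>+y. (\<integral>\<^sup>+z. ennreal (exp (- (2 * (\<alpha> * (y * z) + \<beta> * (x * z) + \<gamma> * (x * y))))) \<partial>hl) \<partial>hl) \<partial>hl) =
     (\<integral>\<^sup>+x. (\<integral>\<^sup>+y. ennreal (exp (- (2 * \<gamma> * x * y)) / (2 * (\<alpha> * y + \<beta> * x))) \<partial>hl) \<partial>hl)"
    by (intro nn_integral_cong inner) auto
  also have "\<dots> = (\<integral>\<^sup>+x. (\<integral>\<^sup>+t. ennreal (1 / (2 * (\<alpha> * t + \<beta>))) * ennreal (x ^ (2 * 0) * exp (- (2 * \<gamma> * t) * x\<^sup>2)) \<partial>hl) \<partial>hl)"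
    by (intro nn_integral_cong middle) auto
  also have "\<dots> = (\<integral>\<^sup>+t. (\<integral>\<^sup>+x. ennreal (1 / (2 * (\<alpha> * t + \<beta>))) * ennreal (x ^ (2 * 0) * exp (- (2 * \<gamma> * t) * x\<^sup>2)) \<partial>hl) \<partial>hl)"
    using hl2.Fubini'[OF meas] by simp
  also have "\<dots> = (\<integral>\<^sup>+t. ennreal (sqrt (pi / (2 * \<gamma>)) / 4) * ennreal (1 / ((\<alpha> * t + \<beta>) * sqrt t)) \<partial>hl)"
    by (intro nn_integral_cong outer) auto
  also have "\<dots> = ennreal (sqrt (pi / (2 * \<gamma>)) / 4) * (\<integral>\<^sup>+t. ennreal (1 / ((\<alpha> * t + \<beta>) * sqrt t)) \<partial>hl)"
    by (rule nn_integral_cmult) (rule measurable_hl, measurable)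
  also have "\<dots> = ennreal (sqrt (pi / (2 * \<gamma>)) / 4 * (pi / sqrt (\<alpha> * \<beta>)))"
    using p by (simp add: nn_integral_hl_arctan ennreal_mult'[symmetric])
  also have "sqrt (pi / (2 * \<gamma>)) / 4 * (pi / sqrt (\<alpha> * \<beta>)) = pi * sqrt pi / (4 * sqrt (2 * (\<alpha> * \<beta> * \<gamma>)))"
    by (simp add: real_sqrt_mult real_sqrt_divide mult_ac)
  finally show ?thesis .
qed

context pos_off_diag
begin

text \<open>The radicand \<open>2 * (g k m * g k n * g m n)\<close> is the determinant of the 3 by 3
  block, and the constant \<open>pi * sqrt pi / 4\<close> is the area \<open>pi\<close> of an ideal
  triangle times the integral \<open>sqrt pi / 4\<close> of
  \<open>s\<^sup>2 * exp (- s\<^sup>2)\<close> over the half-line.\<close>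

lemma mom0_triple:
  assumes d: "k \<noteq> m" "k \<noteq> n" "m \<noteq> n"
  shows "mom0 g {k, m, n} = pi * sqrt pi / (4 * sqrt (2 * (g k m * g k n * g m n)))"
proof -
  have m0: "(\<lambda>a. ennreal (exp (- qf g J a))) \<in> borel_measurable (orthant J)" for J
    using measurable_compose[OF exp_qf_measurable measurable_ennreal] .
  have 1: "(\<integral>\<^sup>+a. ennreal (exp (- qf g {k,m,n} a)) \<partial>orthant {k,m,n}) =
    (\<integral>\<^sup>+a. (\<integral>\<^sup>+z. ennreal (exp (- qf g {k,m,n} (a(k:=z)))) \<partial>hl) \<partial>orthant {m,n})"
    by (rule hlP.product_nn_integral_insert[OF _ _ m0]) (use d in auto)
  have m1: "(\<lambda>a. (\<integral>\<^sup>+z. ennreal (exp (- qf g {k,m,n} (a(k:=z)))) \<partial>hl)) \<in> borel_measurable (orthant {m,n})"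
  proof -
    have "(\<lambda>(a, z). a(k := z)) \<in> measurable (orthant {m,n} \<Otimes>\<^sub>M hl) (orthant (insert k {m,n}))"
      by (rule measurable_add_dim)
    from measurable_compose[OF this m0]
    have "(\<lambda>(a, z). ennreal (exp (- qf g {k,m,n} (a(k:=z))))) \<in> borel_measurable (orthant {m,n} \<Otimes>\<^sub>M hl)"
      unfolding case_prod_beta' .
    then show ?thesis by (rule sigma_finite_measure.borel_measurable_nn_integral[OF sigma_finite_hl])
  qed
  have 2: "(\<integral>\<^sup>+a. (\<integral>\<^sup>+z. ennreal (exp (- qf g {k,m,n} (a(k:=z)))) \<partial>hl) \<partial>orthant {m,n}) =
    (\<integral>\<^sup>+a. (\<integral>\<^sup>+y. (\<integral>\<^sup>+z. ennreal (exp (- qf g {k,m,n} ((a(m:=y))(k:=z)))) \<partial>hl) \<partial>hl) \<partial>orthant {n})"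
    by (rule hlP.product_nn_integral_insert[OF _ _ m1]) (use d in auto)
  have q: "qf g {k,m,n} ((a(m:=y))(k:=z)) = 2 * (g k m * (y * z) + g k n * (a n * z) + g m n * (a n * y))" for a y z
    unfolding qf_def using d by (simp add: diag sym[of m k] sym[of n k] sym[of n m] algebra_simps)
  have 3: "(\<integral>\<^sup>+a. (\<integral>\<^sup>+y. (\<integral>\<^sup>+z. ennreal (exp (- (2 * (g k m * (y * z) + g k n * (a n * z) + g m n * (a n * y))))) \<partial>hl) \<partial>hl) \<partial>orthant {n}) =
    (\<integral>\<^sup>+x. (\<integral>\<^sup>+y. (\<integral>\<^sup>+z. ennreal (exp (- (2 * (g k m * (y * z) + g k n * (x * z) + g m n * (x * y))))) \<partial>hl) \<partial>hl) \<partial>hl)"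
  proof (rule hlP.product_nn_integral_singleton)
    have id: "(\<lambda>x. x) \<in> measurable hl borel" by (rule measurable_hl) simp
    have c1: "(\<lambda>w. fst (fst w)) \<in> borel_measurable ((hl \<Otimes>\<^sub>M hl) \<Otimes>\<^sub>M hl)"
      "(\<lambda>w. snd (fst w)) \<in> borel_measurable ((hl \<Otimes>\<^sub>M hl) \<Otimes>\<^sub>M hl)"
      "(\<lambda>w. snd w) \<in> borel_measurable ((hl \<Otimes>\<^sub>M hl) \<Otimes>\<^sub>M hl)"
      by (rule measurable_compose[OF measurable_compose[OF measurable_fst measurable_fst] id]
        measurable_compose[OF measurable_compose[OF measurable_fst measurable_snd] id] measurable_compose[OF measurable_snd id])+
    have "(\<lambda>w. ennreal (exp (- (2 * (g k m * (snd (fst w) * snd w) + g k n * (fst (fst w) * snd w) + g m n * (fst (fst w) * snd (fst w))))))) \<in> borel_measurable ((hl \<Otimes>\<^sub>M hl) \<Otimes>\<^sub>M hl)"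
      using c1 by (intro measurable_compose[OF _ measurable_ennreal] borel_measurable_times
        borel_measurable_add borel_measurable_const measurable_compose[OF _ borel_measurable_exp] borel_measurable_uminus)
    then have "(\<lambda>(v, z). ennreal (exp (- (2 * (g k m * (snd v * z) + g k n * (fst v * z) + g m n * (fst v * snd v)))))) \<in> borel_measurable ((hl \<Otimes>\<^sub>M hl) \<Otimes>\<^sub>M hl)"
      unfolding case_prod_beta' .
    from sigma_finite_measure.borel_measurable_nn_integral[OF sigma_finite_hl this]
    have "(\<lambda>(x, y). \<integral>\<^sup>+z. ennreal (exp (- (2 * (g k m * (y * z) + g k n * (x * z) + g m n * (x * y))))) \<partial>hl) \<in> borel_measurable (hl \<Otimes>\<^sub>M hl)"
      unfolding case_prod_beta' .
    from sigma_finite_measure.borel_measurable_nn_integral[OF sigma_finite_hl this]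
    show "(\<lambda>x. \<integral>\<^sup>+y. \<integral>\<^sup>+z. ennreal (exp (- (2 * (g k m * (y * z) + g k n * (x * z) + g m n * (x * y))))) \<partial>hl \<partial>hl) \<in> borel_measurable hl" .
  qed
  have "(\<integral>\<^sup>+a. ennreal (exp (- qf g {k,m,n} a)) \<partial>orthant {k,m,n}) = ennreal (pi * sqrt pi / (4 * sqrt (2 * (g k m * g k n * g m n))))"
    unfolding 1 2 q 3 using d by (intro nn_integral_triple pos)
  moreover have "g k m * g k n * g m n > 0" using d pos by simp
  ultimately have "has_bochner_integral (orthant {k,m,n}) (\<lambda>a. exp (- qf g {k,m,n} a)) (pi * sqrt pi / (4 * sqrt (2 * (g k m * g k n * g m n))))"
    by (intro has_bochner_integral_nn_integral exp_qf_measurable) auto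
  then show ?thesis unfolding mom0_def by (rule has_bochner_integral_integral_eq)
qed

end

section \<open>Differentiation of the Gaussian integral along a segment of matrices\<close>

lemma qf_line: "qf (\<lambda>i j. (1 - t) * g i j + t * h i j) J a = (1 - t) * qf g J a + t * qf h J a"
  unfolding qf_def sum_distrib_left sum.distrib[symmetric]
  by (intro sum.cong refl) (simp add: algebra_simps)

lemma abs_exp_minus_diff_le:
  fixes x y c :: real
  assumes "c \<le> x" "c \<le> y"
  shows "\<bar>exp (- x) - exp (- y)\<bar> \<le> \<bar>x - y\<bar> * exp (- c)"
proof -
  have *: "exp (- u) - exp (- v) \<le> (v - u) * exp (- c)" if "u \<le> v" "c \<le> u" for u v
  proof -
    have "exp (- u) - exp (- v) = exp (- u) * (1 - exp (- (v - u)))"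
      by (simp add: right_diff_distrib exp_add[symmetric])
    also have "\<dots> \<le> exp (- u) * (v - u)"
    proof (rule mult_left_mono)
      show "1 - exp (- (v - u)) \<le> v - u" using exp_ge_add_one_self[of "- (v - u)"] by linarith
    qed simp
    also have "\<dots> \<le> exp (- c) * (v - u)"
      using that by (intro mult_right_mono) auto
    finally show ?thesis by (simp add: mult.commute)
  qed
  show ?thesis
    using *[of x y] *[of y x] assms by (cases "x \<le> y") (auto simp: abs_if)
qed

text \<open>Dominated convergence for the difference quotients: the smaller of the two lower bounds,
  \<open>m\<close>, is valid on the whole segment, and the quotient is at most a second moment of
  the corresponding weight, integrable because \<open>card J \<ge> 5\<close>. Both ends are
  included, with one-sided derivatives, so the degenerate end of the later segment causes no trouble
  here.\<close>

lemma mom0_line_derivative: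
  assumes g: "pos_off_diag g" and h: "pos_off_diag h" and J: "finite J" "card J \<ge> 5" and t: "t \<in> {0..1}"
  defines "G \<equiv> \<lambda>t i j. (1 - t) * g i j + t * h i j"
  shows "((\<lambda>t. mom0 (G t) J) has_real_derivative - (\<Sum>i\<in>J. \<Sum>j\<in>J. (h i j - g i j) * mom2 (G t) J i j)) (at t within {0..1})"
proof -
  interpret g: pos_off_diag g by fact
  interpret h: pos_off_diag h by fact
  obtain m1 where m1: "m1 > 0" "\<And>i j. i \<in> J \<Longrightarrow> j \<in> J \<Longrightarrow> i \<noteq> j \<Longrightarrow> m1 \<le> g i j"
    using g.lower_bound[OF J(1)] by blast
  obtain m2 where m2: "m2 > 0" "\<And>i j. i \<in> J \<Longrightarrow> j \<in> J \<Longrightarrow> i \<noteq> j \<Longrightarrow> m2 \<le> h i j"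
    using h.lower_bound[OF J(1)] by blast
  define m where "m = min m1 m2"
  have m: "m > 0" using m1 m2 by (simp add: m_def)
  have Gm: "m \<le> G s i j" if "s \<in> {0..1}" "i \<in> J" "j \<in> J" "i \<noteq> j" for s i j
  proof -
    have "m = (1 - s) * m + s * m" by (simp add: algebra_simps)
    also have "\<dots> \<le> G s i j"
      unfolding G_def using that m1(2)[of i j] m2(2)[of i j]
      by (intro add_mono mult_left_mono) (auto simp: m_def)
    finally show ?thesis .
  qed
  have Gp: "pos_off_diag (G s)" if "s \<in> {0..1}" for s
  proof
    show "G s i j = G s j i" for i j by (simp add: G_def g.sym[of i j] h.sym[of i j])
    show "G s i i = 0" for i by (simp add: G_def g.diag h.diag)
    show "G s i j > 0" if "i \<noteq> j" for i j
    proof (cases "s = 0")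
      case False
      then have "0 \<le> (1 - s) * g i j" "0 < s * h i j" using \<open>s \<in> _\<close> g.pos[OF that] h.pos[OF that] by auto
      then show ?thesis by (simp add: G_def)
    qed (simp add: G_def g.pos[OF that])
  qed
  define K where "K = (\<Sum>i\<in>J. \<Sum>j\<in>J. \<bar>h i j - g i j\<bar>)"
  define S where "S a = (\<Sum>i\<in>J. \<Sum>j\<in>J-{i}. a i * a j)" for a :: "nat \<Rightarrow> real"
  define B where "B a = (\<Sum>i\<in>J. \<Sum>j\<in>J. (h i j - g i j) * (a i * a j))" for a :: "nat \<Rightarrow> real"
  have Beq: "B a = qf h J a - qf g J a" for a
    unfolding B_def qf_def sum_subtractf[symmetric] by (intro sum.cong refl) (simp add: algebra_simps)
  have B: "\<bar>B a\<bar> \<le> K * (sum a J)\<^sup>2" if a: "\<And>j. j \<in> J \<Longrightarrow> a j > 0" for a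
  proof -
    have le: "a j \<le> sum a J" "0 \<le> a j" if "j \<in> J" for j
      using member_le_sum[of j J a] J a that by (auto simp: less_imp_le)
    have "\<bar>B a\<bar> \<le> (\<Sum>i\<in>J. \<Sum>j\<in>J. \<bar>(h i j - g i j) * (a i * a j)\<bar>)"
      unfolding B_def by (rule order_trans[OF sum_abs sum_mono[OF sum_abs]])
    also have "\<dots> \<le> (\<Sum>i\<in>J. \<Sum>j\<in>J. \<bar>h i j - g i j\<bar> * (sum a J)\<^sup>2)"
    proof (intro sum_mono)
      fix i j assume ij: "i \<in> J" "j \<in> J"
      have "0 \<le> sum a J" using le[OF ij(1)] by linarith
      then have "a i * a j \<le> (sum a J)\<^sup>2" unfolding power2_eq_square using le ij by (intro mult_mono) auto
      then show "\<bar>(h i j - g i j) * (a i * a j)\<bar> \<le> \<bar>h i j - g i j\<bar> * (sum a J)\<^sup>2"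
        unfolding abs_mult using le ij by (intro mult_left_mono) auto
    qed
    also have "\<dots> = K * (sum a J)\<^sup>2" by (simp add: K_def sum_distrib_right)
    finally show ?thesis .
  qed
  have int: "integrable (orthant J) (\<lambda>a. exp (- qf (G s) J a))" if "s \<in> {0..1}" for s
    using pos_off_diag.integrable_mom0[OF Gp[OF that] J(1)] J(2) by simp
  have int2: "integrable (orthant J) (\<lambda>a. a i * a j * exp (- qf (G t) J a))" if "i \<in> J" "j \<in> J" for i j
    using pos_off_diag.integrable_mom2[OF Gp[OF t] J] that by simp
  have qd: "qf (G s) J a - qf (G t) J a = (s - t) * B a" for s a
    unfolding G_def qf_line Beq by (simp add: algebra_simps)
  have dom: "integrable (orthant J) (\<lambda>a. K * ((sum a J) ^ 2 * exp (- m * S a)))"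
    unfolding S_def using integrable_power_sum_exp[of J 2 m] J m by (intro integrable_mult_right) auto
  have lim: "((\<lambda>s. (mom0 (G s) J - mom0 (G t) J) / (s - t)) \<longlongrightarrow> (\<integral>a. - B a * exp (- qf (G t) J a) \<partial>orthant J)) (at t within {0..1})"
    unfolding tendsto_at_iff_sequentially comp_def
  proof (intro allI impI)
    fix X :: "nat \<Rightarrow> real" assume X: "\<forall>i. X i \<in> {0..1} - {t}" and Xt: "X \<longlonglongrightarrow> t"
    then have X01: "X n \<in> {0..1}" and Xne: "X n \<noteq> t" for n by auto
    define F where "F n a = (exp (- qf (G (X n)) J a) - exp (- qf (G t) J a)) / (X n - t)" for n a
    have "(\<lambda>n. \<integral>a. F n a \<partial>orthant J) \<longlonglongrightarrow> (\<integral>a. - B a * exp (- qf (G t) J a) \<partial>orthant J)"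
    proof (rule integral_dominated_convergence[OF _ _ dom])
      show "F n \<in> borel_measurable (orthant J)" for n
        unfolding F_def[abs_def]
        by (rule borel_measurable_divide[OF borel_measurable_diff[OF exp_qf_measurable exp_qf_measurable] borel_measurable_const])
      have "(\<lambda>a. - (qf h J a - qf g J a)) \<in> borel_measurable (orthant J)"
        by (rule borel_measurable_uminus[OF borel_measurable_diff[OF qf_measurable qf_measurable]])
      then show "(\<lambda>a. - B a * exp (- qf (G t) J a)) \<in> borel_measurable (orthant J)"
        unfolding Beq by (rule borel_measurable_times[OF _ exp_qf_measurable])
      show "AE a in orthant J. (\<lambda>n. F n a) \<longlonglongrightarrow> - B a * exp (- qf (G t) J a)"
      proof (rule AE_I2)
        fix a assume "a \<in> space (orthant J)"
        define c where "c = qf (G t) J a - t * B a"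
        have qG: "qf (G s) J a = c + s * B a" for s
          using qd[of s a] by (simp add: c_def algebra_simps)
        have "((\<lambda>s. exp (- (c + s * B a))) has_real_derivative - B a * exp (- (c + t * B a))) (at t)"
          by (auto intro!: derivative_eq_intros)
        then have "((\<lambda>s. (exp (- (c + s * B a)) - exp (- (c + t * B a))) / (s - t)) \<longlongrightarrow> - B a * exp (- (c + t * B a))) (at t)"
          unfolding has_field_derivative_iff .
        then have "((\<lambda>n. (exp (- (c + X n * B a)) - exp (- (c + t * B a))) / (X n - t)) \<longlonglongrightarrow> - B a * exp (- (c + t * B a)))"
          by (rule filterlim_compose) (use Xt Xne in \<open>auto simp: filterlim_at\<close>)
        then show "(\<lambda>n. F n a) \<longlonglongrightarrow> - B a * exp (- qf (G t) J a)"
          unfolding F_def qG .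
      qed
      show "AE a in orthant J. norm (F n a) \<le> K * ((sum a J) ^ 2 * exp (- m * S a))" for n
      proof (rule AE_I2)
        fix a assume "a \<in> space (orthant J)"
        then have a: "a j > 0" if "j \<in> J" for j using that by (auto simp: space_PiM)
        have q: "m * S a \<le> qf (G s) J a" if "s \<in> {0..1}" for s
          unfolding S_def using Gm[OF that] pos_off_diag.diag[OF Gp[OF that]] a
          by (intro qf_ge[OF _ _ J(1)]) auto
        have "\<bar>exp (- qf (G (X n)) J a) - exp (- qf (G t) J a)\<bar> \<le> \<bar>(X n - t) * B a\<bar> * exp (- (m * S a))"
          using abs_exp_minus_diff_le[OF q[OF X01] q[OF t], of n] unfolding qd .
        then have "norm (F n a) \<le> \<bar>B a\<bar> * exp (- (m * S a))"
          using Xne[of n] unfolding F_def by (simp add: abs_mult divide_le_eq mult_ac)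
        also have "\<dots> \<le> (K * (sum a J)\<^sup>2) * exp (- (m * S a))"
          using B[OF a] by (intro mult_right_mono) auto
        finally show "norm (F n a) \<le> K * ((sum a J) ^ 2 * exp (- m * S a))" by simp
      qed
    qed
    also have "(\<lambda>n. \<integral>a. F n a \<partial>orthant J) = (\<lambda>n. (mom0 (G (X n)) J - mom0 (G t) J) / (X n - t))"
      unfolding F_def mom0_def using int[OF X01] int[OF t] by (simp add: Bochner_Integration.integral_diff)
    finally show "(\<lambda>n. (mom0 (G (X n)) J - mom0 (G t) J) / (X n - t)) \<longlonglongrightarrow> (\<integral>a. - B a * exp (- qf (G t) J a) \<partial>orthant J)" .
  qed
  have "(\<integral>a. - B a * exp (- qf (G t) J a) \<partial>orthant J) = (\<integral>a. - (\<Sum>i\<in>J. \<Sum>j\<in>J. (h i j - g i j) * (a i * a j * exp (- qf (G t) J a))) \<partial>orthant J)"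
    by (simp add: B_def sum_distrib_right mult.assoc)
  also have "\<dots> = - (\<Sum>i\<in>J. \<Sum>j\<in>J. (h i j - g i j) * mom2 (G t) J i j)"
    unfolding mom2_def using int2 by (simp add: Bochner_Integration.integral_sum)
  finally show ?thesis using lim unfolding has_field_derivative_iff by simp
qed

section \<open>The adjugate of a symmetric matrix of size 5 with zero diagonal\<close>

text \<open>
  The polynomials \<open>minor4\<close> and \<open>cof_off\<close> are the diagonal and the off-diagonal cofactors, written out in the
  entries; \<open>tri\<close> is half the determinant of the principal submatrix that omits the indices \<open>i\<close> and \<open>l\<close>.
\<close>

definition others :: "nat \<Rightarrow> nat \<Rightarrow> nat list" where
  "others i l = filter (\<lambda>x. x \<noteq> i \<and> x \<noteq> l) [0, 1, 2, 3, 4]"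

definition minor4 :: "(nat \<Rightarrow> nat \<Rightarrow> real) \<Rightarrow> nat \<Rightarrow> nat \<Rightarrow> nat \<Rightarrow> nat \<Rightarrow> real" where
  "minor4 g i j k l = (g i j * g k l)\<^sup>2 + (g i k * g j l)\<^sup>2 + (g i l * g j k)\<^sup>2
     - 2 * (g i j * g k l) * (g i k * g j l) - 2 * (g i j * g k l) * (g i l * g j k) - 2 * (g i k * g j l) * (g i l * g j k)"

definition cof_off :: "(nat \<Rightarrow> nat \<Rightarrow> real) \<Rightarrow> nat \<Rightarrow> nat \<Rightarrow> nat \<Rightarrow> nat \<Rightarrow> nat \<Rightarrow> real" where
  "cof_off g i l k m n =
     g k m * g m n * (g i k * g n l + g i n * g k l) + g k n * g m n * (g i k * g m l + g i m * g k l)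
     + g k m * g k n * (g i m * g n l + g i n * g m l)
     - 2 * g i l * (g k m * g k n * g m n)
     - (g k m)\<^sup>2 * g i n * g n l - (g k n)\<^sup>2 * g i m * g m l - (g m n)\<^sup>2 * g i k * g k l"

definition cof :: "(nat \<Rightarrow> nat \<Rightarrow> real) \<Rightarrow> nat \<Rightarrow> nat \<Rightarrow> real" where
  "cof g i l = (case others i l of [k, m, n] \<Rightarrow> cof_off g i l k m n | [j, k, m, n] \<Rightarrow> minor4 g j k m n | _ \<Rightarrow> 0)"

definition tri :: "(nat \<Rightarrow> nat \<Rightarrow> real) \<Rightarrow> nat \<Rightarrow> nat \<Rightarrow> real" where
  "tri g i l = (case others i l of [k, m, n] \<Rightarrow> g k m * g k n * g m n | _ \<Rightarrow> 0)"

definition det5 :: "(nat \<Rightarrow> nat \<Rightarrow> real) \<Rightarrow> real" where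
  "det5 g = (\<Sum>j<5. cof g 0 j * g j 0)"

lemma lessThan_5: "{..<5::nat} = {0, 1, 2, 3, 4}"
  by auto

lemma all_less_5: "(\<forall>i<5. P i) \<longleftrightarrow> P 0 \<and> P 1 \<and> P 2 \<and> P 3 \<and> P (4::nat)"
proof -
  have "(\<forall>i<5. P i) \<longleftrightarrow> (\<forall>i\<in>{..<5}. P i)" by auto
  then show ?thesis by (simp add: lessThan_5 del: One_nat_def)
qed

lemma sum_lessThan_5: "(\<Sum>j<5::nat. f j) = f 0 + f 1 + f 2 + f 3 + (f 4 :: 'a :: comm_monoid_add)"
  by (simp add: lessThan_5 add.assoc del: One_nat_def)

lemma cof_eval:
  "cof g 0 0 = minor4 g 1 2 3 4" "cof g 0 1 = cof_off g 0 1 2 3 4" "cof g 0 2 = cof_off g 0 2 1 3 4"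
  "cof g 0 3 = cof_off g 0 3 1 2 4" "cof g 0 4 = cof_off g 0 4 1 2 3" "cof g 1 0 = cof_off g 1 0 2 3 4"
  "cof g 1 1 = minor4 g 0 2 3 4" "cof g 1 2 = cof_off g 1 2 0 3 4" "cof g 1 3 = cof_off g 1 3 0 2 4"
  "cof g 1 4 = cof_off g 1 4 0 2 3" "cof g 2 0 = cof_off g 2 0 1 3 4" "cof g 2 1 = cof_off g 2 1 0 3 4"
  "cof g 2 2 = minor4 g 0 1 3 4" "cof g 2 3 = cof_off g 2 3 0 1 4" "cof g 2 4 = cof_off g 2 4 0 1 3"
  "cof g 3 0 = cof_off g 3 0 1 2 4" "cof g 3 1 = cof_off g 3 1 0 2 4" "cof g 3 2 = cof_off g 3 2 0 1 4"
  "cof g 3 3 = minor4 g 0 1 2 4" "cof g 3 4 = cof_off g 3 4 0 1 2" "cof g 4 0 = cof_off g 4 0 1 2 3"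
  "cof g 4 1 = cof_off g 4 1 0 2 3" "cof g 4 2 = cof_off g 4 2 0 1 3" "cof g 4 3 = cof_off g 4 3 0 1 2"
  "cof g 4 4 = minor4 g 0 1 2 3"
  by (simp_all add: cof_def others_def del: One_nat_def)

lemma tri_eval:
  "tri g 0 1 = g 2 3 * g 2 4 * g 3 4" "tri g 0 2 = g 1 3 * g 1 4 * g 3 4"
  "tri g 0 3 = g 1 2 * g 1 4 * g 2 4" "tri g 0 4 = g 1 2 * g 1 3 * g 2 3"
  "tri g 1 0 = g 2 3 * g 2 4 * g 3 4" "tri g 1 2 = g 0 3 * g 0 4 * g 3 4"
  "tri g 1 3 = g 0 2 * g 0 4 * g 2 4" "tri g 1 4 = g 0 2 * g 0 3 * g 2 3"
  "tri g 2 0 = g 1 3 * g 1 4 * g 3 4" "tri g 2 1 = g 0 3 * g 0 4 * g 3 4"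
  "tri g 2 3 = g 0 1 * g 0 4 * g 1 4" "tri g 2 4 = g 0 1 * g 0 3 * g 1 3"
  "tri g 3 0 = g 1 2 * g 1 4 * g 2 4" "tri g 3 1 = g 0 2 * g 0 4 * g 2 4"
  "tri g 3 2 = g 0 1 * g 0 4 * g 1 4" "tri g 3 4 = g 0 1 * g 0 2 * g 1 2"
  "tri g 4 0 = g 1 2 * g 1 3 * g 2 3" "tri g 4 1 = g 0 2 * g 0 3 * g 2 3"
  "tri g 4 2 = g 0 1 * g 0 3 * g 1 3" "tri g 4 3 = g 0 1 * g 0 2 * g 1 2"
  by (simp_all add: tri_def others_def del: One_nat_def)

lemmas cof_poly = sum_lessThan_5 det5_def cof_eval tri_eval minor4_def cof_off_def power2_eq_square

locale zero_diag =
  fixes g :: "nat \<Rightarrow> nat \<Rightarrow> real"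
  assumes sym: "g i j = g j i" and diag: "g i i = 0"
begin

lemma sym_rules: "g 1 0 = g 0 1" "g 2 0 = g 0 2" "g 3 0 = g 0 3" "g 4 0 = g 0 4"
  "g 2 1 = g 1 2" "g 3 1 = g 1 3" "g 4 1 = g 1 4" "g 3 2 = g 2 3" "g 4 2 = g 2 4" "g 4 3 = g 3 4"
  by (rule sym)+

lemma cof_sym: "i < 5 \<Longrightarrow> l < 5 \<Longrightarrow> cof g i l = cof g l i"
proof -
  have "\<forall>i<5. \<forall>l<5. cof g i l = cof g l i"
    unfolding all_less_5 by (intro conjI; (rule refl | (simp only: cof_poly sym_rules; algebra)))
  then show "i < 5 \<Longrightarrow> l < 5 \<Longrightarrow> cof g i l = cof g l i" by blast
qed

lemma cof_mult_same: "i < 5 \<Longrightarrow> (\<Sum>j<5. cof g i j * g j i) = det5 g"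
proof -
  have "\<forall>i<5. (\<Sum>j<5. cof g i j * g j i) = det5 g"
    unfolding all_less_5 by (intro conjI; simp only: cof_poly sym_rules diag; algebra)
  then show "i < 5 \<Longrightarrow> (\<Sum>j<5. cof g i j * g j i) = det5 g" by blast
qed

lemma cof_mult_other: "i < 5 \<Longrightarrow> l < 5 \<Longrightarrow> i \<noteq> l \<Longrightarrow> (\<Sum>j<5. cof g i j * g j l) = 0"
proof -
  have "\<forall>i<5. \<forall>l<5. i = l \<or> (\<Sum>j<5. cof g i j * g j l) = 0"
    unfolding all_less_5
    by (intro conjI; ((rule disjI1; rule refl) | (rule disjI2; simp only: cof_poly sym_rules diag; algebra)))
  then show "i < 5 \<Longrightarrow> l < 5 \<Longrightarrow> i \<noteq> l \<Longrightarrow> (\<Sum>j<5. cof g i j * g j l) = 0" by blast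
qed

lemma cof_mult:
  assumes "i < 5" "l < 5"
  shows "(\<Sum>j<5. cof g i j * g j l) = (if i = l then det5 g else 0)"
  using assms cof_mult_same cof_mult_other by auto

text \<open>Jacobi's identity for complementary minors: a 2 by 2 minor of the adjugate is the
  determinant times the complementary 3 by 3 minor \<open>2 * tri g i l\<close>. It controls the
  sines of the angles as well as several signs.\<close>

lemma cof_minor2: "i < 5 \<Longrightarrow> l < 5 \<Longrightarrow> i \<noteq> l \<Longrightarrow> cof g i i * cof g l l - (cof g i l)\<^sup>2 = 2 * det5 g * tri g i l"
proof -
  have "\<forall>i<5. \<forall>l<5. i = l \<or> cof g i i * cof g l l - (cof g i l)\<^sup>2 = 2 * det5 g * tri g i l"
    unfolding all_less_5
    by (intro conjI; ((rule disjI1; rule refl) | (rule disjI2; simp only: cof_poly sym_rules diag; algebra)))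
  then show "i < 5 \<Longrightarrow> l < 5 \<Longrightarrow> i \<noteq> l \<Longrightarrow> cof g i i * cof g l l - (cof g i l)\<^sup>2 = 2 * det5 g * tri g i l"
    by blast
qed

end

lemma list_case_differentiable:
  assumes "\<And>y ys. f0 differentiable F" "\<And>y ys. (\<lambda>t. f1 t y ys) differentiable F"
  shows "(\<lambda>t. case xs of [] \<Rightarrow> f0 t | y # ys \<Rightarrow> f1 t y ys) differentiable F"
  using assms by (cases xs) auto

lemma cof_differentiable:
  assumes "\<And>i j. ((\<lambda>t. G t i j) has_real_derivative d i j) (at t)"
  shows "(\<lambda>t. cof (G t) i l) differentiable (at t)"
proof -
  have *: "(\<lambda>t. G t i j) differentiable (at t)" for i j
    using assms real_differentiable_def by blast
  have 1: "(\<lambda>t. minor4 (G t) j k m n) differentiable (at t)" for j k m n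
    unfolding minor4_def by (intro derivative_intros *)
  have 2: "(\<lambda>t. cof_off (G t) i l k m n) differentiable (at t)" for i l k m n
    unfolding cof_off_def by (intro derivative_intros *)
  show ?thesis
    unfolding cof_def by (intro list_case_differentiable 1 2 differentiable_const)
qed

lemma det5_derivative:
  assumes d: "\<And>i j. ((\<lambda>t. G t i j) has_real_derivative d i j) (at t)"
    and G: "\<And>t. zero_diag (G t)" and D: "zero_diag d"
  shows "((\<lambda>t. det5 (G t)) has_real_derivative (\<Sum>i<5. \<Sum>j<5. d i j * cof (G t) i j)) (at t)"
proof -
  interpret D: zero_diag d by fact
  note s = zero_diag.sym_rules[OF G] zero_diag.diag[OF G]
  \<comment> \<open>Only permutations without fixed points contribute: 24 five-cycles, which are
    even, and 20 products of a three-cycle and a transposition, which are odd. Pairing each with its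
    inverse gives the factor 2, the 12 positive and the 10 negative terms.\<close>
  have eq: "det5 (G t) = 2 * (G t 0 1 * G t 0 4 * G t 1 2 * G t 2 3 * G t 3 4
    + G t 0 1 * G t 0 3 * G t 1 2 * G t 2 4 * G t 3 4
    + G t 0 1 * G t 0 4 * G t 1 3 * G t 2 3 * G t 2 4
    + G t 0 1 * G t 0 2 * G t 1 3 * G t 2 4 * G t 3 4
    + G t 0 1 * G t 0 3 * G t 1 4 * G t 2 3 * G t 2 4
    + G t 0 1 * G t 0 2 * G t 1 4 * G t 2 3 * G t 3 4
    + G t 0 2 * G t 0 4 * G t 1 2 * G t 1 3 * G t 3 4
    + G t 0 2 * G t 0 3 * G t 1 2 * G t 1 4 * G t 3 4
    + G t 0 2 * G t 0 4 * G t 1 3 * G t 1 4 * G t 2 3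
    + G t 0 2 * G t 0 3 * G t 1 3 * G t 1 4 * G t 2 4
    + G t 0 3 * G t 0 4 * G t 1 2 * G t 1 3 * G t 2 4
    + G t 0 3 * G t 0 4 * G t 1 2 * G t 1 4 * G t 2 3
    - G t 0 1 * G t 0 1 * G t 2 3 * G t 2 4 * G t 3 4
    - G t 0 2 * G t 0 2 * G t 1 3 * G t 1 4 * G t 3 4
    - G t 0 3 * G t 0 3 * G t 1 2 * G t 1 4 * G t 2 4
    - G t 0 4 * G t 0 4 * G t 1 2 * G t 1 3 * G t 2 3
    - G t 1 2 * G t 1 2 * G t 0 3 * G t 0 4 * G t 3 4
    - G t 1 3 * G t 1 3 * G t 0 2 * G t 0 4 * G t 2 4
    - G t 1 4 * G t 1 4 * G t 0 2 * G t 0 3 * G t 2 3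
    - G t 2 3 * G t 2 3 * G t 0 1 * G t 0 4 * G t 1 4
    - G t 2 4 * G t 2 4 * G t 0 1 * G t 0 3 * G t 1 3
    - G t 3 4 * G t 3 4 * G t 0 1 * G t 0 2 * G t 1 2)" for t
    by (simp only: cof_poly s; algebra)
  show ?thesis unfolding eq
    by (rule DERIV_cong, (rule derivative_eq_intros d refl)+, simp only: cof_poly s D.sym_rules D.diag, algebra)
qed

section \<open>Variation of the Gaussian integral\<close>

text \<open>
  Here \<open>C\<close> is the adjugate of \<open>g\<close>, \<open>D\<close> its determinant and \<open>d\<close> the derivative of \<open>g\<close>; \<open>M\<close> stands for the
  second order moments, \<open>B i\<close> for the first order moments of the \<open>i\<close>th facet of the orthant, and \<open>\<Phi>\<close>, \<open>\<phi>\<close> for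
  the Gaussian integrals over the orthant and over its faces of codimension 2. Condition \<open>B0\<close> fixes the
  undetermined diagonal of \<open>B\<close> and produces the correction term with \<open>P i i\<close>.
\<close>

lemma schlaefli_algebra:
  fixes g C M B \<phi> d P :: "nat \<Rightarrow> nat \<Rightarrow> real" and D \<Phi> :: real
  assumes adj: "\<And>i l. i < n \<Longrightarrow> l < n \<Longrightarrow> (\<Sum>j<n. C i j * g j l) = (if i = l then D else 0)"
    and D: "D \<noteq> 0" and Cd: "\<And>i. i < n \<Longrightarrow> C i i \<noteq> 0"
    and M: "\<And>i l. i < n \<Longrightarrow> l < n \<Longrightarrow> (\<Sum>k<n. 2 * g i k * M k l) = B i l + (if i = l then \<Phi> else 0)"
    and B0: "\<And>i. i < n \<Longrightarrow> B i i = 0"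
    and B: "\<And>i l. i < n \<Longrightarrow> l < n \<Longrightarrow> i \<noteq> l \<Longrightarrow> (\<Sum>k<n. 2 * g l k * B i k) = \<phi> i l"
    and \<phi>0: "\<And>i. i < n \<Longrightarrow> \<phi> i i = 0"
    and P: "\<And>i l. P i l = (\<Sum>k<n. \<Sum>j<n. d k j * C k i * C j l)"
  shows "(\<Sum>i<n. \<Sum>j<n. d i j * M i j) =
     \<Phi> / (2 * D) * (\<Sum>i<n. \<Sum>j<n. d i j * C i j) +
     1 / (4 * D\<^sup>2) * (\<Sum>i<n. \<Sum>l<n. \<phi> i l * (P i l - P i i * C i l / C i i))"
proof -
  have solve: "(\<Sum>i<n. C m i * (\<Sum>k<n. 2 * g i k * x k)) = 2 * D * x m" if m: "m < n" for m and x :: "nat \<Rightarrow> real"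
  proof -
    have "(\<Sum>i<n. C m i * (\<Sum>k<n. 2 * g i k * x k)) = (\<Sum>i<n. \<Sum>k<n. 2 * x k * (C m i * g i k))"
      by (simp add: sum_distrib_left mult_ac)
    also have "\<dots> = (\<Sum>k<n. 2 * x k * (\<Sum>i<n. C m i * g i k))"
      by (subst sum.swap) (simp add: sum_distrib_left)
    also have "\<dots> = (\<Sum>k<n. if m = k then 2 * x k * D else 0)"
      using m by (intro sum.cong refl) (simp add: adj)
    also have "\<dots> = 2 * D * x m" using m by simp
    finally show ?thesis .
  qed
  have M_eq: "2 * D * M m l = (\<Sum>i<n. C m i * B i l) + C m l * \<Phi>" if "m < n" "l < n" for m l
  proof -
    have "2 * D * M m l = (\<Sum>i<n. C m i * (\<Sum>k<n. 2 * g i k * M k l))"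
      using solve[OF that(1), of "\<lambda>k. M k l"] by simp
    also have "\<dots> = (\<Sum>i<n. C m i * B i l + (if i = l then C m i * \<Phi> else 0))"
      using that by (intro sum.cong refl, subst M) (auto simp: distrib_left)
    also have "\<dots> = (\<Sum>i<n. C m i * B i l) + C m l * \<Phi>"
      using that by (simp add: sum.distrib)
    finally show ?thesis .
  qed
  have B_eq: "2 * D * B i j = (\<Sum>l<n. \<phi> i l * (C j l - C j i * C i l / C i i))" if i: "i < n" and j: "j < n" for i j
  proof -
    \<comment> \<open>This is the right-hand side of the missing equation \<open>l = i\<close>; the
      vanishing of \<open>B i i\<close> determines it.\<close>
    define s where "s = (\<Sum>k<n. 2 * g i k * B i k)"
    have *: "2 * D * B i j = (\<Sum>l<n. C j l * \<phi> i l) + C j i * s" if j: "j < n" for j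
    proof -
      have "2 * D * B i j = (\<Sum>l<n. C j l * (\<Sum>k<n. 2 * g l k * B i k))"
        using solve[OF j, of "B i"] by simp
      also have "\<dots> = (\<Sum>l<n. C j l * \<phi> i l + (if l = i then C j l * s else 0))"
        using i by (intro sum.cong refl) (auto simp: B \<phi>0 s_def)
      also have "\<dots> = (\<Sum>l<n. C j l * \<phi> i l) + C j i * s"
        using i by (simp add: sum.distrib)
      finally show ?thesis .
    qed
    have "C i i * s = - (\<Sum>l<n. C i l * \<phi> i l)" using *[OF i] B0[OF i] by simp
    then have s: "s = - (\<Sum>l<n. C i l * \<phi> i l) / C i i" using Cd[OF i] by (simp add: field_simps)
    have "(\<Sum>l<n. \<phi> i l * (C j l - C j i * C i l / C i i)) = (\<Sum>l<n. C j l * \<phi> i l) - (\<Sum>l<n. C j i / C i i * (C i l * \<phi> i l))"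
      unfolding sum_subtractf[symmetric] by (intro sum.cong refl) (simp add: algebra_simps)
    also have "\<dots> = 2 * D * B i j"
      unfolding *[OF j] s by (simp add: sum_distrib_left[symmetric] sum_divide_distrib[symmetric])
    finally show ?thesis by simp
  qed
  have inner: "2 * D * (\<Sum>m<n. \<Sum>l<n. d m l * C m i * B i l) = (\<Sum>l<n. \<phi> i l * (P i l - P i i * C i l / C i i))" if i: "i < n" for i
  proof -
    have "2 * D * (\<Sum>m<n. \<Sum>j<n. d m j * C m i * B i j) = (\<Sum>m<n. \<Sum>j<n. d m j * C m i * (2 * D * B i j))"
      by (simp add: sum_distrib_left mult_ac)
    also have "\<dots> = (\<Sum>m<n. \<Sum>j<n. \<Sum>l<n. \<phi> i l * (d m j * C m i * C j l - d m j * C m i * C j i * (C i l / C i i)))"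
    proof (intro sum.cong refl)
      fix m j assume j: "j \<in> {..<n}"
      have "d m j * C m i * (2 * D * B i j) = d m j * C m i * (\<Sum>l<n. \<phi> i l * (C j l - C j i * C i l / C i i))"
        using B_eq[OF i, of j] j by simp
      also have "\<dots> = (\<Sum>l<n. \<phi> i l * (d m j * C m i * C j l - d m j * C m i * C j i * (C i l / C i i)))"
        unfolding sum_distrib_left by (intro sum.cong refl) (simp add: algebra_simps)
      finally show "d m j * C m i * (2 * D * B i j) = \<dots>" .
    qed
    also have "\<dots> = (\<Sum>m<n. \<Sum>l<n. \<Sum>j<n. \<phi> i l * (d m j * C m i * C j l - d m j * C m i * C j i * (C i l / C i i)))"
      by (rule sum.cong[OF refl], rule sum.swap)
    also have "\<dots> = (\<Sum>l<n. \<Sum>m<n. \<Sum>j<n. \<phi> i l * (d m j * C m i * C j l - d m j * C m i * C j i * (C i l / C i i)))"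
      by (rule sum.swap)
    also have "\<dots> = (\<Sum>l<n. \<phi> i l * (P i l - P i i * (C i l / C i i)))"
      unfolding P by (simp add: sum_distrib_left sum_distrib_right sum_subtractf right_diff_distrib mult_ac)
    finally show ?thesis by simp
  qed
  have "2 * D * (\<Sum>i<n. \<Sum>j<n. d i j * M i j) = (\<Sum>m<n. \<Sum>l<n. d m l * (2 * D * M m l))"
    by (simp add: sum_distrib_left mult_ac)
  also have "\<dots> = (\<Sum>m<n. \<Sum>l<n. d m l * C m l * \<Phi> + (\<Sum>i<n. d m l * C m i * B i l))"
  proof (intro sum.cong refl)
    fix m l assume "m \<in> {..<n}" "l \<in> {..<n}"
    then have "d m l * (2 * D * M m l) = d m l * ((\<Sum>i<n. C m i * B i l) + C m l * \<Phi>)"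
      using M_eq[of m l] by simp
    also have "\<dots> = d m l * C m l * \<Phi> + (\<Sum>i<n. d m l * C m i * B i l)"
      by (simp add: distrib_left sum_distrib_left mult.assoc)
    finally show "d m l * (2 * D * M m l) = \<dots>" .
  qed
  also have "\<dots> = (\<Sum>m<n. \<Sum>l<n. d m l * C m l * \<Phi>) + (\<Sum>m<n. \<Sum>l<n. \<Sum>i<n. d m l * C m i * B i l)"
    by (simp add: sum.distrib)
  also have "(\<Sum>m<n. \<Sum>l<n. \<Sum>i<n. d m l * C m i * B i l) = (\<Sum>m<n. \<Sum>i<n. \<Sum>l<n. d m l * C m i * B i l)"
    by (rule sum.cong[OF refl], rule sum.swap)
  also have "\<dots> = (\<Sum>i<n. \<Sum>m<n. \<Sum>l<n. d m l * C m i * B i l)"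
    by (rule sum.swap)
  also have "(\<Sum>m<n. \<Sum>l<n. d m l * C m l * \<Phi>) = (\<Sum>m<n. \<Sum>l<n. d m l * C m l) * \<Phi>"
    by (simp add: sum_distrib_right)
  finally have 1: "2 * D * (\<Sum>i<n. \<Sum>j<n. d i j * M i j) =
    (\<Sum>m<n. \<Sum>l<n. d m l * C m l) * \<Phi> + (\<Sum>i<n. \<Sum>m<n. \<Sum>l<n. d m l * C m i * B i l)" .
  have 2: "2 * D * (\<Sum>i<n. \<Sum>m<n. \<Sum>l<n. d m l * C m i * B i l) = (\<Sum>i<n. \<Sum>l<n. \<phi> i l * (P i l - P i i * C i l / C i i))"
    by (subst sum_distrib_left, rule sum.cong[OF refl], rule inner, simp)
  define X where "X = (\<Sum>i<n. \<Sum>m<n. \<Sum>l<n. d m l * C m i * B i l)"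
  define Y where "Y = (\<Sum>i<n. \<Sum>l<n. \<phi> i l * (P i l - P i i * C i l / C i i))"
  define S where "S = (\<Sum>i<n. \<Sum>j<n. d i j * M i j)"
  define Z where "Z = (\<Sum>m<n. \<Sum>l<n. d m l * C m l)"
  have "2 * D * S = Z * \<Phi> + X" "2 * D * X = Y"
    using 1 2 unfolding X_def Y_def S_def Z_def by (simp_all only:)
  then have Y: "Y = 2 * D * (2 * D * S - Z * \<Phi>)" by simp
  have "S = \<Phi> / (2 * D) * Z + 1 / (4 * D\<^sup>2) * Y"
    unfolding Y using D by (simp add: field_simps power2_eq_square)
  then show ?thesis by (simp only: S_def Z_def Y_def)
qed

text \<open>Differentiate the relation between \<open>C\<close> and \<open>g\<close> and multiply by
  \<open>C\<close> from the right: \<open>g\<close> times \<open>C\<close> is again \<open>D\<close>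
  times the identity by symmetry. No inverse is taken, so the identity does not depend on
  \<open>D\<close> being nonzero.\<close>

lemma adjugate_derivative_algebra:
  fixes g C C' d P :: "nat \<Rightarrow> nat \<Rightarrow> real" and D D' :: real
  assumes adj: "\<And>i l. i < n \<Longrightarrow> l < n \<Longrightarrow> (\<Sum>j<n. C i j * g j l) = (if i = l then D else 0)"
    and sym: "\<And>i j. i < n \<Longrightarrow> j < n \<Longrightarrow> g i j = g j i" "\<And>i j. i < n \<Longrightarrow> j < n \<Longrightarrow> C i j = C j i"
    and diff: "\<And>i l. i < n \<Longrightarrow> l < n \<Longrightarrow> (\<Sum>j<n. C' i j * g j l + C i j * d j l) = (if i = l then D' else 0)"
    and i: "i < n" and m: "m < n"
  shows "D * C' i m = D' * C i m - (\<Sum>k<n. \<Sum>j<n. d k j * C k i * C j m)"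
proof -
  have "(\<Sum>l<n. (if i = l then D' else 0) * C l m) = (\<Sum>l<n. (\<Sum>j<n. C' i j * g j l + C i j * d j l) * C l m)"
    using i by (intro sum.cong refl) (simp add: diff)
  also have "\<dots> = (\<Sum>l<n. \<Sum>j<n. C' i j * g j l * C l m) + (\<Sum>l<n. \<Sum>j<n. C i j * d j l * C l m)"
    by (simp add: sum_distrib_right distrib_right sum.distrib)
  also have "(\<Sum>l<n. \<Sum>j<n. C' i j * g j l * C l m) = (\<Sum>j<n. \<Sum>l<n. C' i j * (C m l * g l j))"
  proof (subst sum.swap, intro sum.cong refl)
    fix j l assume "j \<in> {..<n}" "l \<in> {..<n}"
    then show "C' i j * g j l * C l m = C' i j * (C m l * g l j)"
      using sym(1)[of j l] sym(2)[of l m] m by simp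
  qed
  also have "\<dots> = (\<Sum>j<n. C' i j * (\<Sum>l<n. C m l * g l j))"
    by (simp add: sum_distrib_left)
  also have "\<dots> = (\<Sum>j<n. if m = j then C' i j * D else 0)"
    using m by (intro sum.cong refl) (simp add: adj)
  also have "\<dots> = D * C' i m" using m by simp
  also have "(\<Sum>l<n. \<Sum>j<n. C i j * d j l * C l m) = (\<Sum>k<n. \<Sum>j<n. d k j * C k i * C j m)"
  proof (subst sum.swap, intro sum.cong refl)
    fix j l assume "j \<in> {..<n}" "l \<in> {..<n}"
    then show "C i j * d j l * C l m = d j l * C j i * C l m"
      using sym(2)[of i j] i by simp
  qed
  finally have "(\<Sum>l<n. (if i = l then D' else 0) * C l m) = D * C' i m + (\<Sum>k<n. \<Sum>j<n. d k j * C k i * C j m)" .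
  moreover have "(\<Sum>l<n. (if i = l then D' else 0) * C l m) = (\<Sum>l<n. if i = l then D' * C l m else 0)"
    by (intro sum.cong refl) simp
  moreover have "\<dots> = D' * C i m" using i by simp
  ultimately show ?thesis by simp
qed

section \<open>Signs of the determinant and of the diagonal cofactors\<close>

text \<open>For positive entries \<open>g 0 i\<close>, the rescaling of \<open>w i\<close> by
  \<open>g 0 i\<close> turns this into strict conditional negative definiteness of
  \<open>g i j / (g 0 i * g 0 j)\<close>, Schoenberg's condition for squared distances of four
  affinely independent points. With a zero diagonal the coordinate \<open>w 0\<close> enters the
  form only through the linear condition, hence the range \<open>{1..<5}\<close>.\<close>

definition cnd :: "(nat \<Rightarrow> nat \<Rightarrow> real) \<Rightarrow> bool" where
  "cnd g \<longleftrightarrow> (\<forall>w. (\<Sum>i<5. g 0 i * w i) = 0 \<longrightarrow> (\<exists>i\<in>{1..<5}. w i \<noteq> 0) \<longrightarrow> qf g {..<5} w < 0)"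

lemma (in pos_off_diag) zero_diag: "zero_diag g"
  by unfold_locales (rule sym, rule diag)

text \<open>A vector supported on 1, 2, 3 tests the condition. Index 4 is treated first because
  \<open>cnd\<close> singles out index 0; Jacobi's identity carries the sign to the other indices
  afterwards.\<close>

lemma (in pos_off_diag) cof_diag_last_neg:
  assumes "cnd g"
  shows "cof g 4 4 < 0"
proof -
  interpret zero_diag g by (rule zero_diag)
  define b where "b = g 0 2 * g 1 3"
  define S where "S = b + g 0 1 * g 2 3 - g 0 3 * g 1 2"
  \<comment> \<open>Up to scaling, consider the vectors with \<open>g 0 i * w i\<close> equal to
    \<open>- s\<close>, \<open>2 * b\<close>, \<open>s - 2 * b\<close>. The form is a positive
    multiple of \<open>- s\<^sup>2 + 2 * s * S - 4 * b * (g 0 1 * g 2 3)\<close>;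
    \<open>s = S\<close> maximizes it, and the maximum is the minor
    \<open>cof g 4 4\<close>.\<close>
  define w :: "nat \<Rightarrow> real" where "w i = (if i = 1 then g 0 2 * g 0 3 * (- S) else if i = 2 then g 0 1 * g 0 3 * (2 * b) else if i = 3 then g 0 1 * g 0 2 * (S - 2 * b) else 0)" for i
  have w: "w 0 = 0" "w 1 = g 0 2 * g 0 3 * (- S)" "w 2 = g 0 1 * g 0 3 * (2 * b)" "w 3 = g 0 1 * g 0 2 * (S - 2 * b)" "w 4 = 0"
    by (simp_all add: w_def)
  have p: "g 0 1 > 0" "g 0 2 > 0" "g 0 3 > 0" "b > 0" using pos by (simp_all add: b_def)
  have "(\<Sum>i<5. g 0 i * w i) = 0"
    by (simp only: sum_lessThan_5 w diag; algebra)
  moreover have "w 2 \<noteq> 0" using p by (simp add: w)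
  then have "\<exists>i\<in>{1..<5}. w i \<noteq> 0" by (intro bexI[of _ 2]) auto
  ultimately have "qf g {..<5} w < 0" using assms unfolding cnd_def by blast
  also have "qf g {..<5} w = (2 * (g 0 1 * g 0 2 * g 0 3) * b) * cof g 4 4"
    unfolding qf_def by (simp only: cof_poly w sym_rules diag S_def b_def; algebra)
  finally have "(2 * (g 0 1 * g 0 2 * g 0 3) * b) * cof g 4 4 < 0" .
  moreover have "2 * (g 0 1 * g 0 2 * g 0 3) * b > 0" using p by simp
  ultimately show ?thesis by (meson mult_nonneg_nonneg not_less order_less_imp_le)
qed

lemma (in pos_off_diag) tri_pos:
  assumes "i < 5" "l < 5" "i \<noteq> l"
  shows "tri g i l > 0"
proof -
  have "\<forall>i<5. \<forall>l<5. i = l \<or> tri g i l > 0"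
    unfolding all_less_5 using pos by (simp add: tri_eval del: One_nat_def)
  then show ?thesis using assms by blast
qed

text \<open>The test vector is the last row of the adjugate. The matrix maps it to
  \<open>det5 g\<close> times the last unit vector, so the linear condition holds and the form takes
  the value \<open>cof g 4 4 * det5 g\<close>.\<close>

lemma (in pos_off_diag) det5_pos:
  assumes "cnd g"
  shows "det5 g > 0"
proof -
  interpret zero_diag g by (rule zero_diag)
  have neg: "cof g 4 4 < 0" by (rule cof_diag_last_neg[OF assms])
  have row: "(\<Sum>j<5. g i j * cof g 4 j) = (if i = 4 then det5 g else 0)" if "i < 5" for i
    using cof_mult[of 4 i] that by (simp add: sym[of i] mult.commute)
  have "(\<Sum>i<5. g 0 i * cof g 4 i) = 0" using row[of 0] by simp
  moreover have "\<exists>i\<in>{1..<5}. cof g 4 i \<noteq> 0" using neg by (intro bexI[of _ 4]) auto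
  ultimately have "qf g {..<5} (cof g 4) < 0" using assms unfolding cnd_def by blast
  also have "qf g {..<5} (cof g 4) = (\<Sum>i<5. cof g 4 i * (\<Sum>j<5. g i j * cof g 4 j))"
    unfolding qf_def by (simp add: sum_distrib_left mult_ac)
  also have "\<dots> = (\<Sum>i<5. if i = 4 then cof g 4 i * det5 g else 0)"
    by (intro sum.cong refl) (simp add: row)
  also have "\<dots> = cof g 4 4 * det5 g" by simp
  finally show ?thesis using neg by (simp add: mult_less_0_iff)
qed

text \<open>Jacobi's identity, with \<open>det5 g\<close> and \<open>tri g i 4\<close> positive,
  makes the product with \<open>cof g 4 4\<close> positive.\<close>

lemma (in pos_off_diag) cof_diag_neg:
  assumes "cnd g" "i < 5"
  shows "cof g i i < 0"
proof (cases "i = 4")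
  case False
  interpret zero_diag g by (rule zero_diag)
  have neg: "cof g 4 4 < 0" by (rule cof_diag_last_neg[OF assms(1)])
  have "cof g i i * cof g 4 4 = (cof g i 4)\<^sup>2 + 2 * det5 g * tri g i 4"
    using cof_minor2[of i 4] False assms by simp
  also have "\<dots> > 0"
    using det5_pos[OF assms(1)] tri_pos[of i 4] False assms by (intro add_nonneg_pos) auto
  finally show ?thesis using neg by (simp add: zero_less_mult_iff)
qed (use cof_diag_last_neg[OF assms(1)] in simp)

section \<open>The degenerate end of the segment\<close>

definition flat_dist :: "nat \<Rightarrow> nat \<Rightarrow> real" where
  "flat_dist i j = (if i = j then 0 else if i = 4 \<or> j = 4 then 1 else 3)"

text \<open>Row 0 is copied from \<open>g\<close>, so that the linear condition in
  \<open>cnd\<close> is the same on the whole segment. The entries of \<open>flat_dist\<close> are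
  half the squared distances in a planar configuration.\<close>

definition flat_gram :: "(nat \<Rightarrow> nat \<Rightarrow> real) \<Rightarrow> nat \<Rightarrow> nat \<Rightarrow> real" where
  "flat_gram g i j = (if i = 0 \<or> j = 0 then g i j else g 0 i * g 0 j * flat_dist i j)"

text \<open>The inverse of a Gram matrix is the Gram matrix of the dual basis, here the facet
  normals. Cofactors differ from its entries by the determinant, which cancels in the quotient; so
  the formula stays meaningful when the determinant vanishes.\<close>

definition out_angle :: "(nat \<Rightarrow> nat \<Rightarrow> real) \<Rightarrow> nat \<Rightarrow> nat \<Rightarrow> real" where
  "out_angle g i l = arccos (- cof g i l / sqrt (cof g i i * cof g l l))"

lemma (in pos_off_diag) flat_gram: "pos_off_diag (flat_gram g)"
proof
  show "flat_gram g i j = flat_gram g j i" for i j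
    by (auto simp: flat_gram_def flat_dist_def intro: sym)
  show "flat_gram g i i = 0" for i by (simp add: flat_gram_def flat_dist_def diag)
  show "flat_gram g i j > 0" if "i \<noteq> j" for i j
    using that pos[of i j] pos[of 0 i] pos[of 0 j] by (auto simp: flat_gram_def flat_dist_def)
qed

lemma (in pos_off_diag) flat_gram_eval:
  "flat_gram g 0 1 = g 0 1" "flat_gram g 0 2 = g 0 2" "flat_gram g 0 3 = g 0 3" "flat_gram g 0 4 = g 0 4"
  "flat_gram g 1 2 = 3 * (g 0 1 * g 0 2)" "flat_gram g 1 3 = 3 * (g 0 1 * g 0 3)" "flat_gram g 2 3 = 3 * (g 0 2 * g 0 3)"
  "flat_gram g 1 4 = g 0 1 * g 0 4" "flat_gram g 2 4 = g 0 2 * g 0 4" "flat_gram g 3 4 = g 0 3 * g 0 4"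
  by (simp_all add: flat_gram_def flat_dist_def del: One_nat_def)

text \<open>The flat configuration in the upper half space picture seen from vertex 0: an equilateral
  triangle with side \<open>sqrt 6\<close> and its centre. Its Gram matrix has the kernel vector \<open>(-3, 1, 1, 1, -3)\<close>, up to scaling.\<close>

definition flat_kernel :: "(nat \<Rightarrow> nat \<Rightarrow> real) \<Rightarrow> nat \<Rightarrow> real" where
  "flat_kernel g i = (if i = 0 then - 3 * (g 0 1 * g 0 2 * g 0 3 * g 0 4) else if i = 1 then g 0 2 * g 0 3 * g 0 4
     else if i = 2 then g 0 1 * g 0 3 * g 0 4 else if i = 3 then g 0 1 * g 0 2 * g 0 4 else - 3 * (g 0 1 * g 0 2 * g 0 3))"

text \<open>The flat matrix has a one-dimensional kernel, so its adjugate has rank one and is a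
  multiple of the kernel vector times its transpose.\<close>

lemma (in pos_off_diag) cof_flat_gram:
  assumes "i < 5" "l < 5"
  shows "cof (flat_gram g) i l = - 3 * flat_kernel g i * flat_kernel g l"
proof -
  interpret f: pos_off_diag "flat_gram g" by (rule flat_gram)
  interpret f: zero_diag "flat_gram g" by (rule f.zero_diag)
  have k: "flat_kernel g 0 = - 3 * (g 0 1 * g 0 2 * g 0 3 * g 0 4)" "flat_kernel g 1 = g 0 2 * g 0 3 * g 0 4"
    "flat_kernel g 2 = g 0 1 * g 0 3 * g 0 4" "flat_kernel g 3 = g 0 1 * g 0 2 * g 0 4" "flat_kernel g 4 = - 3 * (g 0 1 * g 0 2 * g 0 3)"
    by (simp_all add: flat_kernel_def del: One_nat_def)
  have "\<forall>i<5. \<forall>l<5. cof (flat_gram g) i l = - 3 * flat_kernel g i * flat_kernel g l"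
    unfolding all_less_5 by (intro conjI; simp only: cof_poly f.sym_rules f.diag flat_gram_eval k; algebra)
  then show ?thesis using assms by blast
qed

lemma (in pos_off_diag) det5_flat_gram: "det5 (flat_gram g) = 0"
proof -
  interpret f: pos_off_diag "flat_gram g" by (rule flat_gram)
  interpret f: zero_diag "flat_gram g" by (rule f.zero_diag)
  show ?thesis by (simp only: cof_poly f.sym_rules f.diag flat_gram_eval; algebra)
qed

lemma (in pos_off_diag) flat_kernel_nonzero: "flat_kernel g i \<noteq> 0"
  using pos[of 0 1] pos[of 0 2] pos[of 0 3] pos[of 0 4] by (simp add: flat_kernel_def)

lemma (in pos_off_diag) cof_flat_gram_diag_neg: "i < 5 \<Longrightarrow> cof (flat_gram g) i i < 0"
  using flat_kernel_nonzero[of i] by (simp add: cof_flat_gram power2_eq_square[symmetric] mult.assoc)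

text \<open>Because the adjugate has rank one, every cosine is 1 or -1, according to the signs of
  two kernel entries; these are positive exactly at the corners 1, 2, 3 of the triangle.\<close>

lemma (in pos_off_diag) out_angle_flat_gram:
  assumes "i < 5" "l < 5"
  shows "out_angle (flat_gram g) i l = (if i \<in> {1,2,3} \<longleftrightarrow> l \<in> {1,2,3} then 0 else pi)"
proof -
  define a where "a = flat_kernel g i"
  define b where "b = flat_kernel g l"
  have ab: "a \<noteq> 0" "b \<noteq> 0" using flat_kernel_nonzero by (auto simp: a_def b_def)
  have "sqrt (cof (flat_gram g) i i * cof (flat_gram g) l l) = sqrt ((3 * a * b)\<^sup>2)"
    using assms by (simp add: cof_flat_gram a_def b_def power2_eq_square mult_ac)
  also have "\<dots> = 3 * \<bar>a * b\<bar>" by (simp add: abs_mult)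
  finally have eq: "out_angle (flat_gram g) i l = arccos ((a * b) / \<bar>a * b\<bar>)"
    unfolding out_angle_def using assms by (simp add: cof_flat_gram a_def b_def)
  have p: "g 0 1 > 0" "g 0 2 > 0" "g 0 3 > 0" "g 0 4 > 0" using pos by simp_all
  have sgn: "flat_kernel g k > 0 \<longleftrightarrow> k \<in> {1,2,3}" if "k < 5" for k
  proof -
    have "\<forall>k<5. flat_kernel g k > 0 \<longleftrightarrow> k \<in> {1,2,3}"
      unfolding all_less_5 using p by (simp add: flat_kernel_def mult_pos_pos not_less)
    then show ?thesis using that by blast
  qed
  have "a * b > 0 \<longleftrightarrow> (i \<in> {1,2,3} \<longleftrightarrow> l \<in> {1,2,3})"
    using sgn[OF assms(1)] sgn[OF assms(2)] ab unfolding a_def b_def by (auto simp: zero_less_mult_iff)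
  moreover have "(a * b) / \<bar>a * b\<bar> = (if a * b > 0 then 1 else - 1)" using ab by auto
  ultimately show ?thesis unfolding eq by auto
qed

lemma (in pos_off_diag) sum_out_angle_flat_gram:
  "(\<Sum>i<5. \<Sum>l\<in>{..<5}-{i}. out_angle (flat_gram g) i l) = 12 * pi"
proof -
  have "(\<Sum>i<5. \<Sum>l\<in>{..<5}-{i}. out_angle (flat_gram g) i l) =
    (\<Sum>i<5::nat. \<Sum>l\<in>{..<5::nat}-{i}. if i \<in> {1,2,3} \<longleftrightarrow> l \<in> {1,2,3} then 0 else pi)"
    by (intro sum.cong refl out_angle_flat_gram) auto
  also have "\<dots> = (\<Sum>i<5::nat. \<Sum>l<5::nat. if i \<in> {1,2,3} \<longleftrightarrow> l \<in> {1,2,3} then 0 else pi)"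
    by (intro sum.cong refl sum.mono_neutral_left) auto
  \<comment> \<open>Six pairs separate \<open>{1, 2, 3}\<close> from \<open>{0, 4}\<close>, and each
    is counted in both orders.\<close>
  also have "\<dots> = 12 * pi" unfolding sum_lessThan_5 by simp
  finally show ?thesis .
qed

text \<open>In the rescaled coordinates the form on the hyperplane is minus a sum of squares of
  differences. It is only semidefinite, since it vanishes at \<open>x = y = z\<close>, the direction
  of the kernel vector.\<close>

lemma (in pos_off_diag) qf_flat_gram_nonpos:
  assumes w: "(\<Sum>i<5. g 0 i * w i) = 0"
  shows "qf (flat_gram g) {..<5} w \<le> 0"
proof -
  interpret f: pos_off_diag "flat_gram g" by (rule flat_gram)
  interpret f: zero_diag "flat_gram g" by (rule f.zero_diag)
  define x y z u where "x = g 0 1 * w 1" and "y = g 0 2 * w 2" and "z = g 0 3 * w 3" and "u = g 0 4 * w 4"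
  have "x + y + z + u = 0" using w unfolding sum_lessThan_5 x_def y_def z_def u_def by (simp add: diag del: One_nat_def)
  then have u: "u = - (x + y + z)" by linarith
  have "qf (flat_gram g) {..<5} w = 2 * w 0 * (x + y + z + u) + 6 * (x * y + x * z + y * z) + 2 * u * (x + y + z)"
    unfolding qf_def x_def y_def z_def u_def
    by (simp only: sum_lessThan_5 f.sym_rules f.diag flat_gram_eval; algebra)
  also have "\<dots> = - ((x - y)\<^sup>2 + (y - z)\<^sup>2 + (x - z)\<^sup>2)"
    unfolding u by algebra
  also have "\<dots> \<le> 0"
    using zero_le_power2[of "x - y"] zero_le_power2[of "y - z"] zero_le_power2[of "x - z"] by linarith
  finally show ?thesis .
qed

text \<open>The hyperplane is independent of \<open>t\<close> because row 0 is; on it a strictly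
  negative form is mixed with a nonpositive one, so strictness persists as long as
  \<open>t < 1\<close>.\<close>

lemma (in pos_off_diag) cnd_line_flat_gram:
  assumes "cnd g" "0 \<le> t" "t < 1"
  shows "cnd (\<lambda>i j. (1 - t) * g i j + t * flat_gram g i j)"
  unfolding cnd_def
proof (intro allI impI)
  fix w assume w: "(\<Sum>i<5. ((1 - t) * g 0 i + t * flat_gram g 0 i) * w i) = 0" and ne: "\<exists>i\<in>{1..<5}. w i \<noteq> 0"
  have "(1 - t) * g 0 i + t * flat_gram g 0 i = g 0 i" for i by (simp add: flat_gram_def algebra_simps)
  then have w: "(\<Sum>i<5. g 0 i * w i) = 0" using w by simp
  then have "qf g {..<5} w < 0" using assms(1) ne unfolding cnd_def by blast
  then have "(1 - t) * qf g {..<5} w < 0" using assms by (simp add: mult_less_0_iff)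
  moreover have "t * qf (flat_gram g) {..<5} w \<le> 0"
    using qf_flat_gram_nonpos[OF w] assms by (simp add: mult_nonneg_nonpos)
  ultimately show "qf (\<lambda>i j. (1 - t) * g i j + t * flat_gram g i j) {..<5} w < 0"
    unfolding qf_line by linarith
qed

section \<open>Schlaefli's formula along the segment\<close>

lemma others_obtain:
  assumes "i < 5" "l < 5" "i \<noteq> l"
  obtains k m n where "k \<noteq> m" "k \<noteq> n" "m \<noteq> n" "{..<5} - {i} - {l} = {k, m, n}" "\<And>g. tri g i l = g k m * g k n * g m n"
proof -
  have "\<forall>i<5. \<forall>l<5. i = l \<or> (\<exists>k m n. others i l = [k, m, n])"
    unfolding all_less_5 by (simp add: others_def)
  then obtain k m n where o: "others i l = [k, m, n]" using assms by blast
  have "distinct (others i l)" by (simp add: others_def)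
  moreover have "set (others i l) = {..<5} - {i} - {l}" unfolding others_def lessThan_5 by auto
  ultimately show ?thesis using that[of k m n] o by (simp add: tri_def)
qed

lemma (in pos_off_diag) mom0_codim2:
  assumes "i < 5" "l < 5" "i \<noteq> l"
  shows "mom0 g ({..<5} - {i} - {l}) = pi * sqrt pi / (4 * sqrt (2 * tri g i l))"
  using others_obtain[OF assms] mom0_triple by metis

lemma pos_off_diag_line:
  assumes g: "pos_off_diag g" and h: "pos_off_diag h" and s: "s \<in> {0..1}"
  shows "pos_off_diag (\<lambda>i j. (1 - s) * g i j + s * h i j)"
proof
  interpret g: pos_off_diag g by fact
  interpret h: pos_off_diag h by fact
  show "(1 - s) * g i j + s * h i j = (1 - s) * g j i + s * h j i" for i j by (simp add: g.sym[of i j] h.sym[of i j])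
  show "(1 - s) * g i i + s * h i i = 0" for i by (simp add: g.diag h.diag)
  show "(1 - s) * g i j + s * h i j > 0" if "i \<noteq> j" for i j
  proof (cases "s = 0")
    case False
    then have "0 \<le> (1 - s) * g i j" "0 < s * h i j" using s g.pos[OF that] h.pos[OF that] by auto
    then show ?thesis by linarith
  qed (simp add: g.pos[OF that])
qed

text \<open>The sine of the angle is \<open>e / sqrt (a t * b t)\<close>. Keeping \<open>e\<close>
  as a parameter allows Jacobi's identity to replace it by the root of \<open>2 * D * tri\<close>,
  where the integral over a face of codimension 2 becomes visible.\<close>

lemma out_angle_derivative:
  fixes a b c :: "real \<Rightarrow> real"
  assumes a: "(a has_real_derivative a') (at t)" and b: "(b has_real_derivative b') (at t)" and c: "(c has_real_derivative c') (at t)"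
    and neg: "a t < 0" "b t < 0" and e: "a t * b t - (c t)\<^sup>2 = e\<^sup>2" "e > 0"
  shows "((\<lambda>t. arccos (- c t / sqrt (a t * b t))) has_real_derivative
    (c' - c t * (a' / a t + b' / b t) / 2) / e) (at t)"
proof -
  define q where "q = sqrt (a t * b t)"
  have ab: "a t * b t > 0" using neg by (simp add: mult_neg_neg)
  have q: "q > 0" "q\<^sup>2 = a t * b t" using ab by (simp_all add: q_def)
  have "(c t)\<^sup>2 < a t * b t"
    using e(1) zero_less_power[OF e(2), of 2] by linarith
  then have lt: "(c t / q)\<^sup>2 < 1"
    using q ab by (simp add: power_divide)
  then have bd: "-1 < - c t / q" "- c t / q < 1"
  proof -
    have "\<bar>c t / q\<bar> < 1" using lt abs_square_less_1 by blast
    then have "-1 < c t / q" "c t / q < 1" by linarith+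
    then show "-1 < - c t / q" "- c t / q < 1" by simp_all
  qed
  have s: "sqrt (1 - (- c t / q)\<^sup>2) = e / q"
  proof -
    have "1 - (- c t / q)\<^sup>2 = (e / q)\<^sup>2"
    proof -
      have "(e / q)\<^sup>2 + (c t / q)\<^sup>2 = (e\<^sup>2 + (c t)\<^sup>2) / q\<^sup>2"
        by (simp add: power_divide add_divide_distrib)
      also have "e\<^sup>2 + (c t)\<^sup>2 = q\<^sup>2" using q(2) e(1) by linarith
      also have "q\<^sup>2 / q\<^sup>2 = 1" using q(1) by simp
      finally show ?thesis by simp
    qed
    then show ?thesis using e q by (simp add: real_sqrt_abs)
  qed
  have dq: "((\<lambda>t. sqrt (a t * b t)) has_real_derivative (a' * b t + a t * b') * (inverse q / 2)) (at t)"
    unfolding q_def using ab by (auto intro!: derivative_eq_intros a b simp: algebra_simps)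
  have "((\<lambda>t. - c t / sqrt (a t * b t)) has_real_derivative
     (- c' * q - - c t * ((a' * b t + a t * b') * (inverse q / 2))) / (q * q)) (at t)"
    using DERIV_divide[OF DERIV_minus[OF c] dq] q unfolding q_def[symmetric] by auto
  from DERIV_chain2[OF DERIV_arccos this] bd
  have "((\<lambda>t. arccos (- c t / sqrt (a t * b t))) has_real_derivative
    inverse (- sqrt (1 - (- c t / q)\<^sup>2)) * ((- c' * q - - c t * ((a' * b t + a t * b') * (inverse q / 2))) / (q * q))) (at t)"
    unfolding q_def[symmetric] by simp
  also have "inverse (- sqrt (1 - (- c t / q)\<^sup>2)) * ((- c' * q - - c t * ((a' * b t + a t * b') * (inverse q / 2))) / (q * q)) =
     (c' - c t * (a' * b t + a t * b') / (2 * q\<^sup>2)) / e"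
    unfolding s using q(1) e(2) by (simp add: field_simps power2_eq_square)
  also have "\<dots> = (c' - c t * (a' / a t + b' / b t) / 2) / e"
    unfolding q(2) using neg by (simp add: field_simps)
  finally show ?thesis .
qed

lemma tri_commute: "tri g i l = tri g l i"
  by (simp add: tri_def others_def conj_commute)

context
  fixes g :: "nat \<Rightarrow> nat \<Rightarrow> real"
  assumes g: "pos_off_diag g" and c: "cnd g"
begin

interpretation pos_off_diag g by (rule g)

definition line_gram :: "real \<Rightarrow> nat \<Rightarrow> nat \<Rightarrow> real" where
  "line_gram t i j = (1 - t) * g i j + t * flat_gram g i j"

lemma line_gram_pos: "t \<in> {0..1} \<Longrightarrow> pos_off_diag (line_gram t)"
  unfolding line_gram_def[abs_def] by (rule pos_off_diag_line[OF g flat_gram])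

lemma line_gram_cnd: "0 \<le> t \<Longrightarrow> t < 1 \<Longrightarrow> cnd (line_gram t)"
  unfolding line_gram_def[abs_def] by (rule cnd_line_flat_gram[OF c])

lemma line_gram_zero_diag: "zero_diag (line_gram t)"
proof
  interpret f: pos_off_diag "flat_gram g" by (rule flat_gram)
  show "line_gram t i j = line_gram t j i" for i j by (simp add: line_gram_def sym[of i j] f.sym[of i j])
  show "line_gram t i i = 0" for i by (simp add: line_gram_def diag f.diag)
qed

lemma line_gram_0: "line_gram 0 = g" and line_gram_1: "line_gram 1 = flat_gram g"
  by (simp_all add: line_gram_def fun_eq_iff)

lemma line_gram_deriv: "((\<lambda>t. line_gram t i j) has_real_derivative (flat_gram g i j - g i j)) (at t)"
  unfolding line_gram_def by (auto intro!: derivative_eq_intros)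

lemma diff_zero_diag: "zero_diag (\<lambda>i j. flat_gram g i j - g i j)"
proof
  interpret f: pos_off_diag "flat_gram g" by (rule flat_gram)
  show "flat_gram g i j - g i j = flat_gram g j i - g j i" for i j by (simp add: sym[of i j] f.sym[of i j])
  show "flat_gram g i i - g i i = 0" for i by (simp add: diag f.diag)
qed

lemma line_det5_deriv: "((\<lambda>t. det5 (line_gram t)) has_real_derivative
    (\<Sum>i<5. \<Sum>j<5. (flat_gram g i j - g i j) * cof (line_gram t) i j)) (at t)"
  by (rule det5_derivative[OF line_gram_deriv line_gram_zero_diag diff_zero_diag])

text \<open>The derivative is merely named here; its value comes from
  \<open>line_cof_deriv_eq\<close>, without differentiating the cofactor polynomials.\<close>

lemma line_cof_deriv: "((\<lambda>t. cof (line_gram t) i l) has_real_derivative deriv (\<lambda>t. cof (line_gram t) i l) t) (at t)"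
  using cof_differentiable[where G=line_gram and d="\<lambda>i j. flat_gram g i j - g i j", OF line_gram_deriv]
  by (simp add: DERIV_deriv_iff_real_differentiable)

lemma line_det5_nonneg: "t \<in> {0..1} \<Longrightarrow> det5 (line_gram t) \<ge> 0"
  using pos_off_diag.det5_pos[OF line_gram_pos line_gram_cnd, of t] det5_flat_gram line_gram_1
  by (cases "t = 1") auto

text \<open>The end \<open>t = 1\<close> is included: there the cofactor is -3 times the square of a
  nonzero kernel entry. Hence no denominator of \<open>out_angle\<close> vanishes on the closed
  segment.\<close>

lemma line_cof_diag_neg: "t \<in> {0..1} \<Longrightarrow> i < 5 \<Longrightarrow> cof (line_gram t) i i < 0"
  using pos_off_diag.cof_diag_neg[OF line_gram_pos line_gram_cnd, of t i] cof_flat_gram_diag_neg[of i] line_gram_1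
  by (cases "t = 1") auto

lemma line_cof_deriv_eq:
  assumes "i < 5" "m < 5"
  shows "det5 (line_gram t) * deriv (\<lambda>t. cof (line_gram t) i m) t =
    (\<Sum>i<5. \<Sum>j<5. (flat_gram g i j - g i j) * cof (line_gram t) i j) * cof (line_gram t) i m -
    (\<Sum>k<5. \<Sum>j<5. (flat_gram g k j - g k j) * cof (line_gram t) k i * cof (line_gram t) j m)"
proof (rule adjugate_derivative_algebra[where g="line_gram t" and n=5])
  interpret z: zero_diag "line_gram t" by (rule line_gram_zero_diag)
  show "(\<Sum>j<5. cof (line_gram t) i j * line_gram t j l) = (if i = l then det5 (line_gram t) else 0)" if "i < 5" "l < 5" for i l
    using z.cof_mult that by simp
  show "line_gram t i j = line_gram t j i" for i j by (rule z.sym)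
  show "cof (line_gram t) i j = cof (line_gram t) j i" if "i < 5" "j < 5" for i j using z.cof_sym that by simp
  show "(\<Sum>j<5. deriv (\<lambda>t. cof (line_gram t) i j) t * line_gram t j l + cof (line_gram t) i j * (flat_gram g j l - g j l)) =
    (if i = l then \<Sum>i<5. \<Sum>j<5. (flat_gram g i j - g i j) * cof (line_gram t) i j else 0)" if "i < 5" "l < 5" for i l
  proof -
    have "((\<lambda>t. \<Sum>j<5. cof (line_gram t) i j * line_gram t j l) has_real_derivative
       (\<Sum>j<5. deriv (\<lambda>t. cof (line_gram t) i j) t * line_gram t j l + (flat_gram g j l - g j l) * cof (line_gram t) i j)) (at t)"
      by (intro DERIV_sum DERIV_mult line_cof_deriv line_gram_deriv)
    moreover have "(\<lambda>t. \<Sum>j<5. cof (line_gram t) i j * line_gram t j l) = (\<lambda>t. if i = l then det5 (line_gram t) else 0)"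
      using zero_diag.cof_mult[OF line_gram_zero_diag] that by simp
    moreover have "((\<lambda>t. if i = l then det5 (line_gram t) else 0) has_real_derivative
       (if i = l then \<Sum>i<5. \<Sum>j<5. (flat_gram g i j - g i j) * cof (line_gram t) i j else 0)) (at t)"
      using line_det5_deriv by (cases "i = l") auto
    ultimately show ?thesis by (simp add: DERIV_unique mult.commute)
  qed
qed (use assms in auto)

text \<open>In the derivative of the first term the two contributions of \<Phi> with
  \<open>D'\<close> cancel, and what survives is a combination of the integrals \<phi> that matches
  the derivatives of the angles. The weight of one angle is \<open>pi * sqrt pi / 8\<close>, the
  product of the radial constant \<open>3 * sqrt pi / 8\<close> and \<open>pi / 3\<close>; it is
  halved because the sum runs over ordered pairs.\<close>

lemma line_defect_deriv:
  assumes t: "0 < t" "t < 1"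
  shows "((\<lambda>t. sqrt (det5 (line_gram t)) * mom0 (line_gram t) {..<5} -
     pi * sqrt pi / 16 * (\<Sum>i<5. \<Sum>l\<in>{..<5}-{i}. out_angle (line_gram t) i l)) has_real_derivative 0) (at t)"
proof -
  have t01: "t \<in> {0..1}" using t by auto
  interpret p: pos_off_diag "line_gram t" by (rule line_gram_pos[OF t01])
  interpret z: zero_diag "line_gram t" by (rule line_gram_zero_diag)
  define G where "G = line_gram t"
  define C where "C = cof G"
  define D where "D = det5 G"
  define d where "d i j = flat_gram g i j - g i j" for i j
  define P where "P i l = (\<Sum>k<5. \<Sum>j<5. d k j * C k i * C j l)" for i l
  define D' where "D' = (\<Sum>i<5. \<Sum>j<5. d i j * C i j)"
  define C' where "C' i l = deriv (\<lambda>t. cof (line_gram t) i l) t" for i l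
  define \<Phi> where "\<Phi> = mom0 G {..<5}"
  define M where "M = mom2 G {..<5}"
  define B where "B i l = (if i = l then 0 else mom1 G ({..<5} - {i}) l)" for i l
  define \<phi> where "\<phi> i l = (if i = l then 0 else pi * sqrt pi / (4 * sqrt (2 * tri G i l)))" for i l
  have D: "D > 0" unfolding D_def G_def using p.det5_pos line_gram_cnd t by auto
  have Cneg: "C i i < 0" if "i < 5" for i unfolding C_def G_def using line_cof_diag_neg[OF t01 that] .
  have Csym: "C i l = C l i" if "i < 5" "l < 5" for i l unfolding C_def G_def using z.cof_sym that by simp
  have tri: "tri G i l > 0" if "i < 5" "l < 5" "i \<noteq> l" for i l unfolding G_def using p.tri_pos that by simp
  have S: "(\<Sum>i<5. \<Sum>j<5. d i j * M i j) = \<Phi> / (2 * D) * D' +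
     1 / (4 * D\<^sup>2) * (\<Sum>i<5. \<Sum>l<5. \<phi> i l * (P i l - P i i * C i l / C i i))"
    unfolding D'_def
  proof (rule schlaefli_algebra[where g=G and B=B])
    show "(\<Sum>j<5. C i j * G j l) = (if i = l then D else 0)" if "i < 5" "l < 5" for i l
      using z.cof_mult that unfolding C_def D_def G_def by simp
    show "D \<noteq> 0" using D by simp
    show "C i i \<noteq> 0" if "i < 5" for i using Cneg[OF that] by simp
    show "(\<Sum>k<5. 2 * G i k * M k l) = B i l + (if i = l then \<Phi> else 0)" if "i < 5" "l < 5" for i l
      using p.mom2_row_same[of "{..<5}" i] p.mom2_row_other[of "{..<5}" i l] that
      unfolding B_def M_def \<Phi>_def G_def by auto
    show "B i i = 0" for i by (simp add: B_def)
    show "(\<Sum>k<5. 2 * G l k * B i k) = \<phi> i l" if "i < 5" "l < 5" "i \<noteq> l" for i l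
    proof -
      have "(\<Sum>k<5. 2 * G l k * B i k) = (\<Sum>k\<in>{..<5}-{i}. 2 * G l k * mom1 G ({..<5} - {i}) k)"
        unfolding B_def by (rule sum.mono_neutral_cong_right) auto
      also have "\<dots> = mom0 G ({..<5} - {i} - {l})"
        using p.mom1_row[of "{..<5} - {i}" l] that unfolding G_def by simp
      also have "\<dots> = \<phi> i l" using p.mom0_codim2[OF that] that unfolding G_def \<phi>_def by simp
      finally show ?thesis .
    qed
    show "\<phi> i i = 0" for i by (simp add: \<phi>_def)
    show "P i l = (\<Sum>k<5. \<Sum>j<5. d k j * C k i * C j l)" for i l by (rule P_def)
  qed
  have \<Phi>': "((\<lambda>t. mom0 (line_gram t) {..<5}) has_real_derivative - (\<Sum>i<5. \<Sum>j<5. d i j * M i j)) (at t)"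
  proof -
    have "((\<lambda>t. mom0 (line_gram t) {..<5}) has_real_derivative - (\<Sum>i<5. \<Sum>j<5. d i j * M i j)) (at t within {0..1})"
      using mom0_line_derivative[OF g flat_gram _ _ t01, of "{..<5}"]
      unfolding d_def M_def G_def line_gram_def[abs_def] by simp
    moreover have "at t within {0..1} = at t" using t by (intro at_within_interior) simp
    ultimately show ?thesis by simp
  qed
  have D'': "((\<lambda>t. det5 (line_gram t)) has_real_derivative D') (at t)"
    unfolding D'_def d_def C_def G_def by (rule line_det5_deriv)
  have W: "((\<lambda>t. sqrt (det5 (line_gram t)) * mom0 (line_gram t) {..<5}) has_real_derivative
     D' * (inverse (sqrt D) / 2) * \<Phi> + - (\<Sum>i<5. \<Sum>j<5. d i j * M i j) * sqrt D) (at t)"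
    using DERIV_mult[OF DERIV_chain2[OF DERIV_real_sqrt D''] \<Phi>'] D unfolding D_def \<Phi>_def G_def by (simp add: mult_ac)
  have CD: "C' i l = (D' * C i l - P i l) / D" if "i < 5" "l < 5" for i l
    using line_cof_deriv_eq[OF that, of t] D unfolding C'_def D_def D'_def d_def C_def P_def G_def by (simp add: field_simps)
  have out: "((\<lambda>t. out_angle (line_gram t) i l) has_real_derivative
      - (4 / (pi * sqrt pi * D * sqrt D)) * (\<phi> i l * (P i l - C i l * (P i i / C i i + P l l / C l l) / 2))) (at t)"
    if "i < 5" "l \<in> {..<5} - {i}" for i l
  proof -
    have il: "i < 5" "l < 5" "i \<noteq> l" using that by auto
    define e where "e = sqrt (2 * D * tri G i l)"
    have e: "e > 0" using D tri[OF il] by (simp add: e_def)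
    have e2: "e\<^sup>2 = 2 * D * tri G i l" using D tri[OF il] by (simp add: e_def)
    have "cof (line_gram t) i i * cof (line_gram t) l l - (cof (line_gram t) i l)\<^sup>2 = e\<^sup>2"
      using z.cof_minor2[OF il] unfolding e2 D_def G_def .
    from out_angle_derivative[OF line_cof_deriv line_cof_deriv line_cof_deriv _ _ this e]
    have "((\<lambda>t. out_angle (line_gram t) i l) has_real_derivative
      (C' i l - C i l * (C' i i / C i i + C' l l / C l l) / 2) / e) (at t)"
      using line_cof_diag_neg[OF t01] il unfolding out_angle_def C'_def C_def G_def by simp
    \<comment> \<open>The terms with \<open>D'\<close> cancel, since the angle is invariant under
      scaling all cofactors by a common factor.\<close>
    also have "C' i l - C i l * (C' i i / C i i + C' l l / C l l) / 2 = - (P i l - C i l * (P i i / C i i + P l l / C l l) / 2) / D"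
      using il D Cneg[of i] Cneg[of l] by (simp add: CD field_simps)
    also have "- (P i l - C i l * (P i i / C i i + P l l / C l l) / 2) / D / e =
      - (4 / (pi * sqrt pi * D * sqrt D)) * (\<phi> i l * (P i l - C i l * (P i i / C i i + P l l / C l l) / 2))"
    proof -
      have "e = sqrt D * sqrt (2 * tri G i l)" by (simp add: e_def real_sqrt_mult)
      then show ?thesis using il D tri[OF il] by (simp add: \<phi>_def field_simps)
    qed
    finally show ?thesis .
  qed
  define X where "X = (\<Sum>i<5. \<Sum>l<5. \<phi> i l * P i l)"
  define Y where "Y = (\<Sum>i<5. \<Sum>l<5. \<phi> i l * (P i i * C i l / C i i))"
  have sumP: "(\<Sum>i<5. \<Sum>l<5. \<phi> i l * (P i l - P i i * C i l / C i i)) = X - Y"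
    unfolding X_def Y_def by (simp add: right_diff_distrib sum_subtractf)
  \<comment> \<open>The angle derivative splits its correction evenly between \<open>i\<close> and
    \<open>l\<close>, whereas \<open>schlaefli_algebra\<close> puts all of it at \<open>i\<close>.
    By symmetry of \<open>C\<close> and \<phi> the two agree after summation.\<close>
  have Y': "(\<Sum>i<5. \<Sum>l<5. \<phi> i l * (C i l * P l l / C l l)) = Y"
  proof -
    have "(\<Sum>i<5. \<Sum>l<5. \<phi> i l * (C i l * P l l / C l l)) = (\<Sum>l<5. \<Sum>i<5. \<phi> i l * (C i l * P l l / C l l))"
      by (rule sum.swap)
    also have "\<dots> = (\<Sum>l<5. \<Sum>i<5. \<phi> l i * (P l l * C l i / C l l))"
      by (intro sum.cong refl) (auto simp: \<phi>_def tri_commute Csym)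
    finally show ?thesis by (simp add: Y_def)
  qed
  have sumout: "(\<Sum>i<5. \<Sum>l\<in>{..<5}-{i}. - (4 / (pi * sqrt pi * D * sqrt D)) * (\<phi> i l * (P i l - C i l * (P i i / C i i + P l l / C l l) / 2))) =
     - (4 / (pi * sqrt pi * D * sqrt D)) * (X - Y)"
  proof -
    have "(\<Sum>i<5. \<Sum>l\<in>{..<5}-{i}. \<phi> i l * (P i l - C i l * (P i i / C i i + P l l / C l l) / 2)) =
      (\<Sum>i<5. \<Sum>l<5. \<phi> i l * (P i l - C i l * (P i i / C i i + P l l / C l l) / 2))"
      by (intro sum.cong refl sum.mono_neutral_left) (auto simp: \<phi>_def)
    also have "\<dots> = (\<Sum>i<5. \<Sum>l<5. \<phi> i l * P i l - \<phi> i l * (P i i * C i l / C i i) / 2 - \<phi> i l * (C i l * P l l / C l l) / 2)"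
      by (intro sum.cong refl) (simp add: algebra_simps add_divide_distrib)
    also have "\<dots> = X - Y / 2 - (\<Sum>i<5. \<Sum>l<5. \<phi> i l * (C i l * P l l / C l l)) / 2"
      unfolding X_def Y_def by (simp only: sum_subtractf sum_divide_distrib)
    also have "\<dots> = X - Y" unfolding Y' by simp
    finally show ?thesis by (simp only: sum_distrib_left[symmetric])
  qed
  have "((\<lambda>t. sqrt (det5 (line_gram t)) * mom0 (line_gram t) {..<5} -
     pi * sqrt pi / 16 * (\<Sum>i<5. \<Sum>l\<in>{..<5}-{i}. out_angle (line_gram t) i l)) has_real_derivative
     (D' * (inverse (sqrt D) / 2) * \<Phi> + - (\<Sum>i<5. \<Sum>j<5. d i j * M i j) * sqrt D) -
     pi * sqrt pi / 16 * (\<Sum>i<5. \<Sum>l\<in>{..<5}-{i}. - (4 / (pi * sqrt pi * D * sqrt D)) * (\<phi> i l * (P i l - C i l * (P i i / C i i + P l l / C l l) / 2)))) (at t)"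
    by (intro DERIV_diff DERIV_cmult DERIV_sum W out) auto
  moreover have "(D' * (inverse (sqrt D) / 2) * \<Phi> + - (\<Sum>i<5. \<Sum>j<5. d i j * M i j) * sqrt D) -
     pi * sqrt pi / 16 * (- (4 / (pi * sqrt pi * D * sqrt D)) * (X - Y)) = 0"
  proof -
    define s where "s = sqrt D"
    have s: "s > 0" "D = s * s" using D by (auto simp: s_def)
    have p: "pi * sqrt pi \<noteq> 0" by simp
    have "pi * sqrt pi / 16 * (- (4 / (pi * sqrt pi * D * s)) * (X - Y)) = - (X - Y) / (4 * D * s)"
      using p s by (simp add: field_simps)
    then show ?thesis unfolding S sumP s_def[symmetric] using s by (simp add: field_simps power2_eq_square)
  qed
  ultimately show ?thesis unfolding sumout by simp
qed

text \<open>Up to the end \<open>t = 1\<close>, where the determinant is 0, Jacobi's identity still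
  gives cosines of absolute value at most 1; there they reach the ends of the domain of
  arccos.\<close>

lemma line_defect_continuous:
  "continuous_on {0..1} (\<lambda>t. sqrt (det5 (line_gram t)) * mom0 (line_gram t) {..<5} -
     pi * sqrt pi / 16 * (\<Sum>i<5. \<Sum>l\<in>{..<5}-{i}. out_angle (line_gram t) i l))"
proof -
  have det: "continuous_on {0..1} (\<lambda>t. det5 (line_gram t))"
    by (intro continuous_at_imp_continuous_on ballI DERIV_isCont[OF line_det5_deriv])
  have cof: "continuous_on {0..1} (\<lambda>t. cof (line_gram t) i l)" for i l
    by (intro continuous_at_imp_continuous_on ballI DERIV_isCont[OF line_cof_deriv])
  have mom: "continuous_on {0..1} (\<lambda>t. mom0 (line_gram t) {..<5})"
    unfolding continuous_on_eq_continuous_within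
  proof
    fix t :: real assume "t \<in> {0..1}"
    from DERIV_continuous[OF mom0_line_derivative[OF g flat_gram _ _ this, of "{..<5}"]]
    show "continuous (at t within {0..1}) (\<lambda>t. mom0 (line_gram t) {..<5})"
      unfolding line_gram_def[abs_def] by simp
  qed
  have out: "continuous_on {0..1} (\<lambda>t. out_angle (line_gram t) i l)" if "i < 5" "l \<in> {..<5} - {i}" for i l
    unfolding out_angle_def
  proof (intro continuous_on_arccos ballI)
    have il: "i < 5" "l < 5" "i \<noteq> l" using that by auto
    have pos: "cof (line_gram t) i i * cof (line_gram t) l l > 0" if "t \<in> {0..1}" for t
      using line_cof_diag_neg[OF that] il by (simp add: mult_neg_neg)
    show "continuous_on {0..1} (\<lambda>t. - cof (line_gram t) i l / sqrt (cof (line_gram t) i i * cof (line_gram t) l l))"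
      using pos by (intro continuous_intros cof) fastforce
    fix t :: real assume t: "t \<in> {0..1}"
    have "(cof (line_gram t) i l)\<^sup>2 \<le> cof (line_gram t) i i * cof (line_gram t) l l"
    proof -
      have "0 \<le> 2 * det5 (line_gram t) * tri (line_gram t) i l"
        using line_det5_nonneg[OF t] pos_off_diag.tri_pos[OF line_gram_pos[OF t] il] by simp
      then show ?thesis using zero_diag.cof_minor2[OF line_gram_zero_diag il, of t] by linarith
    qed
    define s where "s = sqrt (cof (line_gram t) i i * cof (line_gram t) l l)"
    have s: "s > 0" using pos[OF t] by (simp add: s_def)
    have "\<bar>cof (line_gram t) i l\<bar> \<le> s"
      unfolding s_def using \<open>(cof (line_gram t) i l)\<^sup>2 \<le> _\<close> by (rule real_le_rsqrt[OF power2_abs[THEN ord_eq_le_trans]])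
    then show "- 1 \<le> - cof (line_gram t) i l / sqrt (cof (line_gram t) i i * cof (line_gram t) l l) \<and>
      - cof (line_gram t) i l / sqrt (cof (line_gram t) i i * cof (line_gram t) l l) \<le> 1"
      unfolding s_def[symmetric] using s by (simp add: abs_le_iff pos_divide_le_eq pos_le_divide_eq)
  qed
  show ?thesis
    by (intro continuous_intros det mom out) auto
qed

text \<open>The defect is constant on the segment. At \<open>t = 1\<close> the vanishing determinant
  removes the volume term and only the known angle sum \<open>12 * pi\<close> is left.\<close>

lemma gram_volume_formula:
  "sqrt (det5 g) * mom0 g {..<5} = pi * sqrt pi / 16 * ((\<Sum>i<5. \<Sum>l\<in>{..<5}-{i}. out_angle g i l) - 12 * pi)"
proof -
  have "sqrt (det5 (line_gram 1)) * mom0 (line_gram 1) {..<5} -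
     pi * sqrt pi / 16 * (\<Sum>i<5. \<Sum>l\<in>{..<5}-{i}. out_angle (line_gram 1) i l) =
    sqrt (det5 (line_gram 0)) * mom0 (line_gram 0) {..<5} -
     pi * sqrt pi / 16 * (\<Sum>i<5. \<Sum>l\<in>{..<5}-{i}. out_angle (line_gram 0) i l)"
    by (rule DERIV_isconst_end[OF _ line_defect_continuous line_defect_deriv]) auto
  then show ?thesis
    unfolding line_gram_0 line_gram_1 det5_flat_gram sum_out_angle_flat_gram by (simp add: algebra_simps)
qed

end

section \<open>Hyperbolic volume as a Gaussian integral\<close>

text \<open>As measurability rules, these make the prover diverge on functions that are not of the form treated above.\<close>

declare measurable_hl [measurable del]
  qf_measurable [measurable del] exp_qf_measurable [measurable del] cube_or_star_measurable [measurable del]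

lemma det_4:
  "det (A::'a::comm_ring_1^4^4) =
    A$1$1 * (A$2$2 * (A$3$3 * A$4$4 - A$3$4 * A$4$3) - A$2$3 * (A$3$2 * A$4$4 - A$3$4 * A$4$2) + A$2$4 * (A$3$2 * A$4$3 - A$3$3 * A$4$2))
  - A$1$2 * (A$2$1 * (A$3$3 * A$4$4 - A$3$4 * A$4$3) - A$2$3 * (A$3$1 * A$4$4 - A$3$4 * A$4$1) + A$2$4 * (A$3$1 * A$4$3 - A$3$3 * A$4$1))
  + A$1$3 * (A$2$1 * (A$3$2 * A$4$4 - A$3$4 * A$4$2) - A$2$2 * (A$3$1 * A$4$4 - A$3$4 * A$4$1) + A$2$4 * (A$3$1 * A$4$2 - A$3$2 * A$4$1))
  - A$1$4 * (A$2$1 * (A$3$2 * A$4$3 - A$3$3 * A$4$2) - A$2$2 * (A$3$1 * A$4$3 - A$3$3 * A$4$1) + A$2$3 * (A$3$1 * A$4$2 - A$3$2 * A$4$1))"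
proof -
  have f1234: "finite {2::4, 3, 4}" "1 \<notin> {2::4, 3, 4}" by auto
  have f234: "finite {3::4, 4}" "2 \<notin> {3::4, 4}" by auto
  have f34: "finite {4::4}" "3 \<notin> {4::4}" by auto
  show ?thesis
    unfolding det_def UNIV_4
    unfolding sum_over_permutations_insert[OF f1234]
    unfolding sum_over_permutations_insert[OF f234]
    unfolding sum_over_permutations_insert[OF f34]
    unfolding permutes_sing
    by (simp add: sign_swap_id permutation_swap_id sign_compose sign_id swap_id_eq permutation_compose algebra_simps)
qed

text \<open>The metric is a multiple \<open>r\<close> of the identity plus a rank-one matrix, so its
  determinant is \<open>r ^ 4 + r ^ 5 * (norm x)\<^sup>2\<close>, and
  \<open>r * (1 - (norm x)\<^sup>2) = 1\<close> turns this into \<open>r ^ 5\<close>.\<close>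

lemma sqrt_det_klein_metric:
  fixes x :: "real ^ 4"
  assumes "norm x < 1"
  shows "sqrt (det (\<chi> i j. klein_metric x (axis i 1) (axis j 1))) = 1 / sqrt (1 - (norm x)\<^sup>2) ^ 5"
proof -
  define s where "s = 1 - (norm x)\<^sup>2"
  have s: "s > 0" using assms abs_square_less_1[of "norm x"] by (simp add: s_def)
  define r where "r = 1 / s"
  have n: "x $ 1 * x $ 1 + x $ 2 * x $ 2 + x $ 3 * x $ 3 + x $ 4 * x $ 4 = 1 - s"
    by (simp add: s_def power2_norm_eq_inner inner_vec_def sum_4)
  have rs: "r * s = 1" using s by (simp add: r_def)
  have k: "klein_metric x (axis i 1) (axis j 1) = (if i = j then r else 0) + x $ i * x $ j * (r * r)" for i j
  proof -
    have "axis i (1::real) $ j = (if i = j then 1 else 0)" by (simp add: axis_def)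
    then show ?thesis
      by (simp add: klein_metric_def inner_axis_axis inner_axis r_def s_def power2_eq_square)
  qed
  have "det (\<chi> i j. klein_metric x (axis i 1) (axis j 1)) = r ^ 4 + r ^ 3 * (r * r) * (x $ 1 * x $ 1 + x $ 2 * x $ 2 + x $ 3 * x $ 3 + x $ 4 * x $ 4)"
    unfolding k det_4 by (simp del: One_nat_def; algebra)
  also have "\<dots> = r ^ 5"
    unfolding n using rs by algebra
  finally have "sqrt (det (\<chi> i j. klein_metric x (axis i 1) (axis j 1))) = sqrt (r ^ 5)" by simp
  also have "\<dots> = 1 / sqrt s ^ 5"
    by (simp add: r_def real_sqrt_power real_sqrt_divide power_divide)
  finally show ?thesis by (simp add: s_def)
qed

lemma emeasure_hyp_measure:
  fixes M :: "(real ^ 4) set"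
  assumes M: "M \<in> sets borel" "M \<subseteq> ball 0 1"
  shows "emeasure hyp_measure M = (\<integral>\<^sup>+x. ennreal (1 / sqrt (1 - (norm x)\<^sup>2) ^ 5) * indicator M x \<partial>lborel)"
proof -
  let ?f = "\<lambda>x::real^4. ennreal (sqrt (det (\<chi> i j. klein_metric x (axis i 1) (axis j 1))))"
  let ?h = "\<lambda>x::real^4. ennreal (1 / sqrt (1 - (norm x)\<^sup>2) ^ 5)"
  let ?R = "restrict_space lborel hyp_space :: (real^4) measure"
  have hb: "hyp_space \<in> sets (lborel :: (real^4) measure)" by (simp add: hyp_space_def)
  have eq: "?f x = ?h x" if "x \<in> space ?R" for x
    using that sqrt_det_klein_metric[of x] by (simp add: space_restrict_space hyp_space_def)
  have h: "?h \<in> borel_measurable borel" by measurable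
  have "?h \<in> borel_measurable ?R" by (rule measurable_restrict_space1) (simp add: h)
  then have f: "?f \<in> borel_measurable ?R" using measurable_cong[of ?R ?f ?h] eq by blast
  have MR: "M \<in> sets ?R" using M hb by (simp add: sets_restrict_space_iff hyp_space_def)
  have "emeasure hyp_measure M = (\<integral>\<^sup>+x. ?f x * indicator M x \<partial>?R)"
    unfolding hyp_measure_def by (rule emeasure_density[OF f MR])
  also have "\<dots> = (\<integral>\<^sup>+x. ?h x * indicator M x \<partial>?R)"
    by (rule nn_integral_cong) (simp only: eq)
  also have "\<dots> = (\<integral>\<^sup>+x. ?h x * indicator M x * indicator hyp_space x \<partial>lborel)"
    using hb by (subst nn_integral_restrict_space) auto
  also have "\<dots> = (\<integral>\<^sup>+x. ?h x * indicator M x \<partial>lborel)"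
    using M by (intro nn_integral_cong) (auto simp: indicator_def hyp_space_def)
  finally show ?thesis .
qed

section \<open>Changes of variables and two descriptions of the orthant\<close>

lemma nn_integral_lborel_linear:
  fixes f :: "real ^ 'n::{finite,wellorder} \<Rightarrow> ennreal" and E :: "real ^ 'n::_ ^ 'n::_"
  assumes f: "f \<in> borel_measurable borel" and E: "det E \<noteq> 0"
  shows "(\<integral>\<^sup>+x. f x \<partial>lborel) = ennreal \<bar>det E\<bar> * (\<integral>\<^sup>+x. f (a + E *v x) \<partial>lborel)"
proof -
  let ?T = "\<lambda>x. a + E *v x"
  have T: "?T \<in> borel_measurable borel"
    by (intro borel_measurable_continuous_onI continuous_intros)
  have inv: "invertible E" using E by (simp add: invertible_det_nz)
  then obtain F where FE: "F ** E = mat 1" "E ** F = mat 1" unfolding invertible_def by blast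
  have detF: "\<bar>det E\<bar> * \<bar>det F\<bar> = 1"
    using FE(2) by (metis abs_mult abs_one det_I det_mul)
  have "lborel = density (distr lborel borel ?T) (\<lambda>_. ennreal \<bar>det E\<bar>)"
  proof (rule lborel_eqI)
    fix l u :: "real ^ 'n::_" assume le: "\<And>b. b \<in> Basis \<Longrightarrow> l \<bullet> b \<le> u \<bullet> b"
    \<comment> \<open>Lebesgue measure is characterized on boxes; the preimage of a box is a linear
      image under the inverse matrix, whose measure is known from the determinant.\<close>
    have vi: "?T -` box l u = (*v) F ` box (l - a) (u - a)"
    proof -
      have "?T x \<in> box l u \<longleftrightarrow> E *v x \<in> box (l - a) (u - a)" for x
        by (auto simp: mem_box inner_diff_left inner_add_left algebra_simps)
      moreover have "E *v x \<in> S \<longleftrightarrow> x \<in> (*v) F ` S" for x S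
      proof
        assume "E *v x \<in> S"
        then show "x \<in> (*v) F ` S" by (metis FE(1) image_eqI matrix_vector_mul_assoc matrix_vector_mul_lid)
      next
        assume "x \<in> (*v) F ` S"
        then show "E *v x \<in> S" by (metis FE(2) imageE matrix_vector_mul_assoc matrix_vector_mul_lid)
      qed
      ultimately show ?thesis by auto
    qed
    have lm: "(*v) F ` box (l - a) (u - a) \<in> lmeasurable"
      by (rule measurable_linear_image) (auto simp: matrix_vector_mul_linear)
    have "emeasure (density (distr lborel borel ?T) (\<lambda>_. ennreal \<bar>det E\<bar>)) (box l u) = ennreal \<bar>det E\<bar> * emeasure (distr lborel borel ?T) (box l u)"
      by (rule emeasure_density_const) simp
    also have "emeasure (distr lborel borel ?T) (box l u) = emeasure lborel ((*v) F ` box (l - a) (u - a))"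
      using T by (subst emeasure_distr) (auto simp: vi)
    also have "\<dots> = emeasure lebesgue ((*v) F ` box (l - a) (u - a))"
    proof -
      have "?T -` box l u \<in> sets borel" using measurable_sets[OF T, of "box l u"] by simp
      then show ?thesis unfolding vi by simp
    qed
    also have "\<dots> = ennreal (measure lebesgue ((*v) F ` box (l - a) (u - a)))"
      by (rule emeasure_eq_measure2[OF lm])
    also have "measure lebesgue ((*v) F ` box (l - a) (u - a)) = \<bar>det F\<bar> * measure lebesgue (box (l - a) (u - a))"
    proof -
      have "matrix ((*v) F) = F" by (rule matrix_of_matrix_vector_mul)
      moreover have "box (l - a) (u - a) \<in> lmeasurable" by (rule lmeasurable_box)
      ultimately show ?thesis using measure_linear_image[OF matrix_vector_mul_linear[of F]] by metis
    qed
    also have "measure lebesgue (box (l - a) (u - a)) = (\<Prod>b\<in>Basis. (u - l) \<bullet> b)"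
    proof -
      have "measure lebesgue (box (l - a) (u - a)) = measure lborel (box (l - a) (u - a))"
        by (rule measure_completion) simp
      also have "\<dots> = (\<Prod>b\<in>Basis. (u - a - (l - a)) \<bullet> b)"
        using le by (subst measure_lborel_box_eq) (simp add: inner_diff_left)
      finally show ?thesis by simp
    qed
    also have "ennreal \<bar>det E\<bar> * ennreal (\<bar>det F\<bar> * (\<Prod>b\<in>Basis. (u - l) \<bullet> b)) = ennreal (\<Prod>b\<in>Basis. (u - l) \<bullet> b)"
      using detF by (simp add: ennreal_mult'[symmetric] mult.assoc[symmetric])
    finally show "emeasure (density (distr lborel borel ?T) (\<lambda>_. ennreal \<bar>det E\<bar>)) (box l u) = ennreal (\<Prod>b\<in>Basis. (u - l) \<bullet> b)" .
  qed simp
  then have "(\<integral>\<^sup>+x. f x \<partial>lborel) = (\<integral>\<^sup>+x. f x \<partial>density (distr lborel borel ?T) (\<lambda>_. ennreal \<bar>det E\<bar>))" by simp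
  also have "\<dots> = (\<integral>\<^sup>+x. ennreal \<bar>det E\<bar> * f x \<partial>distr lborel borel ?T)"
    using f by (subst nn_integral_density) auto
  also have "\<dots> = ennreal \<bar>det E\<bar> * (\<integral>\<^sup>+x. f x \<partial>distr lborel borel ?T)"
    using f by (intro nn_integral_cmult) simp
  also have "(\<integral>\<^sup>+x. f x \<partial>distr lborel borel ?T) = (\<integral>\<^sup>+x. f (?T x) \<partial>lborel)"
    using T f by (intro nn_integral_distr) auto
  finally show ?thesis .
qed

lemma nn_integral_lborel_scale:
  fixes f :: "real ^ 'n \<Rightarrow> ennreal"
  assumes f: "f \<in> borel_measurable borel" and s: "s > 0"
  shows "(\<integral>\<^sup>+x. f x \<partial>lborel) = ennreal (s ^ CARD('n)) * (\<integral>\<^sup>+x. f (s *\<^sub>R x) \<partial>lborel)"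
proof -
  have T: "(\<lambda>x::real^'n. 0 + s *\<^sub>R x) \<in> borel_measurable borel" by measurable
  have "(\<integral>\<^sup>+x. f x \<partial>lborel) = (\<integral>\<^sup>+x. f x \<partial>density (distr lborel borel (\<lambda>x. 0 + s *\<^sub>R x)) (\<lambda>_. ennreal (\<bar>s\<bar>^DIM(real^'n))))"
    using s lborel_affine[of s "0 :: real^'n"] by simp
  also have "\<dots> = (\<integral>\<^sup>+x. ennreal (\<bar>s\<bar>^DIM(real^'n)) * f x \<partial>distr lborel borel (\<lambda>x. 0 + s *\<^sub>R x))"
    using f by (subst nn_integral_density) auto
  also have "\<dots> = ennreal (\<bar>s\<bar>^DIM(real^'n)) * (\<integral>\<^sup>+x. f x \<partial>distr lborel borel (\<lambda>x. 0 + s *\<^sub>R x))"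
    using f by (intro nn_integral_cmult) simp
  also have "(\<integral>\<^sup>+x. f x \<partial>distr lborel borel (\<lambda>x. 0 + s *\<^sub>R x)) = (\<integral>\<^sup>+x. f (0 + s *\<^sub>R x) \<partial>lborel)"
    using T f by (intro nn_integral_distr) auto
  finally show ?thesis using s by simp
qed

text \<open>Identifies the product measure used for the Gaussian moments with Lebesgue measure on
  the positive part of \<open>real ^ 4\<close>. On \<open>{1..<5}\<close> the map
  \<open>of_nat\<close> hits each element of the index type once.\<close>

lemma PiM_hl_eq_distr:
  "orthant {1..<5} = distr (restrict_space lborel {x :: real^4. \<forall>i. x $ i > 0}) (orthant {1..<5::nat}) (\<lambda>x. \<lambda>k\<in>{1..<5}. x $ of_nat k)"
    (is "_ = distr ?R _ ?T")
proof (rule hlP.PiM_eqI[symmetric])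
  have pos_eq: "{x :: real^4. \<forall>i. x $ i > 0} = {x. x $ 1 > 0} \<inter> {x. x $ 2 > 0} \<inter> {x. x $ 3 > 0} \<inter> {x. x $ 4 > 0}"
    by (auto simp: forall_4)
  have pos: "{x :: real^4. \<forall>i. x $ i > 0} \<in> sets lborel"
    unfolding pos_eq by (intro sets.Int) (simp_all add: open_halfspace_component_gt_cart)
  have comp: "(\<lambda>x. x $ i) \<in> measurable ?R hl" for i
    unfolding hl_def
    by (rule measurable_restrict_space3) auto
  have T: "?T \<in> measurable ?R (orthant {1..<5})"
    by (rule measurable_restrict) (rule comp)
  fix A :: "nat \<Rightarrow> real set" assume A: "\<And>i. i \<in> {1..<5} \<Longrightarrow> A i \<in> sets hl"
  have A': "A i \<in> sets borel" "A i \<subseteq> {0<..}" if "i \<in> {1..<5}" for i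
    using A[OF that] unfolding hl_def by (subst (asm) sets_restrict_space_iff, simp, force)+
  have PE: "Pi\<^sub>E {1..<5} A \<in> sets (orthant {1..<5})" using A by (intro sets_PiM_I_finite) auto
  define A4 where "A4 v = (if v = axis 1 1 then A 1 else if v = axis 2 1 then A 2 else if v = axis 3 1 then A 3 else A 4)" for v :: "real^4"
  have B4: "Basis = {axis 1 1, axis 2 1, axis 3 1, axis 4 1 :: real^4}"
    unfolding Basis_vec_def by (auto simp: UNIV_4)
  have ne: "axis i 1 \<noteq> (axis j 1 :: real^4)" if "i \<noteq> j" for i j using that by (simp add: axis_eq_axis)
  have prod4: "(\<Prod>b\<in>Basis. F b) = F (axis 1 1) * F (axis 2 1) * F (axis 3 1) * F (axis 4 1 :: real^4)" for F :: "real^4 \<Rightarrow> ennreal"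
    unfolding B4 by (subst prod.insert, simp, simp add: ne)+ (simp add: mult.assoc)
  have A4: "A4 (axis 1 1) = A 1" "A4 (axis 2 1) = A 2" "A4 (axis 3 1) = A 3" "A4 (axis 4 1) = A 4"
    by (simp_all add: A4_def ne)
  have A4m: "A4 b \<in> sets borel" for b using A' by (auto simp: A4_def)
  have "emeasure (distr ?R (orthant {1..<5}) ?T) (Pi\<^sub>E {1..<5} A) = emeasure ?R (?T -` Pi\<^sub>E {1..<5} A \<inter> space ?R)"
    by (rule emeasure_distr[OF T PE])
  also have "\<dots> = emeasure lborel (?T -` Pi\<^sub>E {1..<5} A \<inter> space ?R)"
    using pos by (intro emeasure_restrict_space) (auto simp: space_restrict_space)
  also have "?T -` Pi\<^sub>E {1..<5} A \<inter> space ?R = {x. x $ 1 \<in> A 1 \<and> x $ 2 \<in> A 2 \<and> x $ 3 \<in> A 3 \<and> x $ 4 \<in> A 4}"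
  proof -
    have s: "{1..<5::nat} = {1, 2, 3, 4}" by auto
    have p: "x \<in> A i \<Longrightarrow> x > 0" if "i \<in> {1,2,3,4}" for x i using A'(2)[of i] that s by auto
    show ?thesis unfolding s using p by (auto simp: space_restrict_space PiE_iff forall_4)
  qed
  also have "emeasure lborel \<dots> = (\<integral>\<^sup>+x. (\<Prod>b\<in>Basis. indicator (A4 b) (x \<bullet> b)) \<partial>lborel)"
  proof -
    have meas: "{x :: real^4. x $ 1 \<in> A 1 \<and> x $ 2 \<in> A 2 \<and> x $ 3 \<in> A 3 \<and> x $ 4 \<in> A 4} \<in> sets borel"
    proof -
      have "(\<lambda>x::real^4. x $ i) -` A k \<inter> space borel \<in> sets borel" if "k \<in> {1..<5}" for i k
        by (rule measurable_sets[OF _ A'(1)[OF that]]) simp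
      then have "(\<lambda>x::real^4. x $ 1) -` A 1 \<inter> (\<lambda>x::real^4. x $ 2) -` A 2 \<inter> (\<lambda>x::real^4. x $ 3) -` A 3 \<inter> (\<lambda>x::real^4. x $ 4) -` A 4 \<in> sets borel"
        by (intro sets.Int) auto
      then show ?thesis by (simp add: vimage_def Int_def)
    qed
    have "(\<lambda>x::real^4. \<Prod>b\<in>Basis. indicator (A4 b) (x \<bullet> b) :: ennreal) = indicator {x. x $ 1 \<in> A 1 \<and> x $ 2 \<in> A 2 \<and> x $ 3 \<in> A 3 \<and> x $ 4 \<in> A 4}"
      unfolding prod4 A4 by (auto simp: fun_eq_iff indicator_def inner_axis)
    then show ?thesis using meas by (simp add: nn_integral_indicator)
  qed
  also have "\<dots> = (\<Prod>b\<in>Basis. (\<integral>\<^sup>+x. indicator (A4 b) x \<partial>lborel))"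
    by (rule nn_integral_lborel_prod) (use A4m in auto)
  also have "\<dots> = emeasure lborel (A 1) * emeasure lborel (A 2) * emeasure lborel (A 3) * emeasure lborel (A 4)"
    unfolding prod4 A4 using A' by (simp add: nn_integral_indicator)
  also have "\<dots> = (\<Prod>i\<in>{1..<5}. emeasure hl (A i))"
  proof -
    have "emeasure hl (A i) = emeasure lborel (A i)" if "i \<in> {1..<5}" for i
      unfolding hl_def by (rule emeasure_restrict_space) (use A'(2)[OF that] in auto)
    then have "(\<Prod>i\<in>{1..<5}. emeasure hl (A i)) = (\<Prod>i\<in>{1..<5}. emeasure lborel (A i))" by (intro prod.cong) auto
    also have "\<dots> = emeasure lborel (A 1) * emeasure lborel (A 2) * emeasure lborel (A 3) * emeasure lborel (A 4)"
    proof -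
      have s: "{1..<5::nat} = {1,2,3,4}" by auto
      show ?thesis unfolding s by (simp add: mult.assoc)
    qed
    finally show ?thesis by (rule sym)
  qed
  finally show "emeasure (distr ?R (orthant {1..<5}) ?T) (Pi\<^sub>E {1..<5} A) = (\<Prod>i\<in>{1..<5}. emeasure hl (A i))" .
qed simp_all

text \<open>A section of \<open>of_nat\<close>. In the type \<open>4\<close> the numerals 4 and 0
  coincide; choosing the representative 4 keeps the natural number 0 free for the base
  vertex.\<close>

definition index4 :: "4 \<Rightarrow> nat" where
  "index4 j = (if j = 1 then 1 else if j = 2 then 2 else if j = 3 then 3 else 4)"

lemma index4_simps [simp]: "index4 1 = 1" "index4 2 = 2" "index4 3 = 3" "index4 4 = 4"
  by (simp_all add: index4_def)

lemma of_nat_index4 [simp]: "of_nat (index4 j) = j"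
  using exhaust_4[of j] by (elim disjE) (simp_all del: One_nat_def)

lemma sum_index4: "(\<Sum>k\<in>{1..<5}. f k (of_nat k :: 4)) = (\<Sum>j\<in>UNIV. f (index4 j) j)"
proof -
  have s: "{1..<5::nat} = {1, 2, 3, 4}" by auto
  show ?thesis unfolding s sum_4 by (simp add: add.assoc del: One_nat_def)
qed

lemma lessThan_5_insert: "{..<5::nat} = insert 0 {1..<5}"
  by auto

text \<open>A Cayley-Menger identity: when \<open>g\<close> comes from unit vectors, the entries on
  the left are the inner products of the edge vectors from vertex 0, and their Gram determinant is
  the sum of all cofactors of \<open>g\<close>.\<close>

lemma (in zero_diag) det_edge_gram:
  "det (\<chi> i j. g 0 (index4 i) + g 0 (index4 j) - g (index4 i) (index4 j)) = (\<Sum>a<5. \<Sum>b<5. cof g a b)"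
  unfolding det_4 by (simp only: vec_lambda_beta index4_simps cof_poly sym_rules diag; algebra)

section \<open>The simplex with vertices on the sphere, its Gram matrix and its dual basis\<close>

locale sphere_simplex =
  fixes u :: "nat \<Rightarrow> real ^ 4"
  assumes norm_u: "i < 5 \<Longrightarrow> norm (u i) = 1"
    and inj_u: "inj_on u {..<5}"
    and indep: "\<not> affine_dependent (u ` {..<5})"
begin

definition edge_matrix :: "real ^ 4 ^ 4" where
  "edge_matrix = (\<chi> i j. (u (index4 j) - u 0) $ i)"

text \<open>The entries are minus the Lorentz products of the light-like vectors
  \<open>(1, u i)\<close>. The value 1 outside the range makes the matrix satisfy
  \<open>pos_off_diag\<close> for all indices.\<close>

definition gram :: "nat \<Rightarrow> nat \<Rightarrow> real" where
  "gram i j = (if i = j then 0 else if i < 5 \<and> j < 5 then 1 - u i \<bullet> u j else 1)"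

lemma inner_u [simp]: "i < 5 \<Longrightarrow> u i \<bullet> u i = 1"
  using norm_u[of i] by (simp add: norm_eq_1)

lemma gram_eq: "i < 5 \<Longrightarrow> j < 5 \<Longrightarrow> gram i j = 1 - u i \<bullet> u j"
  by (auto simp: gram_def)

lemma gram_pos_off_diag: "pos_off_diag gram"
proof
  show "gram i j = gram j i" for i j by (auto simp: gram_def inner_commute)
  show "gram i i = 0" for i by (simp add: gram_def)
  show "gram i j > 0" if "i \<noteq> j" for i j
  proof (cases "i < 5 \<and> j < 5")
    case True
    then have "u i - u j \<noteq> 0" using inj_u that by (auto simp: inj_on_def)
    then have "0 < (u i - u j) \<bullet> (u i - u j)" by simp
    also have "\<dots> = 2 - 2 * (u i \<bullet> u j)"
      using True by (simp add: inner_diff_left inner_diff_right inner_commute)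
    finally show ?thesis using True that by (simp add: gram_def)
  qed (use that in \<open>auto simp: gram_def\<close>)
qed

lemma combination_zero:
  assumes "(\<Sum>k<5. w k) = 0" "(\<Sum>k<5. w k *\<^sub>R u k) = 0" "k < 5"
  shows "w k = 0"
proof (rule ccontr)
  assume k: "w k \<noteq> 0"
  define U where "U = w \<circ> inv_into {..<5} u"
  have U: "U (u k) = w k" if "k < 5" for k using inj_u that by (simp add: U_def)
  have "sum U (u ` {..<5}) = 0"
    using assms(1) by (subst sum.reindex[OF inj_u]) (simp add: U)
  moreover have "(\<Sum>v\<in>u ` {..<5}. U v *\<^sub>R v) = 0"
    using assms(2) by (subst sum.reindex[OF inj_u]) (simp add: U)
  moreover have "\<exists>v\<in>u ` {..<5}. U v \<noteq> 0" using k U assms(3) by auto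
  ultimately have "affine_dependent (u ` {..<5})"
    by (subst affine_dependent_explicit_finite) auto
  then show False using indep by simp
qed

text \<open>The right-hand side is the square of the time part minus that of the space part of the
  combination of the vectors \<open>(1, u k)\<close> with coefficients \<open>w k\<close>.\<close>

lemma qf_gram: "qf gram {..<5} w = (\<Sum>k<5. w k)\<^sup>2 - (norm (\<Sum>k<5. w k *\<^sub>R u k))\<^sup>2"
proof -
  have "qf gram {..<5} w = (\<Sum>i<5. \<Sum>j<5. w i * w j - w i * w j * (u i \<bullet> u j))"
    unfolding qf_def by (intro sum.cong refl) (simp add: gram_eq algebra_simps)
  also have "\<dots> = (\<Sum>i<5. \<Sum>j<5. w i * w j) - (\<Sum>i<5. \<Sum>j<5. w i * w j * (u i \<bullet> u j))"
    by (simp only: sum_subtractf)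
  also have "(\<Sum>i<5. \<Sum>j<5. w i * w j) = (\<Sum>k<5. w k)\<^sup>2"
    by (simp only: power2_eq_square sum_product)
  also have "(\<Sum>i<5. \<Sum>j<5. w i * w j * (u i \<bullet> u j)) = (\<Sum>i<5. w i *\<^sub>R u i) \<bullet> (\<Sum>j<5. w j *\<^sub>R u j)"
    unfolding inner_sum_left by (intro sum.cong refl) (simp add: inner_sum_right mult_ac)
  finally show ?thesis by (simp only: power2_norm_eq_inner)
qed

text \<open>The linear condition says that the combined vector \<open>(s, p)\<close> is Lorentz
  orthogonal to the light-like \<open>(1, u 0)\<close>. Such a vector is space-like unless it is a
  multiple of \<open>(1, u 0)\<close>, which affine independence excludes.\<close>

lemma cnd_gram: "cnd gram"
  unfolding cnd_def
proof (intro allI impI)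
  fix w :: "nat \<Rightarrow> real"
  assume w: "(\<Sum>i<5. gram 0 i * w i) = 0" and ne: "\<exists>i\<in>{1..<5}. w i \<noteq> 0"
  define s where "s = (\<Sum>k<5. w k)"
  define p where "p = (\<Sum>k<5. w k *\<^sub>R u k)"
  have "(\<Sum>i<5. gram 0 i * w i) = (\<Sum>i<5. w i - u 0 \<bullet> (w i *\<^sub>R u i))"
    by (intro sum.cong refl) (simp add: gram_eq algebra_simps)
  then have s: "s = u 0 \<bullet> p" using w by (simp add: s_def p_def sum_subtractf inner_sum_right)
  have "p \<noteq> s *\<^sub>R u 0"
  proof
    assume eq: "p = s *\<^sub>R u 0"
    define v where "v k = w k - (if k = 0 then s else 0)" for k
    have "(\<Sum>k<5. v k) = 0" by (simp add: v_def sum_subtractf s_def)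
    moreover have "(\<Sum>k<5. v k *\<^sub>R u k) = p - (\<Sum>k<5. if k = 0 then s *\<^sub>R u k else 0)"
      unfolding p_def sum_subtractf[symmetric] by (intro sum.cong refl) (simp add: v_def scaleR_diff_left)
    then have "(\<Sum>k<5. v k *\<^sub>R u k) = 0" using eq by simp
    ultimately have "v k = 0" if "k < 5" for k using combination_zero[of v k] that by blast
    then have "w k = 0" if "k \<in> {1..<5}" for k using that by (force simp: v_def)
    then show False using ne by blast
  qed
  then have "0 < (p - s *\<^sub>R u 0) \<bullet> (p - s *\<^sub>R u 0)" by simp
  also have "\<dots> = p \<bullet> p - s\<^sup>2"
  proof -
    have "p \<bullet> u 0 = s" "u 0 \<bullet> p = s" using s by (simp_all add: inner_commute)
    then show ?thesis by (simp add: inner_diff_left inner_diff_right power2_eq_square)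
  qed
  finally show "qf gram {..<5} w < 0" unfolding qf_gram by (simp add: s_def p_def power2_norm_eq_inner)
qed

lemma edge_matrix_mult: "edge_matrix *v b = (\<Sum>k\<in>{1..<5}. b $ of_nat k *\<^sub>R (u k - u 0))"
proof -
  have "edge_matrix *v b = (\<Sum>j\<in>UNIV. b $ j *\<^sub>R (u (index4 j) - u 0))"
    by (simp add: vec_eq_iff edge_matrix_def matrix_vector_mult_def mult.commute)
  then show ?thesis using sum_index4[of "\<lambda>k j. b $ j *\<^sub>R (u k - u 0)"] by simp
qed

definition bary :: "real ^ 4 \<Rightarrow> nat \<Rightarrow> real" where
  "bary b k = (if k = 0 then 1 - (\<Sum>k\<in>{1..<5}. b $ of_nat k) else b $ of_nat k)"

lemma sum_bary: "(\<Sum>k<5. bary b k) = 1"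
  unfolding lessThan_5_insert by (simp add: bary_def)

lemma bary_combination: "(\<Sum>k<5. bary b k *\<^sub>R u k) = u 0 + edge_matrix *v b"
proof -
  define S where "S = (\<Sum>k\<in>{1..<5}. b $ of_nat k)"
  define T where "T = (\<Sum>k\<in>{1..<5}. b $ of_nat k *\<^sub>R u k)"
  have "(\<Sum>k\<in>{1..<5}. bary b k *\<^sub>R u k) = T"
    unfolding T_def by (rule sum.cong) (auto simp: bary_def)
  moreover have "bary b 0 = 1 - S" by (simp add: bary_def S_def)
  ultimately have "(\<Sum>k<5. bary b k *\<^sub>R u k) = (1 - S) *\<^sub>R u 0 + T"
    unfolding lessThan_5_insert by simp
  moreover have "edge_matrix *v b = T - S *\<^sub>R u 0"
    unfolding edge_matrix_mult S_def T_def scaleR_sum_left scaleR_diff_right sum_subtractf ..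
  ultimately show ?thesis by (simp add: scaleR_diff_left)
qed

lemma edge_matrix_kernel:
  assumes b: "edge_matrix *v b = 0"
  shows "b = 0"
proof -
  define w where "w k = bary b k - (if k = 0 then 1 else 0)" for k
  have "(\<Sum>k<5. w k) = 0" by (simp add: w_def sum_subtractf sum_bary)
  moreover have "(\<Sum>k<5. w k *\<^sub>R u k) = (\<Sum>k<5. bary b k *\<^sub>R u k) - (\<Sum>k<5. if k = 0 then u k else 0)"
    unfolding sum_subtractf[symmetric] by (intro sum.cong refl) (simp add: w_def scaleR_diff_left)
  moreover have "(\<Sum>k<5::nat. if k = 0 then u k else 0) = u 0" by simp
  ultimately have "(\<Sum>k<5. w k) = 0" "(\<Sum>k<5. w k *\<^sub>R u k) = 0"
    unfolding bary_combination b by (simp_all only: add_0_right diff_self)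
  then have "w k = 0" if "k < 5" for k using combination_zero[of w k] that by blast
  moreover have "index4 j < 5" for j by (simp add: index4_def)
  ultimately have "w (index4 j) = 0" for j by blast
  moreover have "w (index4 j) = b $ j" for j
  proof -
    have "index4 j \<noteq> 0" by (simp add: index4_def)
    then show ?thesis unfolding w_def bary_def by simp
  qed
  ultimately have "b $ j = 0" for j by simp
  then show ?thesis by (simp add: vec_eq_iff)
qed

lemma det_edge_matrix_nonzero: "det edge_matrix \<noteq> 0"
proof -
  have "\<exists>B. B ** edge_matrix = mat 1"
    unfolding matrix_left_invertible_ker using edge_matrix_kernel by blast
  then have "invertible edge_matrix" unfolding invertible_left_inverse .
  then show ?thesis unfolding invertible_det_nz .
qed

definition inv_edge :: "real ^ 4 ^ 4" where
  "inv_edge = (SOME F. edge_matrix ** F = mat 1 \<and> F ** edge_matrix = mat 1)"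

lemma inv_edge: "edge_matrix ** inv_edge = mat 1" "inv_edge ** edge_matrix = mat 1"
proof -
  have "\<exists>F. edge_matrix ** F = mat 1 \<and> F ** edge_matrix = mat 1"
    using det_edge_matrix_nonzero invertible_det_nz unfolding invertible_def by blast
  from someI_ex[OF this] show "edge_matrix ** inv_edge = mat 1" "inv_edge ** edge_matrix = mat 1"
    unfolding inv_edge_def by blast+
qed

text \<open>Minus the gradient of a barycentric coordinate, hence pointing out of the simplex across
  the opposite facet; the length is not normalized.\<close>

definition normal :: "nat \<Rightarrow> real ^ 4" where
  "normal k = (if k = 0 then (\<Sum>k\<in>{1..<5}. row (of_nat k) inv_edge) else - row (of_nat k) inv_edge)"

definition height :: "nat \<Rightarrow> real" where
  "height k = (if k = 0 then 1 else 0) + normal k \<bullet> u 0"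

lemma bary_affine: "bary (inv_edge *v (y - u 0)) k = height k - normal k \<bullet> y"
proof -
  have r: "(inv_edge *v v) $ j = row j inv_edge \<bullet> v" for v j
    by (simp add: matrix_vector_mult_def row_def inner_vec_def)
  show ?thesis
  proof (cases "k = 0")
    case True
    have "(\<Sum>k\<in>{1..<5}. row (of_nat k) inv_edge \<bullet> (y - u 0)) = normal 0 \<bullet> (y - u 0)"
      by (simp add: normal_def inner_sum_left)
    moreover have "bary (inv_edge *v (y - u 0)) 0 = 1 - (\<Sum>k\<in>{1..<5}. row (of_nat k) inv_edge \<bullet> (y - u 0))"
      by (simp add: bary_def r)
    ultimately show ?thesis
      using True by (simp add: height_def inner_diff_right)
  next
    case False
    then show ?thesis
      by (simp only: bary_def height_def normal_def r if_False inner_diff_right inner_minus_left)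
  qed
qed

definition coord :: "nat \<Rightarrow> real ^ 4 \<Rightarrow> real" where
  "coord k y = height k - normal k \<bullet> y"

lemma sum_coord: "(\<Sum>k<5. coord k y) = 1"
  unfolding coord_def bary_affine[symmetric] by (rule sum_bary)

lemma coord_combination: "(\<Sum>k<5. coord k y *\<^sub>R u k) = y"
  unfolding coord_def bary_affine[symmetric] bary_combination
  by (simp add: matrix_vector_mul_assoc inv_edge)

lemma coord_u:
  assumes "k < 5" "l < 5"
  shows "coord k (u l) = (if k = l then 1 else 0)"
proof -
  define w where "w k = coord k (u l) - (if k = l then 1 else 0)" for k
  have "(\<Sum>k<5. w k) = 0" using assms by (simp add: w_def sum_subtractf sum_coord)
  moreover have "(\<Sum>k<5. w k *\<^sub>R u k) = (\<Sum>k<5. coord k (u l) *\<^sub>R u k) - (\<Sum>k<5. if k = l then u k else 0)"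
    unfolding sum_subtractf[symmetric] by (intro sum.cong refl) (simp add: w_def scaleR_diff_left)
  then have "(\<Sum>k<5. w k *\<^sub>R u k) = 0" using assms by (simp add: coord_combination)
  ultimately have "w k = 0" using combination_zero[of w k] assms by blast
  then show ?thesis by (simp add: w_def)
qed

lemma coord_edge: "coord k (u 0 + edge_matrix *v b) = bary b k"
  unfolding coord_def bary_affine[symmetric] by (simp add: matrix_vector_mul_assoc inv_edge)

lemma coord_affine:
  assumes "(\<Sum>k<5. w k) = 1" "l < 5"
  shows "coord l (\<Sum>k<5. w k *\<^sub>R u k) = w l"
proof -
  have "coord l (\<Sum>k<5. w k *\<^sub>R u k) = (\<Sum>k<5. w k * coord l (u k))"
    using assms(1) by (simp add: coord_def inner_sum_right right_diff_distrib sum_subtractf sum_distrib_right[symmetric])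
  also have "\<dots> = w l" using assms(2) by (simp add: coord_u if_distrib cong: if_cong)
  finally show ?thesis .
qed

lemma sum_height: "(\<Sum>k<5. height k) = 1" "(\<Sum>k<5. height k *\<^sub>R u k) = 0"
  using sum_coord[of 0] coord_combination[of 0] by (simp_all add: coord_def)

lemma sum_normal: "(\<Sum>k<5. normal k) = 0"
proof -
  have "(\<Sum>k<5. normal k) \<bullet> y = 0" for y
    using sum_coord[of y] sum_height by (simp add: coord_def sum_subtractf inner_sum_left)
  from this[of "\<Sum>k<5. normal k"] show ?thesis by simp
qed

lemma sum_normal_inner: "(\<Sum>k<5. (normal k \<bullet> y) *\<^sub>R u k) = - y"
proof -
  have "- (\<Sum>k<5. (normal k \<bullet> y) *\<^sub>R u k) = y"
    using coord_combination[of y] sum_height(2) by (simp add: coord_def scaleR_diff_left sum_subtractf)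
  then show ?thesis by (metis minus_minus)
qed

text \<open>The pairs \<open>(height a, normal a)\<close> form the basis Lorentz dual to the vectors
  \<open>(1, u b)\<close>, as \<open>coord_u\<close> expresses; their Gram matrix is therefore the
  inverse of \<open>gram\<close>.\<close>

definition dual :: "nat \<Rightarrow> nat \<Rightarrow> real" where
  "dual a b = height a * height b - normal a \<bullet> normal b"

lemma dual_commute: "dual a b = dual b a"
  by (simp add: dual_def inner_commute mult.commute)

lemma dual_gram:
  assumes "a < 5" "e < 5"
  shows "(\<Sum>b<5. dual a b * gram b e) = (if a = e then 1 else 0)"
proof -
  have 1: "(\<Sum>b<5. height b * gram b e) = 1"
  proof -
    have "(\<Sum>b<5. height b * gram b e) = (\<Sum>b<5. height b) - (\<Sum>b<5. height b *\<^sub>R u b) \<bullet> u e"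
      using assms by (simp add: gram_eq inner_sum_left right_diff_distrib sum_subtractf)
    then show ?thesis by (simp add: sum_height)
  qed
  have 2: "(\<Sum>b<5. (normal a \<bullet> normal b) * gram b e) = normal a \<bullet> u e"
  proof -
    have "(\<Sum>b<5. (normal a \<bullet> normal b) * gram b e) = normal a \<bullet> (\<Sum>b<5. normal b) - (\<Sum>b<5. (normal b \<bullet> normal a) *\<^sub>R u b) \<bullet> u e"
      using assms by (simp add: gram_eq inner_sum_left inner_sum_right right_diff_distrib sum_subtractf inner_commute[of "normal a"])
    then show ?thesis by (simp add: sum_normal sum_normal_inner)
  qed
  have "(\<Sum>b<5. dual a b * gram b e) = height a * (\<Sum>b<5. height b * gram b e) - (\<Sum>b<5. (normal a \<bullet> normal b) * gram b e)"
    by (simp add: dual_def left_diff_distrib sum_subtractf sum_distrib_left mult.assoc)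
  also have "\<dots> = coord a (u e)" by (simp add: 1 2 coord_def)
  finally show ?thesis using coord_u[OF assms] by simp
qed

lemma cof_gram:
  assumes "a < 5" "e < 5"
  shows "cof gram a e = det5 gram * dual a e"
proof -
  interpret pos_off_diag gram by (rule gram_pos_off_diag)
  interpret zero_diag gram by (rule zero_diag)
  have "cof gram a e = (\<Sum>b<5. if b = e then cof gram a b else 0)" using assms by simp
  also have "\<dots> = (\<Sum>b<5. cof gram a b * (\<Sum>d<5. dual e d * gram d b))"
    using assms by (intro sum.cong refl) (simp add: dual_gram)
  also have "\<dots> = (\<Sum>b<5. \<Sum>d<5. dual e d * (cof gram a b * gram b d))"
    unfolding sum_distrib_left by (intro sum.cong refl) (simp add: gram_eq inner_commute mult_ac)
  also have "\<dots> = (\<Sum>d<5. dual e d * (\<Sum>b<5. cof gram a b * gram b d))"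
    by (subst sum.swap) (simp add: sum_distrib_left)
  also have "\<dots> = (\<Sum>d<5. if a = d then dual e d * det5 gram else 0)"
    using assms by (intro sum.cong refl) (simp add: cof_mult)
  also have "\<dots> = dual e a * det5 gram" using assms by simp
  finally show ?thesis by (simp add: dual_commute mult.commute)
qed

text \<open>The dual vectors add up to \<open>(1, 0)\<close>, whose Lorentz square is 1.\<close>

lemma sum_dual: "(\<Sum>a<5. \<Sum>b<5. dual a b) = 1"
proof -
  have "(\<Sum>a<5. \<Sum>b<5. dual a b) = (\<Sum>a<5. height a) * (\<Sum>b<5. height b) - (\<Sum>a<5. normal a) \<bullet> (\<Sum>b<5. normal b)"
    by (simp add: dual_def sum_subtractf sum_product inner_sum_left inner_sum_right)
       (subst sum.swap, simp add: inner_commute)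
  then show ?thesis by (simp add: sum_height sum_normal)
qed

text \<open>By \<open>det_edge_gram\<close> the square is the sum of all cofactors, that is,
  \<open>det5 gram\<close> times the sum of all entries of the inverse, which is 1.\<close>

lemma det_edge_matrix_squared: "(det edge_matrix)\<^sup>2 = det5 gram"
proof -
  interpret pos_off_diag gram by (rule gram_pos_off_diag)
  interpret zero_diag gram by (rule zero_diag)
  have e: "(transpose edge_matrix ** edge_matrix) $ i $ j = gram 0 (index4 i) + gram 0 (index4 j) - gram (index4 i) (index4 j)" for i j
  proof -
    have "(transpose edge_matrix ** edge_matrix) $ i $ j = (u (index4 i) - u 0) \<bullet> (u (index4 j) - u 0)"
      by (simp add: matrix_matrix_mult_def transpose_def edge_matrix_def inner_vec_def)
    moreover have "index4 i < 5" "index4 j < 5" by (simp_all add: index4_def)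
    ultimately show ?thesis by (simp add: gram_eq inner_diff_left inner_diff_right inner_commute)
  qed
  then have E: "transpose edge_matrix ** edge_matrix = (\<chi> i j. gram 0 (index4 i) + gram 0 (index4 j) - gram (index4 i) (index4 j))"
    unfolding vec_eq_iff by (intro allI) (simp only: vec_lambda_beta)
  have "(det edge_matrix)\<^sup>2 = det (transpose edge_matrix ** edge_matrix)"
    by (simp add: det_mul power2_eq_square)
  also have "\<dots> = (\<Sum>a<5. \<Sum>b<5. cof gram a b)"
    unfolding E by (rule det_edge_gram)
  also have "\<dots> = (\<Sum>a<5. \<Sum>b<5. det5 gram * dual a b)"
    by (intro sum.cong refl) (simp add: cof_gram)
  also have "\<dots> = det5 gram" by (simp add: sum_distrib_left[symmetric] sum_dual)
  finally show ?thesis .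
qed

lemma abs_det_edge_matrix: "\<bar>det edge_matrix\<bar> = sqrt (det5 gram)"
  unfolding det_edge_matrix_squared[symmetric] by simp

end

section \<open>From the hyperbolic volume to the integral over the orthant\<close>

lemma qf_measurable_comp:
  assumes "\<And>k. (\<lambda>p. w p k) \<in> borel_measurable N"
  shows "(\<lambda>p. qf g J (w p)) \<in> borel_measurable N"
  unfolding qf_def using assms by (intro borel_measurable_sum borel_measurable_times borel_measurable_const)

lemma qf_scale: "qf g J (\<lambda>k. s * w k) = s\<^sup>2 * qf g J w"
  unfolding qf_def sum_distrib_left by (intro sum.cong refl) (simp add: power2_eq_square mult_ac)

context sphere_simplex
begin

definition vertices :: "(real ^ 4) set" where
  "vertices = u ` {..<5}"

lemma card_vertices: "card vertices = 5"
  unfolding vertices_def by (simp add: card_image inj_u)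

lemma interior_hull: "interior (convex hull vertices) = {y. \<forall>k<5. coord k y > 0}"
proof -
  have "interior (convex hull vertices) = {y. \<exists>U. (\<forall>x\<in>vertices. 0 < U x) \<and> sum U vertices = 1 \<and> (\<Sum>x\<in>vertices. U x *\<^sub>R x) = y}"
    using interior_convex_hull_explicit_minimal[OF indep] card_vertices by (simp add: vertices_def)
  also have "\<dots> = {y. \<forall>k<5. coord k y > 0}"
  proof (intro set_eqI iffI; (elim CollectE)?; (rule CollectI)?)
    fix y assume "\<exists>U. (\<forall>x\<in>vertices. 0 < U x) \<and> sum U vertices = 1 \<and> (\<Sum>x\<in>vertices. U x *\<^sub>R x) = y"
    then obtain U where U: "\<And>k. k < 5 \<Longrightarrow> U (u k) > 0" "sum U vertices = 1" "(\<Sum>x\<in>vertices. U x *\<^sub>R x) = y"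
      by (auto simp: vertices_def)
    have "(\<Sum>k<5. U (u k)) = 1" "(\<Sum>k<5. U (u k) *\<^sub>R u k) = y"
      using U(2,3) unfolding vertices_def by (simp_all add: sum.reindex[OF inj_u])
    then show "\<forall>k<5. coord k y > 0" using coord_affine[of "\<lambda>k. U (u k)"] U(1) by auto
  next
    fix y assume pos: "\<forall>k<5. coord k y > 0"
    define U where "U x = coord (inv_into {..<5} u x) y" for x
    have U: "U (u k) = coord k y" if "k < 5" for k using inj_u that by (simp add: U_def)
    have "sum U vertices = 1"
      unfolding vertices_def by (subst sum.reindex[OF inj_u]) (simp add: U sum_coord)
    moreover have "(\<Sum>x\<in>vertices. U x *\<^sub>R x) = y"
      unfolding vertices_def by (subst sum.reindex[OF inj_u]) (simp add: U coord_combination)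
    moreover have "\<forall>x\<in>vertices. 0 < U x" using pos U by (auto simp: vertices_def)
    ultimately show "\<exists>U. (\<forall>x\<in>vertices. 0 < U x) \<and> sum U vertices = 1 \<and> (\<Sum>x\<in>vertices. U x *\<^sub>R x) = y" by blast
  qed
  finally show ?thesis .
qed

text \<open>The Lorentz square of \<open>(1, y)\<close>: in barycentric coordinates the volume
  density becomes a power of the quadratic form itself.\<close>

lemma one_minus_norm: "1 - (norm y)\<^sup>2 = qf gram {..<5} (\<lambda>k. coord k y)"
  unfolding qf_gram sum_coord coord_combination by simp

text \<open>All terms of the form are nonnegative, and two positive coordinates produce a positive
  off-diagonal term.\<close>

lemma norm_less_1:
  assumes nn: "\<And>k. k < 5 \<Longrightarrow> coord k y \<ge> 0" and ij: "i < 5" "j < 5" "i \<noteq> j" "coord i y > 0" "coord j y > 0"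
  shows "norm y < 1"
proof -
  interpret pos_off_diag gram by (rule gram_pos_off_diag)
  have g: "gram k l \<ge> 0" for k l using pos[of k l] diag[of k] by (cases "k = l") auto
  have t: "0 \<le> gram k l * coord k y * coord l y" if "k < 5" "l < 5" for k l
    using g nn that by (intro mult_nonneg_nonneg) auto
  have "0 < gram i j * coord i y * coord j y" using pos[OF ij(3)] ij by simp
  also have "\<dots> \<le> (\<Sum>l<5. gram i l * coord i y * coord l y)"
    using t ij by (intro member_le_sum[of j "{..<5}" "\<lambda>l. gram i l * coord i y * coord l y"]) auto
  also have "\<dots> \<le> (\<Sum>k<5. \<Sum>l<5. gram k l * coord k y * coord l y)"
    using t ij by (intro member_le_sum[of i "{..<5}" "\<lambda>k. \<Sum>l<5. gram k l * coord k y * coord l y"] sum_nonneg) auto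
  also have "\<dots> = 1 - (norm y)\<^sup>2" unfolding one_minus_norm qf_def ..
  finally have "(norm y)\<^sup>2 < 1" by simp
  then show ?thesis using abs_square_less_1[of "norm y"] by simp
qed

definition ideal_hull :: "(real ^ 4) set" where
  "ideal_hull = convex hull vertices \<inter> ball 0 1"

lemma ideal_hull_borel: "ideal_hull \<in> sets borel"
proof -
  have "closed (convex hull vertices)"
    by (intro compact_imp_closed compact_convex_hull finite_imp_compact) (simp add: vertices_def)
  then show ?thesis unfolding ideal_hull_def by (intro sets.Int borel_closed borel_open open_ball)
qed

text \<open>The two sets differ only within the frontier of a convex set, which is
  negligible.\<close>

lemma AE_ideal_hull: "AE y in lborel. y \<in> ideal_hull \<longleftrightarrow> (\<forall>k<5. coord k y > 0)"
proof -
  let ?F = "frontier (convex hull vertices)"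
  have "negligible ?F" by (intro negligible_convex_frontier convex_convex_hull)
  moreover have "?F \<in> sets borel" by (intro borel_closed frontier_closed)
  ultimately have "?F \<in> null_sets lborel"
    unfolding negligible_iff_null_sets using null_sets_completion_iff by (metis sets_lborel)
  then have "AE y in lborel. y \<notin> ?F" by (rule AE_not_in)
  then show ?thesis
  proof (eventually_elim)
    fix y assume y: "y \<notin> ?F"
    show "y \<in> ideal_hull \<longleftrightarrow> (\<forall>k<5. coord k y > 0)"
    proof
      assume "y \<in> ideal_hull"
      then have "y \<in> closure (convex hull vertices)" unfolding ideal_hull_def using closure_subset by blast
      then have "y \<in> interior (convex hull vertices)" using y unfolding frontier_def by blast
      then show "\<forall>k<5. coord k y > 0" unfolding interior_hull by simp
    next
      assume pos: "\<forall>k<5. coord k y > 0"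
      then have "y \<in> interior (convex hull vertices)" unfolding interior_hull by simp
      then have "y \<in> convex hull vertices" using interior_subset by blast
      moreover have "norm y < 1" using pos by (intro norm_less_1[of y 0 1]) (auto simp: less_imp_le)
      ultimately show "y \<in> ideal_hull" by (simp add: ideal_hull_def)
    qed
  qed
qed

text \<open>Coordinates on the cone over the simplex: \<open>t\<close> belongs to vertex 0 and the
  components of \<open>a\<close> to the other vertices.\<close>

definition cone_form :: "real \<Rightarrow> real ^ 4 \<Rightarrow> real" where
  "cone_form t a = qf gram {..<5} (\<lambda>k. if k = 0 then t else a $ of_nat k)"

definition coord_sum :: "real ^ 4 \<Rightarrow> real" where
  "coord_sum a = (\<Sum>k\<in>{1..<5}. a $ of_nat k)"

lemma coord_sum_scale: "coord_sum (s *\<^sub>R a) = s * coord_sum a"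
  by (simp add: coord_sum_def sum_distrib_left)

lemma cone_form_scale: "cone_form (s * t) (s *\<^sub>R a) = s\<^sup>2 * cone_form t a"
proof -
  have "(\<lambda>k. if k = 0 then s * t else (s *\<^sub>R a) $ of_nat k) = (\<lambda>k. s * (if k = 0 then t else a $ of_nat k))"
    by (auto simp: fun_eq_iff)
  then show ?thesis unfolding cone_form_def by (simp only: qf_scale)
qed

lemma cone_form_edge: "cone_form (1 - coord_sum b) b = 1 - (norm (u 0 + edge_matrix *v b))\<^sup>2"
  unfolding one_minus_norm coord_edge cone_form_def bary_def coord_sum_def ..

lemma bary_pos_iff: "(\<forall>k<5. bary b k > 0) \<longleftrightarrow> (\<forall>j. b $ j > 0) \<and> coord_sum b < 1"
proof -
  have "(\<forall>k<5. bary b k > 0) \<longleftrightarrow> bary b 0 > 0 \<and> (\<forall>j. bary b (index4 j) > 0)"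
    unfolding all_less_5 forall_4 index4_simps by blast
  moreover have "bary b (index4 j) = b $ j" for j
  proof -
    have "index4 j \<noteq> 0" by (simp add: index4_def)
    then show ?thesis unfolding bary_def by simp
  qed
  moreover have "bary b 0 = 1 - coord_sum b" by (simp add: bary_def coord_sum_def)
  ultimately show ?thesis by auto
qed

text \<open>Here \<open>s\<close> is the sum of all five cone coordinates. For fixed
  \<open>s\<close> the scaling \<open>a = s *\<^sub>R b\<close> produces the factor
  \<open>s ^ 4\<close>; after exchanging the integrals, the shift \<open>t = s - coord_sum a\<close>
  for fixed \<open>a\<close> has Jacobian 1.\<close>

lemma nn_integral_simplex_eq_orthant:
  "(\<integral>\<^sup>+b. (\<integral>\<^sup>+s. ennreal (s ^ 4 * exp (- cone_form (1 - coord_sum b) b * s\<^sup>2)) * indicator {b. (\<forall>j. b $ j > 0) \<and> coord_sum b < 1} b * indicator {0<..} s \<partial>lborel) \<partial>lborel) =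
   (\<integral>\<^sup>+a. (\<integral>\<^sup>+t. ennreal (exp (- cone_form t a)) * indicator {0<..} t \<partial>lborel) * indicator {a. \<forall>j. a $ j > 0} a \<partial>lborel)"
proof -
  have nth: "(\<lambda>a::real^4. a $ j) \<in> borel_measurable borel" for j by measurable
  have cs [measurable]: "coord_sum \<in> borel_measurable borel"
    unfolding coord_sum_def[abs_def] by (intro borel_measurable_sum nth)
  have pos_eq: "{a :: real^4. \<forall>j. a $ j > 0} = {x. x $ 1 > 0} \<inter> {x. x $ 2 > 0} \<inter> {x. x $ 3 > 0} \<inter> {x. x $ 4 > 0}"
    by (auto simp: forall_4)
  have pos [measurable]: "{a :: real^4. \<forall>j. a $ j > 0} \<in> sets borel"
    unfolding pos_eq by (intro sets.Int borel_open open_halfspace_component_gt_cart)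
  have D [measurable]: "{b :: real^4. (\<forall>j. b $ j > 0) \<and> coord_sum b < 1} \<in> sets borel"
  proof -
    have "{b \<in> space borel. coord_sum b < 1} \<in> sets borel" by measurable
    moreover have "{b :: real^4. (\<forall>j. b $ j > 0) \<and> coord_sum b < 1} = {a. \<forall>j. a $ j > 0} \<inter> {b \<in> space borel. coord_sum b < 1}"
      by auto
    ultimately show ?thesis using sets.Int[OF pos] by (simp only:)
  qed
  have cf: "(\<lambda>p. cone_form (f p) (h p)) \<in> borel_measurable N" if "f \<in> borel_measurable N" "h \<in> borel_measurable N"
    for N :: "'z measure" and f h
    unfolding cone_form_def
  proof (rule qf_measurable_comp)
    fix k :: nat
    show "(\<lambda>p. if k = 0 then f p else h p $ of_nat k) \<in> borel_measurable N"
    proof (cases "k = 0")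
      case True
      then show ?thesis by (simp only: simp_thms if_True that(1))
    next
      case False
      then show ?thesis by (simp only: if_False measurable_compose[OF that(2) nth])
    qed
  qed
  define G where "G b s = ennreal (s ^ 4 * exp (- cone_form (1 - coord_sum b) b * s\<^sup>2)) * indicator {b. (\<forall>j. b $ j > 0) \<and> coord_sum b < 1} b * indicator {0<..} s" for b s
  define F where "F s a = ennreal (exp (- cone_form (s - coord_sum a) a)) * indicator {a. \<forall>j. a $ j > 0} a * indicator {..<s} (coord_sum a) * indicator {0<..} s" for s a
  have lb: "measurable (lborel \<Otimes>\<^sub>M lborel) borel = measurable (borel \<Otimes>\<^sub>M borel) (borel :: ennreal measure)"
    by (intro measurable_cong_sets sets_pair_measure_cong sets_lborel refl)
  note borel_rules = measurable_compose[OF _ measurable_ennreal] borel_measurable_times borel_measurable_power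
    measurable_compose[OF _ borel_measurable_exp] borel_measurable_uminus borel_measurable_times_ennreal
  have m1: "(\<lambda>(b, s). G b s) \<in> borel_measurable (lborel \<Otimes>\<^sub>M lborel)"
    unfolding lb case_prod_beta' G_def
    by (intro borel_rules measurable_fst measurable_snd
        cf[OF borel_measurable_diff[OF borel_measurable_const measurable_compose[OF measurable_fst cs]] measurable_fst]
        measurable_compose[OF measurable_fst borel_measurable_indicator[OF D]]
        measurable_compose[OF measurable_snd borel_measurable_indicator[OF borel_open[OF open_greaterThan]]])
  have m2: "(\<lambda>(s, a). F s a) \<in> borel_measurable (lborel \<Otimes>\<^sub>M lborel)"
  proof -
    have diff: "(\<lambda>p :: real \<times> (real^4). fst p - coord_sum (snd p)) \<in> borel_measurable (borel \<Otimes>\<^sub>M borel)"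
      by (rule borel_measurable_diff[OF measurable_fst measurable_compose[OF measurable_snd cs]])
    have ind: "(\<lambda>p :: real \<times> (real^4). indicator {..<fst p} (coord_sum (snd p)) :: ennreal) = (\<lambda>p. indicator {0<..} (fst p - coord_sum (snd p)))"
      by (auto simp: fun_eq_iff indicator_def)
    have indm: "(\<lambda>p :: real \<times> (real^4). indicator {..<fst p} (coord_sum (snd p)) :: ennreal) \<in> borel_measurable (borel \<Otimes>\<^sub>M borel)"
      unfolding ind by (rule measurable_compose[OF diff borel_measurable_indicator[OF borel_open[OF open_greaterThan]]])
    show ?thesis
      unfolding lb case_prod_beta' F_def
      by (intro borel_rules measurable_fst measurable_snd cf[OF diff measurable_snd]
        measurable_compose[OF measurable_snd borel_measurable_indicator[OF pos]]
        indm
        measurable_compose[OF measurable_fst borel_measurable_indicator[OF borel_open[OF open_greaterThan]]])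
  qed
  have scale: "(\<integral>\<^sup>+b. G b s \<partial>lborel) = (\<integral>\<^sup>+a. F s a \<partial>lborel)" for s
  proof (cases "s > 0")
    case True
    have Fs: "F s \<in> borel_measurable borel"
    proof -
      have "(\<lambda>a. case (s, a) of (s, a) \<Rightarrow> F s a) \<in> borel_measurable lborel"
        by (rule measurable_Pair2[OF m2]) (simp only: space_lborel space_borel UNIV_I)
      then show ?thesis unfolding prod.case measurable_cong_sets[OF sets_lborel refl] .
    qed
    have "(\<integral>\<^sup>+a. F s a \<partial>lborel) = ennreal (s ^ CARD(4)) * (\<integral>\<^sup>+b. F s (s *\<^sub>R b) \<partial>lborel)"
      by (rule nn_integral_lborel_scale[OF Fs True])
    also have "\<dots> = (\<integral>\<^sup>+b. ennreal (s ^ 4) * F s (s *\<^sub>R b) \<partial>lborel)"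
      by (subst nn_integral_cmult) (auto intro!: measurable_compose[OF _ Fs])
    also have "\<dots> = (\<integral>\<^sup>+b. G b s \<partial>lborel)"
    proof (rule nn_integral_cong)
      fix b :: "real^4"
      have "s - coord_sum (s *\<^sub>R b) = s * (1 - coord_sum b)" by (simp add: coord_sum_scale algebra_simps)
      then have cfs: "cone_form (s - coord_sum (s *\<^sub>R b)) (s *\<^sub>R b) = cone_form (1 - coord_sum b) b * s\<^sup>2"
        by (simp add: cone_form_scale)
      have p: "(\<forall>j. (s *\<^sub>R b) $ j > 0) \<longleftrightarrow> (\<forall>j. b $ j > 0)" using True by (simp add: zero_less_mult_iff)
      have q: "coord_sum (s *\<^sub>R b) < s \<longleftrightarrow> coord_sum b < 1" using True by (simp add: coord_sum_scale)
      have i: "indicator {a. \<forall>j. a $ j > 0} (s *\<^sub>R b) * indicator {..<s} (coord_sum (s *\<^sub>R b)) =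
          (indicator {b. (\<forall>j. b $ j > 0) \<and> coord_sum b < 1} b :: ennreal)"
        using p q by (simp add: indicator_def)
      have "ennreal (s ^ 4) * F s (s *\<^sub>R b) = ennreal (s ^ 4) * ennreal (exp (- (cone_form (1 - coord_sum b) b * s\<^sup>2))) *
         (indicator {a. \<forall>j. a $ j > 0} (s *\<^sub>R b) * indicator {..<s} (coord_sum (s *\<^sub>R b))) * indicator {0<..} s"
        unfolding F_def cfs by (simp only: mult.assoc)
      also have "\<dots> = G b s"
      proof -
        have "ennreal (s ^ 4) * ennreal (exp (- (cone_form (1 - coord_sum b) b * s\<^sup>2))) = ennreal (s ^ 4 * exp (- cone_form (1 - coord_sum b) b * s\<^sup>2))"
          using ennreal_mult'[of "s ^ 4" "exp (- cone_form (1 - coord_sum b) b * s\<^sup>2)"] True by simp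
        then show ?thesis unfolding i G_def by (simp only:)
      qed
      finally show "ennreal (s ^ 4) * F s (s *\<^sub>R b) = G b s" .
    qed
    finally show ?thesis by simp
  qed (simp add: G_def F_def)
  have shift: "(\<integral>\<^sup>+s. F s a \<partial>lborel) = (\<integral>\<^sup>+t. ennreal (exp (- cone_form t a)) * indicator {0<..} t \<partial>lborel) * indicator {a. \<forall>j. a $ j > 0} a" for a
  proof (cases "\<forall>j. a $ j > 0")
    case True
    then have cs0: "coord_sum a > 0" unfolding coord_sum_def by (intro sum_pos) auto
    have Fa: "(\<lambda>s. F s a) \<in> borel_measurable borel"
    proof -
      have "(\<lambda>s. case (s, a) of (s, a) \<Rightarrow> F s a) \<in> borel_measurable lborel"
        by (rule measurable_Pair1[OF m2]) (simp only: space_lborel space_borel UNIV_I)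
      then show ?thesis unfolding prod.case measurable_cong_sets[OF sets_lborel refl] .
    qed
    have "(\<integral>\<^sup>+s. F s a \<partial>lborel) = ennreal \<bar>1\<bar> * (\<integral>\<^sup>+t. F (coord_sum a + 1 * t) a \<partial>lborel)"
      using nn_integral_real_affine[OF Fa, of 1 "coord_sum a"] by (simp only: one_neq_zero simp_thms)
    also have "\<dots> = (\<integral>\<^sup>+t. F (coord_sum a + t) a \<partial>lborel)"
      by (simp only: abs_one ennreal_1 mult_1)
    also have "\<dots> = (\<integral>\<^sup>+t. ennreal (exp (- cone_form t a)) * indicator {0<..} t \<partial>lborel)"
      by (rule nn_integral_cong) (use True cs0 in \<open>simp add: F_def indicator_def\<close>)
    finally show ?thesis using True by (simp only: indicator_simps mem_Collect_eq mult_1_right simp_thms)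
  qed (simp add: F_def)
  have "(\<integral>\<^sup>+b. (\<integral>\<^sup>+s. G b s \<partial>lborel) \<partial>lborel) = (\<integral>\<^sup>+s. (\<integral>\<^sup>+b. G b s \<partial>lborel) \<partial>lborel)"
    using lborel_pair.Fubini'[OF m1] by simp
  also have "\<dots> = (\<integral>\<^sup>+s. (\<integral>\<^sup>+a. F s a \<partial>lborel) \<partial>lborel)" by (simp only: scale)
  also have "\<dots> = (\<integral>\<^sup>+a. (\<integral>\<^sup>+s. F s a \<partial>lborel) \<partial>lborel)"
    using lborel_pair.Fubini'[OF m2] by simp
  finally show ?thesis unfolding shift G_def .
qed

lemma nn_integral_orthant_eq_mom0:
  "(\<integral>\<^sup>+a. (\<integral>\<^sup>+t. ennreal (exp (- cone_form t a)) * indicator {0<..} t \<partial>lborel) * indicator {a. \<forall>j. a $ j > 0} a \<partial>lborel) =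
   ennreal (mom0 gram {..<5})"
proof -
  interpret pos_off_diag gram by (rule gram_pos_off_diag)
  let ?R = "restrict_space lborel {x :: real^4. \<forall>i. x $ i > 0}"
  let ?T = "\<lambda>x :: real^4. \<lambda>k\<in>{1..<5::nat}. x $ of_nat k"
  have m0: "(\<lambda>a. ennreal (exp (- qf gram J a))) \<in> borel_measurable (orthant J)" for J
    using measurable_compose[OF exp_qf_measurable measurable_ennreal] .
  have nth: "(\<lambda>a::real^4. a $ j) \<in> borel_measurable borel" for j by measurable
  have pos_eq: "{a :: real^4. \<forall>j. a $ j > 0} = {x. x $ 1 > 0} \<inter> {x. x $ 2 > 0} \<inter> {x. x $ 3 > 0} \<inter> {x. x $ 4 > 0}"
    by (auto simp: forall_4)
  have pos: "{a :: real^4. \<forall>j. a $ j > 0} \<in> sets borel"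
    unfolding pos_eq by (intro sets.Int borel_open open_halfspace_component_gt_cart)
  have T: "?T \<in> measurable ?R (orthant {1..<5})"
  proof (rule measurable_restrict)
    show "(\<lambda>x. x $ of_nat k) \<in> measurable ?R hl" for k
      unfolding hl_def by (rule measurable_restrict_space3) (auto simp: nth)
  qed
  define H where "H x = (\<integral>\<^sup>+t. ennreal (exp (- qf gram {..<5} (x(0:=t)))) \<partial>hl)" for x :: "nat \<Rightarrow> real"
  have H: "H \<in> borel_measurable (orthant {1..<5})"
  proof -
    have "(\<lambda>(a, z). a(0 := z)) \<in> measurable (orthant {1..<5} \<Otimes>\<^sub>M hl) (PiM (insert (0::nat) {1..<5}) (\<lambda>_. hl))"
      by (rule measurable_add_dim)
    from measurable_compose[OF this m0[of "insert 0 {1..<5}"]]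
    have "(\<lambda>(a, z). ennreal (exp (- qf gram {..<5} (a(0:=z))))) \<in> borel_measurable (orthant {1..<5} \<Otimes>\<^sub>M hl)"
      unfolding case_prod_beta' lessThan_5_insert .
    then show ?thesis unfolding H_def[abs_def]
      by (rule sigma_finite_measure.borel_measurable_nn_integral[OF sigma_finite_hl])
  qed
  have HT: "H (?T a) = (\<integral>\<^sup>+t. ennreal (exp (- cone_form t a)) * indicator {0<..} t \<partial>lborel)" for a
  proof -
    have "H (?T a) = (\<integral>\<^sup>+t. ennreal (exp (- cone_form t a)) \<partial>hl)"
      unfolding H_def
    proof (rule nn_integral_cong)
      fix t
      have "qf gram {..<5} ((?T a)(0:=t)) = cone_form t a"
        unfolding qf_def cone_form_def by (intro sum.cong refl) auto
      then show "ennreal (exp (- qf gram {..<5} ((?T a)(0:=t)))) = ennreal (exp (- cone_form t a))" by (simp only:)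
    qed
    also have "\<dots> = (\<integral>\<^sup>+t. ennreal (exp (- cone_form t a)) * indicator {0<..} t \<partial>lborel)"
    proof (rule nn_integral_hl)
      have "(\<lambda>t. cone_form t a) \<in> borel_measurable borel"
        unfolding cone_form_def
      proof (rule qf_measurable_comp)
        show "(\<lambda>t. if k = 0 then t else a $ of_nat k) \<in> borel_measurable borel" for k :: nat
          by (cases "k = 0") simp_all
      qed
      then show "(\<lambda>t. ennreal (exp (- cone_form t a))) \<in> borel_measurable borel" by measurable
    qed
    finally show ?thesis .
  qed
  have "(\<integral>\<^sup>+a. H (?T a) * indicator {a. \<forall>j. a $ j > 0} a \<partial>lborel) = (\<integral>\<^sup>+a. H (?T a) \<partial>?R)"
    by (rule nn_integral_restrict_space[symmetric]) (simp add: pos)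
  also have "\<dots> = (\<integral>\<^sup>+x. H x \<partial>distr ?R (orthant {1..<5}) ?T)"
  proof (rule nn_integral_distr[OF T, symmetric])
    show "H \<in> borel_measurable (distr ?R (orthant {1..<5}) ?T)"
      unfolding measurable_distr_eq1 by (rule H)
  qed
  also have "\<dots> = (\<integral>\<^sup>+x. H x \<partial>orthant {1..<5})"
    unfolding PiM_hl_eq_distr[symmetric] ..
  also have "\<dots> = (\<integral>\<^sup>+a. ennreal (exp (- qf gram {..<5} a)) \<partial>orthant {..<5})"
    unfolding H_def lessThan_5_insert
    by (rule hlP.product_nn_integral_insert[OF _ _ m0, symmetric]) auto
  also have "\<dots> = ennreal (\<integral>a. exp (- qf gram {..<5} a) \<partial>orthant {..<5})"
    by (rule nn_integral_eq_integral[OF integrable_mom0]) auto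
  finally show ?thesis unfolding HT mom0_def .
qed

text \<open>The constant is the integral of \<open>s ^ 4 * exp (- s\<^sup>2)\<close> over the half-line.\<close>

lemma hyp_volume:
  "ennreal (3 * sqrt pi / 8) * emeasure hyp_measure ideal_hull = ennreal (sqrt (det5 gram) * mom0 gram {..<5})"
proof -
  let ?h = "\<lambda>x::real^4. ennreal (1 / sqrt (1 - (norm x)\<^sup>2) ^ 5)"
  let ?D = "{y. \<forall>k<5. coord k y > 0}"
  let ?S = "{b. (\<forall>j. b $ j > 0) \<and> coord_sum b < 1}"
  have h: "?h \<in> borel_measurable borel" by measurable
  have D: "?D \<in> sets borel" unfolding interior_hull[symmetric] by (intro borel_open open_interior)
  have hD: "(\<lambda>x. ?h x * indicator ?D x) \<in> borel_measurable borel"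
    by (rule borel_measurable_times_ennreal[OF h borel_measurable_indicator[OF D]])
  have "emeasure hyp_measure ideal_hull = (\<integral>\<^sup>+x. ?h x * indicator ideal_hull x \<partial>lborel)"
    by (rule emeasure_hyp_measure[OF ideal_hull_borel]) (simp add: ideal_hull_def)
  also have "\<dots> = (\<integral>\<^sup>+x. ?h x * indicator ?D x \<partial>lborel)"
    by (rule nn_integral_cong_AE, rule eventually_mono[OF AE_ideal_hull]) (simp add: indicator_def)
  also have "\<dots> = ennreal \<bar>det edge_matrix\<bar> * (\<integral>\<^sup>+b. ?h (u 0 + edge_matrix *v b) * indicator ?D (u 0 + edge_matrix *v b) \<partial>lborel)"
    by (rule nn_integral_lborel_linear[OF hD det_edge_matrix_nonzero])
  finally have 1: "ennreal (3 * sqrt pi / 8) * emeasure hyp_measure ideal_hull =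
     ennreal \<bar>det edge_matrix\<bar> * (ennreal (3 * sqrt pi / 8) * (\<integral>\<^sup>+b. ?h (u 0 + edge_matrix *v b) * indicator ?D (u 0 + edge_matrix *v b) \<partial>lborel))"
    by (simp only: mult.left_commute)
  have T: "(\<lambda>b. u 0 + edge_matrix *v b) \<in> borel_measurable borel"
    by (intro borel_measurable_continuous_onI continuous_intros)
  have "ennreal (3 * sqrt pi / 8) * (\<integral>\<^sup>+b. ?h (u 0 + edge_matrix *v b) * indicator ?D (u 0 + edge_matrix *v b) \<partial>lborel) =
     (\<integral>\<^sup>+b. ennreal (3 * sqrt pi / 8) * (?h (u 0 + edge_matrix *v b) * indicator ?D (u 0 + edge_matrix *v b)) \<partial>lborel)"
  proof (rule nn_integral_cmult[symmetric])
    show "(\<lambda>b. ?h (u 0 + edge_matrix *v b) * indicator ?D (u 0 + edge_matrix *v b)) \<in> borel_measurable lborel"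
      unfolding measurable_cong_sets[OF sets_lborel refl] by (rule measurable_compose[OF T hD])
  qed
  \<comment> \<open>With \<open>c = 1 - (norm y)\<^sup>2\<close> the density
    \<open>1 / sqrt c ^ 5\<close> is, up to the constant, the radial integral of
    \<open>s ^ 4 * exp (- c * s\<^sup>2)\<close>, and \<open>cone_form_edge\<close> identifies
    \<open>c\<close> with the cone form.\<close>
  also have "\<dots> = (\<integral>\<^sup>+b. (\<integral>\<^sup>+s. ennreal (s ^ 4 * exp (- cone_form (1 - coord_sum b) b * s\<^sup>2)) * indicator ?S b * indicator {0<..} s \<partial>lborel) \<partial>lborel)"
  proof (rule nn_integral_cong)
    fix b :: "real^4"
    have iff: "(u 0 + edge_matrix *v b \<in> ?D) \<longleftrightarrow> b \<in> ?S"
      using bary_pos_iff[of b] by (simp add: coord_edge)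
    show "ennreal (3 * sqrt pi / 8) * (?h (u 0 + edge_matrix *v b) * indicator ?D (u 0 + edge_matrix *v b)) =
      (\<integral>\<^sup>+s. ennreal (s ^ 4 * exp (- cone_form (1 - coord_sum b) b * s\<^sup>2)) * indicator ?S b * indicator {0<..} s \<partial>lborel)"
    proof (cases "b \<in> ?S")
      case True
      define c where "c = cone_form (1 - coord_sum b) b"
      have "norm (u 0 + edge_matrix *v b) < 1"
        using iff True by (intro norm_less_1[of _ 0 1]) (auto simp: less_imp_le)
      then have c: "c > 0" unfolding c_def cone_form_edge using abs_square_less_1[of "norm (u 0 + edge_matrix *v b)"] by simp
      have "(\<integral>\<^sup>+s. ennreal (s ^ 4 * exp (- c * s\<^sup>2)) * indicator ?S b * indicator {0<..} s \<partial>lborel) =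
        (\<integral>\<^sup>+s. ennreal (s ^ (2 * 2) * exp (- c * s\<^sup>2)) * indicator {0<..} s \<partial>lborel)"
        using True by (intro nn_integral_cong) simp
      also have "\<dots> = (\<integral>\<^sup>+s. ennreal (s ^ (2 * 2) * exp (- c * s\<^sup>2)) \<partial>hl)"
        by (rule nn_integral_hl[symmetric]) measurable
      also have "\<dots> = ennreal (sqrt pi / 2 * (fact (2 * 2) / (2 ^ (2 * 2) * fact 2)) / sqrt c ^ (2 * 2 + 1))"
        by (rule nn_integral_hl_gaussian_moment[OF c])
      also have "sqrt pi / 2 * (fact (2 * 2) / (2 ^ (2 * 2) * fact 2)) / sqrt c ^ (2 * 2 + 1) = 3 * sqrt pi / 8 * (1 / sqrt c ^ 5)"
        by (simp add: fact_numeral)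
      also have "ennreal (3 * sqrt pi / 8 * (1 / sqrt c ^ 5)) = ennreal (3 * sqrt pi / 8) * ennreal (1 / sqrt c ^ 5)"
        by (rule ennreal_mult') simp
      finally have "(\<integral>\<^sup>+s. ennreal (s ^ 4 * exp (- c * s\<^sup>2)) * indicator ?S b * indicator {0<..} s \<partial>lborel) =
        ennreal (3 * sqrt pi / 8) * ennreal (1 / sqrt c ^ 5)" .
      moreover have "indicator ?D (u 0 + edge_matrix *v b) = (1 :: ennreal)" using True iff by (simp only: indicator_simps)
      ultimately show ?thesis by (simp only: c_def cone_form_edge mult_1_right)
    qed (use iff in simp)
  qed
  also have "\<dots> = ennreal (mom0 gram {..<5})"
    unfolding nn_integral_simplex_eq_orthant by (rule nn_integral_orthant_eq_mom0)
  finally show ?thesis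
    unfolding 1 using ennreal_mult'[of "\<bar>det edge_matrix\<bar>" "mom0 gram {..<5}"]
    by (simp only: abs_det_edge_matrix[symmetric] abs_ge_zero)
qed


section \<open>Faces of the ideal simplex\<close>

definition face :: "nat set \<Rightarrow> (real ^ 4) set" where
  "face K = {y. norm y < 1 \<and> (\<forall>k<5. coord k y \<ge> 0) \<and> (\<forall>k<5. k \<notin> K \<longrightarrow> coord k y = 0)}"

lemma hull_coord:
  assumes K: "K \<subseteq> {..<5}"
  shows "convex hull (u ` K) = {y. (\<forall>k<5. coord k y \<ge> 0) \<and> (\<forall>k<5. k \<notin> K \<longrightarrow> coord k y = 0)}"
    (is "_ = ?R")
proof
  have "convex ?R"
  proof (rule convexI)
    fix x y and a b :: real
    assume x: "x \<in> ?R" and y: "y \<in> ?R" and ab: "0 \<le> a" "0 \<le> b" "a + b = 1"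
    have "coord k (a *\<^sub>R x + b *\<^sub>R y) = (a + b) * height k - a * (normal k \<bullet> x) - b * (normal k \<bullet> y)" for k
      using ab by (simp add: coord_def inner_add_right)
    then have "coord k (a *\<^sub>R x + b *\<^sub>R y) = a * coord k x + b * coord k y" for k
      by (simp add: coord_def algebra_simps)
    then show "a *\<^sub>R x + b *\<^sub>R y \<in> ?R" using x y ab by auto
  qed
  moreover have "u ` K \<subseteq> ?R" using K by (auto simp: coord_u)
  ultimately show "convex hull (u ` K) \<subseteq> ?R" by (rule hull_minimal[rotated])
  show "?R \<subseteq> convex hull (u ` K)"
  proof
    fix y assume y: "y \<in> ?R"
    have fin: "finite K" using K finite_subset by blast
    have s: "(\<Sum>k\<in>K. coord k y) = (\<Sum>k<5. coord k y)"
      using K y by (intro sum.mono_neutral_left) auto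
    have v: "(\<Sum>k\<in>K. coord k y *\<^sub>R u k) = (\<Sum>k<5. coord k y *\<^sub>R u k)"
      using K y by (intro sum.mono_neutral_left) auto
    have "(\<Sum>k\<in>K. coord k y *\<^sub>R u k) \<in> convex hull (u ` K)"
    proof (rule convex_sum[OF fin convex_convex_hull])
      show "(\<Sum>k\<in>K. coord k y) = 1" unfolding s by (rule sum_coord)
      show "0 \<le> coord k y" if "k \<in> K" for k using y K that by auto
      show "u k \<in> convex hull (u ` K)" if "k \<in> K" for k using that by (intro hull_inc) simp
    qed
    then show "y \<in> convex hull (u ` K)" unfolding v coord_combination .
  qed
qed

lemma face_eq: "K \<subseteq> {..<5} \<Longrightarrow> face K = convex hull (u ` K) \<inter> ball 0 1"
  by (auto simp: face_def hull_coord)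

lemma face_full: "face {..<5} = ideal_hull"
  unfolding ideal_hull_def vertices_def by (rule face_eq) simp

text \<open>A point whose positive barycentric coordinates are exactly those in \<open>K\<close>; it
  separates faces with different index sets.\<close>

definition face_center :: "nat set \<Rightarrow> real ^ 4" where
  "face_center K = (\<Sum>k<5. (if k \<in> K then 1 / real (card K) else 0) *\<^sub>R u k)"

lemma coord_face_center:
  assumes K: "K \<subseteq> {..<5}" "K \<noteq> {}" and l: "l < 5"
  shows "coord l (face_center K) = (if l \<in> K then 1 / real (card K) else 0)"
proof -
  have fin: "finite K" using K(1) finite_subset by blast
  have "(\<Sum>k<5. if k \<in> K then 1 / real (card K) else 0) = (\<Sum>k\<in>K. 1 / real (card K))"
    using K by (intro sum.mono_neutral_cong_right) auto
  also have "\<dots> = 1" using K fin by simp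
  finally show ?thesis unfolding face_center_def by (rule coord_affine[OF _ l])
qed

lemma face_center_in_face:
  assumes K: "K \<subseteq> {..<5}" "card K \<ge> 2"
  shows "face_center K \<in> face K"
proof -
  have ne: "K \<noteq> {}" using K(2) by auto
  note c = coord_face_center[OF K(1) ne]
  obtain i j where ij: "i \<in> K" "j \<in> K" "i \<noteq> j"
    using K(2) by (metis card_2_iff' card_le_Suc0_iff_eq card.infinite not_less_eq_eq numeral_2_eq_2 zero_le)
  have p: "1 / real (card K) > 0" using K(2) by simp
  have "norm (face_center K) < 1"
    by (rule norm_less_1[of _ i j]) (use ij K(1) p c in auto)
  then show ?thesis unfolding face_def using c p by auto
qed

text \<open>A single vertex lies on the sphere and is cut off by the open ball, so the index sets of
  nonempty faces have at least two elements.\<close>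

lemma face_empty:
  assumes K: "K \<subseteq> {..<5}" "card K < 2"
  shows "face K = {}"
proof (rule ccontr)
  assume "face K \<noteq> {}"
  then obtain y where y: "y \<in> convex hull (u ` K)" "norm y < 1" using face_eq[OF K(1)] by auto
  have "finite K" using K(1) finite_subset by blast
  then consider "K = {}" | k where "K = {k}"
    using K(2) by (metis One_nat_def card_0_eq card_1_singletonE less_2_cases)
  then show False
  proof cases
    case 2
    then have "y = u k" "k < 5" using y K(1) by auto
    then show False using y(2) norm_u by simp
  qed (use y in simp)
qed

lemma face_mono_iff:
  assumes "K \<subseteq> {..<5}" "L \<subseteq> {..<5}" "card K \<ge> 2"
  shows "face K \<subseteq> face L \<longleftrightarrow> K \<subseteq> L"
proof
  assume "face K \<subseteq> face L"
  then have c: "face_center K \<in> face L" using face_center_in_face[OF assms(1,3)] by blast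
  show "K \<subseteq> L"
  proof
    fix k assume k: "k \<in> K"
    then have "k < 5" "K \<noteq> {}" using assms(1) by auto
    then have "coord k (face_center K) \<noteq> 0" using coord_face_center[OF assms(1) \<open>K \<noteq> {}\<close>, of k] k assms(3) by simp
    then show "k \<in> L" using c \<open>k < 5\<close> unfolding face_def by blast
  qed
qed (auto simp: face_def)

lemma aff_dim_face:
  assumes "K \<subseteq> {..<5}" "card K \<ge> 2"
  shows "aff_dim (face K) = int (card K) - 1"
proof -
  have "u ` K \<subseteq> u ` {..<5}" using assms(1) by auto
  then have ind: "\<not> affine_dependent (u ` K)" using indep affine_dependent_subset by blast
  have "face K \<noteq> {}" using face_center_in_face[OF assms] by auto
  then have "aff_dim (face K) = aff_dim (convex hull (u ` K))"
    unfolding face_eq[OF assms(1)] by (intro aff_dim_convex_Int_open) auto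
  also have "\<dots> = aff_dim (u ` K)" by (rule aff_dim_convex_hull)
  also have "\<dots> = int (card (u ` K)) - 1" using aff_dim_affine_independent[OF ind] by simp
  also have "card (u ` K) = card K" using inj_u assms(1) by (intro card_image) (rule inj_on_subset)
  finally show ?thesis .
qed

lemma face_of_ideal_hull:
  assumes "K \<subseteq> {..<5}"
  shows "face K face_of ideal_hull"
proof -
  have "convex hull (u ` K) face_of convex hull vertices"
    unfolding vertices_def face_of_convex_hull_affine_independent[OF indep] using assms by blast
  then show ?thesis unfolding face_eq[OF assms] ideal_hull_def by (rule face_of_slice) simp
qed

text \<open>Let \<open>K\<close> be the support of the barycentric coordinates of a point
  \<open>x\<close> in the relative interior of \<open>Y\<close>. Then \<open>x\<close> is also in
  the relative interior of \<open>face K\<close>, and two faces sharing a relative interior point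
  contain each other.\<close>

lemma face_of_ideal_hullD:
  assumes Y: "Y face_of ideal_hull" "Y \<noteq> {}"
  obtains K where "K \<subseteq> {..<5}" "card K \<ge> 2" "Y = face K"
proof -
  have cY: "convex Y" using Y(1) by (rule face_of_imp_convex)
  then obtain x where x: "x \<in> rel_interior Y" using Y(2) rel_interior_eq_empty by blast
  then have xY: "x \<in> Y" using rel_interior_subset by blast
  then have xM: "x \<in> face {..<5}" unfolding face_full using face_of_imp_subset[OF Y(1)] by blast
  define K where "K = {k. k < 5 \<and> coord k x > 0}"
  have K: "K \<subseteq> {..<5}" by (auto simp: K_def)
  have ind: "\<not> affine_dependent (u ` K)" using indep affine_dependent_subset K by (metis image_mono)
  have xK: "x \<in> face K" using xM unfolding face_def K_def by force
  have xri: "x \<in> rel_interior (convex hull (u ` K))"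
  proof -
    have injK: "inj_on u K" using inj_u K by (rule inj_on_subset)
    define U where "U v = coord (inv_into K u v) x" for v
    have U: "U (u k) = coord k x" if "k \<in> K" for k using injK that by (simp add: U_def)
    have "sum U (u ` K) = (\<Sum>k\<in>K. coord k x)" by (subst sum.reindex[OF injK]) (simp add: U)
    also have "\<dots> = (\<Sum>k<5. coord k x)" using K xK by (intro sum.mono_neutral_left) (auto simp: face_def)
    finally have "sum U (u ` K) = 1" by (simp add: sum_coord)
    moreover have "(\<Sum>v\<in>u ` K. U v *\<^sub>R v) = (\<Sum>k\<in>K. coord k x *\<^sub>R u k)" by (subst sum.reindex[OF injK]) (simp add: U)
    then have "(\<Sum>v\<in>u ` K. U v *\<^sub>R v) = (\<Sum>k<5. coord k x *\<^sub>R u k)"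
      using sum.mono_neutral_left[of "{..<5}" K "\<lambda>k. coord k x *\<^sub>R u k"] K xK by (auto simp: face_def)
    then have "(\<Sum>v\<in>u ` K. U v *\<^sub>R v) = x" by (simp add: coord_combination)
    moreover have "\<forall>v\<in>u ` K. 0 < U v" using U by (auto simp: K_def)
    ultimately show ?thesis unfolding rel_interior_convex_hull_explicit[OF ind] by blast
  qed
  have xb: "x \<in> ball 0 1" using xK by (simp add: face_def)
  have "rel_interior (convex hull (u ` K) \<inter> ball 0 1) = rel_interior (convex hull (u ` K)) \<inter> rel_interior (ball 0 1)"
    using xri xb by (intro convex_rel_interior_inter_two) (auto simp: rel_interior_open)
  then have xriK: "x \<in> rel_interior (face K)"
    unfolding face_eq[OF K] using xri xb by (simp add: rel_interior_open)
  have "Y \<subseteq> face K"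
    by (rule subset_of_face_of[OF face_of_ideal_hull[OF K] face_of_imp_subset[OF Y(1)]]) (use x xK in blast)
  moreover have "face K \<subseteq> Y"
    by (rule subset_of_face_of[OF Y(1) face_of_imp_subset[OF face_of_ideal_hull[OF K]]]) (use xriK xY in blast)
  ultimately have "Y = face K" by blast
  moreover have "card K \<ge> 2" using face_empty[OF K] xK by fastforce
  ultimately show ?thesis using that K by blast
qed

lemma aff_dim_ideal_hull: "aff_dim ideal_hull = 4"
  unfolding face_full[symmetric] by (subst aff_dim_face) auto

lemma facet_of_ideal_hull_iff: "F facet_of ideal_hull \<longleftrightarrow> (\<exists>j<5. F = face ({..<5} - {j}))"
proof
  assume F: "F facet_of ideal_hull"
  then obtain K where K: "K \<subseteq> {..<5}" "card K \<ge> 2" "F = face K"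
    using face_of_ideal_hullD unfolding facet_of_def by metis
  have "card K = 4" using F aff_dim_face[OF K(1,2)] unfolding facet_of_def aff_dim_ideal_hull K(3) by simp
  then have "card ({..<5} - K) = 1" using K(1) by (subst card_Diff_subset) (auto intro: finite_subset)
  then obtain j where "{..<5} - K = {j}" by (metis card_1_singletonE)
  then have "K = {..<5} - {j}" "j < 5" using K(1) by auto
  then show "\<exists>j<5. F = face ({..<5} - {j})" using K(3) by blast
next
  assume "\<exists>j<5. F = face ({..<5} - {j})"
  then obtain j where j: "j < 5" "F = face ({..<5} - {j})" by blast
  have c: "{..<5} - {j} \<subseteq> {..<5}" "card ({..<5} - {j}) = 4" using j by auto
  then have "F \<noteq> {}" using face_center_in_face[of "{..<5} - {j}"] j by auto
  then show "F facet_of ideal_hull"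
    unfolding facet_of_def using face_of_ideal_hull[OF c(1)] aff_dim_face[OF c(1)] c j aff_dim_ideal_hull by simp
qed

lemma codim2_faces_ideal_hull:
  "codim2_faces ideal_hull = (\<lambda>(i, l). face ({..<5} - {i, l})) ` {(i, l). i < l \<and> l < 5}"
proof (intro set_eqI iffI)
  fix Y assume "Y \<in> codim2_faces ideal_hull"
  then have Y: "Y face_of ideal_hull" "Y \<noteq> {}" "aff_dim Y = 2"
    unfolding codim2_faces_def aff_dim_ideal_hull by auto
  obtain K where K: "K \<subseteq> {..<5}" "card K \<ge> 2" "Y = face K"
    using face_of_ideal_hullD[OF Y(1,2)] by metis
  have "card K = 3" using Y(3) aff_dim_face[OF K(1,2)] unfolding K(3) by simp
  then have "card ({..<5} - K) = 2" using K(1) by (subst card_Diff_subset) (auto intro: finite_subset)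
  then obtain i l where il: "{..<5} - K = {i, l}" "i \<noteq> l" by (metis card_2_iff)
  then have Keq: "K = {..<5} - {i, l}" "K = {..<5} - {l, i}" "i < 5" "l < 5" using K(1) by auto
  show "Y \<in> (\<lambda>(i, l). face ({..<5} - {i, l})) ` {(i, l). i < l \<and> l < 5}"
  proof (cases "i < l")
    case True
    then show ?thesis using K(3) Keq by (intro image_eqI[of _ _ "(i, l)"]) auto
  next
    case False
    then show ?thesis using K(3) Keq il(2) by (intro image_eqI[of _ _ "(l, i)"]) auto
  qed
next
  fix Y assume "Y \<in> (\<lambda>(i, l). face ({..<5} - {i, l})) ` {(i, l). i < l \<and> l < 5}"
  then obtain i l where il: "i < l" "l < 5" "Y = face ({..<5} - {i, l})" by auto
  have c: "{..<5} - {i, l} \<subseteq> {..<5}" "card ({..<5} - {i, l}) = 3" using il by (auto simp: card_Diff_subset)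
  then have "Y \<noteq> {}" using face_center_in_face[of "{..<5} - {i, l}"] il by auto
  then show "Y \<in> codim2_faces ideal_hull"
    unfolding codim2_faces_def using face_of_ideal_hull[OF c(1)] aff_dim_face[OF c(1)] c il aff_dim_ideal_hull by simp
qed

lemma inj_on_codim2: "inj_on (\<lambda>(i, l). face ({..<5} - {i, l})) {(i, l). i < l \<and> l < 5}"
proof (rule inj_onI, clarsimp)
  fix i l i' l' assume a: "i < l" "l < 5" "i' < l'" "l' < 5" and eq: "face ({..<5} - {i, l}) = face ({..<5} - {i', l'})"
  have c: "card ({..<5} - {i, l}) = 3" "card ({..<5} - {i', l'}) = 3" using a by (auto simp: card_Diff_subset)
  have "{..<5} - {i, l} = {..<5} - {i', l'}"
    using face_mono_iff[of "{..<5} - {i, l}" "{..<5} - {i', l'}"] face_mono_iff[of "{..<5} - {i', l'}" "{..<5} - {i, l}"] c eq by auto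
  moreover have "{i, l} \<subseteq> {..<5}" "{i', l'} \<subseteq> {..<5}" using a by auto
  ultimately have "{i, l} = {i', l'}" by blast
  then show "i = i' \<and> l = l'" using a by (auto simp: doubleton_eq_iff)
qed

section \<open>Unit normals and dihedral angles\<close>

lemma dual_diag_neg:
  assumes "j < 5" shows "dual j j < 0"
proof -
  interpret pos_off_diag gram by (rule gram_pos_off_diag)
  show ?thesis
    using cof_diag_neg[OF cnd_gram assms] det5_pos[OF cnd_gram] cof_gram[OF assms assms] by (simp add: mult_less_0_iff)
qed

text \<open>The vertices are ideal and belong to no face, so conditions quantified over points of a
  face cannot be tested at \<open>u k\<close>; the midpoint of \<open>x\<close> and
  \<open>u k\<close> tests the same direction.\<close>

lemma midpoint_in_face:
  assumes x: "x \<in> face K" and K: "K \<subseteq> {..<5}" and k: "k < 5"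
  shows "(1/2) *\<^sub>R (x + u k) \<in> face (insert k K)"
proof -
  have c: "coord j ((1/2) *\<^sub>R (x + u k)) = (coord j x + coord j (u k)) / 2" for j
    by (simp add: coord_def inner_add_right field_simps)
  have "norm (x + u k) \<le> norm x + norm (u k)" by (rule norm_triangle_ineq)
  also have "\<dots> < 2" using x norm_u[OF k] by (simp add: face_def)
  finally have "norm ((1/2) *\<^sub>R (x + u k)) < 1" by simp
  then show ?thesis using x k unfolding face_def mem_Collect_eq c by (auto simp: coord_u)
qed

text \<open>Vanishing along the facet and the sign towards vertex \<open>j\<close> force the dual
  covector of \<open>n\<close> to be a nonnegative multiple of \<open>normal j\<close>; the unit
  length fixes the multiple.\<close>

lemma outer_unit_normal_unique:
  assumes j: "j < 5" and x: "x \<in> face ({..<5} - {j})"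
    and n: "outer_unit_normal ideal_hull (face ({..<5} - {j})) x n"
  defines "s \<equiv> 1 - (norm x)\<^sup>2"
  shows "n = (s / sqrt (s * - dual j j)) *\<^sub>R (normal j - height j *\<^sub>R x)"
proof -
  have s: "s > 0" using x abs_square_less_1[of "norm x"] by (simp add: face_def s_def)
  \<comment> \<open>The index of \<open>n\<close> is lowered: \<open>p\<close> represents the
    functional \<open>klein_metric x n\<close> in the Euclidean inner product. The inverse operation
    is \<open>n = s *\<^sub>R (p - (x \<bullet> p) *\<^sub>R x)\<close>.\<close>
  define p where "p = (1 / s) *\<^sub>R n + ((x \<bullet> n) / s\<^sup>2) *\<^sub>R x"
  have km: "klein_metric x n w = p \<bullet> w" for w
    by (simp add: klein_metric_def p_def s_def inner_add_left)
  have cx: "coord j x = 0" using x j by (auto simp: face_def)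
  have xM: "x \<in> ideal_hull" using x unfolding face_full[symmetric] face_def by auto
  have zero: "p \<bullet> (u k - x) = 0" if k: "k < 5" "k \<noteq> j" for k
  proof -
    have "(1/2) *\<^sub>R (x + u k) \<in> face (insert k ({..<5} - {j}))" by (rule midpoint_in_face[OF x _ k(1)]) auto
    also have "insert k ({..<5} - {j}) = {..<5} - {j}" using k by auto
    finally have "p \<bullet> ((1/2) *\<^sub>R (x + u k) - x) = 0" using n unfolding outer_unit_normal_def km by blast
    moreover have "(1/2) *\<^sub>R (x + u k) - x = (1/2) *\<^sub>R (u k - x)" by (simp add: vec_eq_iff field_simps)
    ultimately show ?thesis by simp
  qed
  define \<kappa> where "\<kappa> = - (p \<bullet> (u j - x))"
  have \<kappa>0: "\<kappa> \<ge> 0"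
  proof -
    have "(1/2) *\<^sub>R (x + u j) \<in> face (insert j ({..<5} - {j}))" by (rule midpoint_in_face[OF x _ j]) auto
    also have "insert j ({..<5} - {j}) = {..<5}" using j by auto
    finally have "p \<bullet> ((1/2) *\<^sub>R (x + u j) - x) \<le> 0" using n unfolding outer_unit_normal_def km face_full by blast
    moreover have "(1/2) *\<^sub>R (x + u j) - x = (1/2) *\<^sub>R (u j - x)" by (simp add: vec_eq_iff field_simps)
    ultimately show ?thesis by (simp add: \<kappa>_def)
  qed
  have py: "p \<bullet> (y - x) = - \<kappa> * coord j y" for y
  proof -
    have "y - x = (\<Sum>k<5. coord k y *\<^sub>R u k) - (\<Sum>k<5. coord k y) *\<^sub>R x"
      by (simp add: coord_combination sum_coord)
    also have "\<dots> = (\<Sum>k<5. coord k y *\<^sub>R (u k - x))"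
      by (simp only: scaleR_sum_left sum_subtractf scaleR_diff_right)
    finally have "p \<bullet> (y - x) = (\<Sum>k<5. coord k y * (p \<bullet> (u k - x)))"
      by (simp add: inner_sum_right)
    also have "\<dots> = (\<Sum>k<5. if k = j then - \<kappa> * coord j y else 0)"
      by (intro sum.cong refl) (auto simp: zero \<kappa>_def)
    also have "\<dots> = - \<kappa> * coord j y" using j by simp
    finally show ?thesis .
  qed
  \<comment> \<open>Since \<open>coord j x = 0\<close>, the value of \<open>coord j\<close> at
    \<open>x + z\<close> is \<open>- (normal j \<bullet> z)\<close>.\<close>
  have "(p - \<kappa> *\<^sub>R normal j) \<bullet> z = 0" for z
    using py[of "x + z"] cx by (simp add: coord_def inner_add_right inner_diff_left algebra_simps)
  from this[of "p - \<kappa> *\<^sub>R normal j"] have p: "p = \<kappa> *\<^sub>R normal j" by simp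
  have nx: "normal j \<bullet> x = height j" using cx by (simp add: coord_def)
  have xx: "x \<bullet> x = 1 - s" by (simp add: s_def power2_norm_eq_inner)
  have xp: "x \<bullet> p = (x \<bullet> n) / s\<^sup>2"
    using s by (simp add: p_def inner_add_right xx field_simps power2_eq_square)
  have "n = s *\<^sub>R (p - (x \<bullet> p) *\<^sub>R x)"
    unfolding xp using s by (simp add: p_def)
  also have "\<dots> = (s * \<kappa>) *\<^sub>R (normal j - height j *\<^sub>R x)"
    unfolding p by (simp add: nx inner_commute[of x] scaleR_diff_right mult_ac)
  finally have n_eq: "n = (s * \<kappa>) *\<^sub>R (normal j - height j *\<^sub>R x)" .
  have "1 = p \<bullet> n" using n unfolding outer_unit_normal_def km by simp
  also have "\<dots> = \<kappa>\<^sup>2 * (s * - dual j j)"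
    unfolding p n_eq by (simp add: inner_diff_right nx dual_def power2_eq_square algebra_simps)
  finally have \<kappa>2: "\<kappa>\<^sup>2 * (s * - dual j j) = 1" by simp
  have pos: "s * - dual j j > 0" using s dual_diag_neg[OF j] by (simp add: mult_pos_neg)
  have "\<kappa> = 1 / sqrt (s * - dual j j)"
  proof -
    have "s * - dual j j \<noteq> 0" using pos by linarith
    then have "\<kappa>\<^sup>2 = 1 / (s * - dual j j)" using \<kappa>2 by (rule iffD2[OF nonzero_eq_divide_eq])
    then have "sqrt (\<kappa>\<^sup>2) = 1 / sqrt (s * - dual j j)" by (simp only: real_sqrt_divide real_sqrt_one)
    then show ?thesis using \<kappa>0 by (simp only: real_sqrt_abs abs_of_nonneg)
  qed
  then show ?thesis using n_eq by simp
qed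

text \<open>All powers of \<open>s\<close> cancel and the right-hand side no longer contains
  \<open>x\<close>: the dihedral angle is the same at every point of the face.\<close>

lemma klein_metric_unit_normals:
  assumes "i < 5" "l < 5" and x: "norm x < 1" "coord i x = 0" "coord l x = 0"
  defines "s \<equiv> 1 - (norm x)\<^sup>2"
  shows "klein_metric x ((s / sqrt (s * - dual i i)) *\<^sub>R (normal i - height i *\<^sub>R x)) ((s / sqrt (s * - dual l l)) *\<^sub>R (normal l - height l *\<^sub>R x)) =
    - dual i l / (sqrt (- dual i i) * sqrt (- dual l l))"
proof -
  have s: "s > 0" using x abs_square_less_1[of "norm x"] by (simp add: s_def)
  define a where "a = s / sqrt (s * - dual i i)"
  define b where "b = s / sqrt (s * - dual l l)"
  have n: "normal i \<bullet> x = height i" "normal l \<bullet> x = height l" using x by (simp_all add: coord_def)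
  have n': "x \<bullet> normal i = height i" "x \<bullet> normal l = height l" using n by (simp_all add: inner_commute)
  have xx: "x \<bullet> x = 1 - s" by (simp add: s_def power2_norm_eq_inner)
  have nn: "(normal i - height i *\<^sub>R x) \<bullet> (normal l - height l *\<^sub>R x) = - dual i l - s * (height i * height l)"
    by (simp add: inner_diff_left inner_diff_right n n' xx dual_def algebra_simps)
  have xn: "x \<bullet> (normal i - height i *\<^sub>R x) = s * height i" "x \<bullet> (normal l - height l *\<^sub>R x) = s * height l"
    by (simp_all add: inner_diff_right n' xx algebra_simps)
  have "klein_metric x (a *\<^sub>R (normal i - height i *\<^sub>R x)) (b *\<^sub>R (normal l - height l *\<^sub>R x)) = a * b * (- dual i l) / s"
    unfolding klein_metric_def s_def[symmetric] inner_scaleR_left inner_scaleR_right nn xn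
    using s by (simp add: field_simps power2_eq_square)
  also have "\<dots> = - dual i l / (sqrt (- dual i i) * sqrt (- dual l l))"
  proof -
    have c: "q * q / (q * P) * (q * q / (q * Q)) * d / (q * q) = d / (P * Q)" if "q > 0" "P > 0" "Q > 0" for q P Q d :: real
      using that by (simp add: field_simps)
    have q: "s = sqrt s * sqrt s" using s by simp
    show ?thesis
      using c[of "sqrt s" "sqrt (- dual i i)" "sqrt (- dual l l)" "- dual i l"] s
        dual_diag_neg[OF assms(1)] dual_diag_neg[OF assms(2)]
      unfolding a_def b_def real_sqrt_mult q[symmetric] by simp
  qed
  finally show ?thesis unfolding a_def b_def .
qed

lemma out_angle_gram:
  assumes "i < 5" "l < 5"
  shows "out_angle gram i l = arccos (- dual i l / (sqrt (- dual i i) * sqrt (- dual l l)))"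
proof -
  interpret pos_off_diag gram by (rule gram_pos_off_diag)
  have D: "det5 gram > 0" by (rule det5_pos[OF cnd_gram])
  have "sqrt (cof gram i i * cof gram l l) = sqrt ((det5 gram)\<^sup>2 * ((- dual i i) * (- dual l l)))"
    using assms by (simp add: cof_gram power2_eq_square mult_ac)
  also have "\<dots> = det5 gram * (sqrt (- dual i i) * sqrt (- dual l l))"
    using D by (simp only: real_sqrt_mult real_sqrt_abs abs_of_pos)
  finally show ?thesis unfolding out_angle_def using assms D by (simp add: cof_gram)
qed

lemma out_angle_commute:
  assumes "i < 5" "l < 5"
  shows "out_angle gram i l = out_angle gram l i"
  unfolding out_angle_gram[OF assms] out_angle_gram[OF assms(2,1)] by (simp add: dual_commute[of i l] mult.commute)

text \<open>Uniqueness alone does not give the description operator in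
  \<open>outer_dihedral_angle\<close> a value; this supplies the witnesses.\<close>

lemma outer_unit_normal_exists:
  assumes j: "j < 5" and x: "x \<in> face ({..<5} - {j})"
  defines "s \<equiv> 1 - (norm x)\<^sup>2"
  shows "outer_unit_normal ideal_hull (face ({..<5} - {j})) x ((s / sqrt (s * - dual j j)) *\<^sub>R (normal j - height j *\<^sub>R x))"
proof -
  have s: "s > 0" using x abs_square_less_1[of "norm x"] by (simp add: face_def s_def)
  define a where "a = s / sqrt (s * - dual j j)"
  have d: "dual j j < 0" by (rule dual_diag_neg[OF j])
  then have a: "a > 0" using s by (simp add: a_def mult_pos_neg)
  have cx: "coord j x = 0" "norm x < 1" using x j by (auto simp: face_def)
  have n: "normal j \<bullet> x = height j" "x \<bullet> normal j = height j" using cx by (simp_all add: coord_def inner_commute)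
  have xx: "x \<bullet> x = 1 - s" by (simp add: s_def power2_norm_eq_inner)
  have km: "klein_metric x (a *\<^sub>R (normal j - height j *\<^sub>R x)) (y - x) = - (a / s) * coord j y" for y
  proof -
    have "klein_metric x (a *\<^sub>R (normal j - height j *\<^sub>R x)) w = (a / s) * (normal j \<bullet> w)" for w
      unfolding klein_metric_def s_def[symmetric]
      using s by (simp add: inner_diff_left inner_diff_right n xx field_simps power2_eq_square)
    then show ?thesis by (simp add: inner_diff_right n coord_def right_diff_distrib diff_divide_distrib)
  qed
  have "klein_metric x (a *\<^sub>R (normal j - height j *\<^sub>R x)) (a *\<^sub>R (normal j - height j *\<^sub>R x)) = 1"
    using klein_metric_unit_normals[OF j j cx(2,1,1)] d unfolding s_def[symmetric] a_def[symmetric] by simp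
  moreover have "\<forall>y\<in>face ({..<5} - {j}). klein_metric x (a *\<^sub>R (normal j - height j *\<^sub>R x)) (y - x) = 0"
    unfolding km using j by (auto simp: face_def)
  moreover have "\<forall>y\<in>ideal_hull. klein_metric x (a *\<^sub>R (normal j - height j *\<^sub>R x)) (y - x) \<le> 0"
    unfolding km face_full[symmetric] using j a s by (auto simp: face_def)
  ultimately show ?thesis unfolding outer_unit_normal_def a_def by blast
qed

text \<open>Only the facets omitting \<open>i\<close> or \<open>l\<close> contain the face. The
  description leaves both the point and the order of the two facets free, so uniqueness rests on
  independence of the point and on symmetry in \<open>i\<close> and \<open>l\<close>.\<close>

lemma outer_dihedral_angle_eq:
  assumes il: "i < 5" "l < 5" "i \<noteq> l"
  shows "outer_dihedral_angle ideal_hull (face ({..<5} - {i, l})) = out_angle gram i l"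
proof -
  let ?Y = "face ({..<5} - {i, l})"
  let ?F = "\<lambda>j. face ({..<5} - {j})"
  let ?n = "\<lambda>j x. ((1 - (norm x)\<^sup>2) / sqrt ((1 - (norm x)\<^sup>2) * - dual j j)) *\<^sub>R (normal j - height j *\<^sub>R x)"
  have c3: "card ({..<5} - {i, l}) = 3" using il by (auto simp: card_Diff_subset)
  have sub: "?Y \<subseteq> ?F j \<longleftrightarrow> j \<in> {i, l}" if "j < 5" for j
    using face_mono_iff[of "{..<5} - {i, l}" "{..<5} - {j}"] c3 that by auto
  have ne: "?F i \<noteq> ?F l"
  proof -
    have "card ({..<5} - {i}) = 4" using il by simp
    then have "\<not> ?F i \<subseteq> ?F l" using face_mono_iff[of "{..<5} - {i}" "{..<5} - {l}"] il by auto
    then show ?thesis by blast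
  qed
  have val: "arccos (klein_metric x (?n a x) (?n b x)) = out_angle gram i l"
    if "x \<in> ?Y" "(a = i \<and> b = l) \<or> (a = l \<and> b = i)" for x a b
  proof -
    have x: "norm x < 1" "coord i x = 0" "coord l x = 0" using that(1) il by (auto simp: face_def)
    show ?thesis
      using that(2) klein_metric_unit_normals[OF il(1,2) x] klein_metric_unit_normals[OF il(2,1) x(1,3,2)]
        out_angle_gram[OF il(1,2)] out_angle_gram[OF il(2,1)] out_angle_commute[OF il(1,2)] by auto
  qed
  show ?thesis
    unfolding outer_dihedral_angle_def
  proof (rule the_equality)
    have x: "face_center ({..<5} - {i, l}) \<in> ?Y" by (rule face_center_in_face) (use c3 in auto)
    let ?x = "face_center ({..<5} - {i, l})"
    have xF: "?x \<in> ?F i" "?x \<in> ?F l" using x sub[OF il(1)] sub[OF il(2)] by blast+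
    have "?F i facet_of ideal_hull" "?F l facet_of ideal_hull"
      unfolding facet_of_ideal_hull_iff using il by blast+
    moreover have "?Y \<subseteq> ?F i" "?Y \<subseteq> ?F l" using sub il by blast+
    moreover note outer_unit_normal_exists[OF il(1) xF(1)] outer_unit_normal_exists[OF il(2) xF(2)] ne
    moreover have "out_angle gram i l = arccos (klein_metric ?x (?n i ?x) (?n l ?x))"
      using val[OF x, of i l] by simp
    ultimately show "\<exists>x\<in>?Y. \<exists>F\<^sub>1 F\<^sub>2 n\<^sub>1 n\<^sub>2. F\<^sub>1 facet_of ideal_hull \<and> F\<^sub>2 facet_of ideal_hull \<and> F\<^sub>1 \<noteq> F\<^sub>2 \<and> ?Y \<subseteq> F\<^sub>1 \<and> ?Y \<subseteq> F\<^sub>2 \<and>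
        outer_unit_normal ideal_hull F\<^sub>1 x n\<^sub>1 \<and> outer_unit_normal ideal_hull F\<^sub>2 x n\<^sub>2 \<and>
        out_angle gram i l = arccos (klein_metric x n\<^sub>1 n\<^sub>2)"
      using x by blast
  next
    fix \<theta>
    assume "\<exists>x\<in>?Y. \<exists>F\<^sub>1 F\<^sub>2 n\<^sub>1 n\<^sub>2. F\<^sub>1 facet_of ideal_hull \<and> F\<^sub>2 facet_of ideal_hull \<and> F\<^sub>1 \<noteq> F\<^sub>2 \<and> ?Y \<subseteq> F\<^sub>1 \<and> ?Y \<subseteq> F\<^sub>2 \<and>
        outer_unit_normal ideal_hull F\<^sub>1 x n\<^sub>1 \<and> outer_unit_normal ideal_hull F\<^sub>2 x n\<^sub>2 \<and>
        \<theta> = arccos (klein_metric x n\<^sub>1 n\<^sub>2)"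
    then obtain x F\<^sub>1 F\<^sub>2 n\<^sub>1 n\<^sub>2 where x: "x \<in> ?Y" and F: "F\<^sub>1 facet_of ideal_hull" "F\<^sub>2 facet_of ideal_hull" "F\<^sub>1 \<noteq> F\<^sub>2" "?Y \<subseteq> F\<^sub>1" "?Y \<subseteq> F\<^sub>2"
      and n: "outer_unit_normal ideal_hull F\<^sub>1 x n\<^sub>1" "outer_unit_normal ideal_hull F\<^sub>2 x n\<^sub>2" and \<theta>: "\<theta> = arccos (klein_metric x n\<^sub>1 n\<^sub>2)"
      by blast
    obtain a b where ab: "a < 5" "F\<^sub>1 = ?F a" "b < 5" "F\<^sub>2 = ?F b"
      using F(1,2) unfolding facet_of_ideal_hull_iff by blast
    have "a \<in> {i, l}" "b \<in> {i, l}" "a \<noteq> b" using sub ab F by auto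
    then have cases: "(a = i \<and> b = l) \<or> (a = l \<and> b = i)" by auto
    have "n\<^sub>1 = ?n a x" using outer_unit_normal_unique[OF ab(1), of x n\<^sub>1] n(1) x F(4) ab(2) by blast
    moreover have "n\<^sub>2 = ?n b x" using outer_unit_normal_unique[OF ab(3), of x n\<^sub>2] n(2) x F(5) ab(4) by blast
    ultimately show "\<theta> = out_angle gram i l" unfolding \<theta> using val[OF x cases] by simp
  qed
qed

section \<open>Summation over the faces and the volume formula\<close>

lemma sum_codim2_faces:
  "(\<Sum>i<5. \<Sum>l\<in>{..<5}-{i}. out_angle gram i l) = 2 * (\<Sum>Y\<in>codim2_faces ideal_hull. outer_dihedral_angle ideal_hull Y)"
proof -
  define f where "f i l = out_angle gram i l" for i l
  have sym: "f 1 0 = f 0 1" "f 2 0 = f 0 2" "f 3 0 = f 0 3" "f 4 0 = f 0 4" "f 2 1 = f 1 2" "f 3 1 = f 1 3" "f 4 1 = f 1 4"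
     "f 3 2 = f 2 3" "f 4 2 = f 2 4" "f 4 3 = f 3 4"
    unfolding f_def by (rule out_angle_commute; simp)+
  have "(\<Sum>Y\<in>codim2_faces ideal_hull. outer_dihedral_angle ideal_hull Y) = (\<Sum>(i, l)\<in>{(i, l). i < l \<and> l < 5}. f i l)"
    unfolding codim2_faces_ideal_hull
    by (subst sum.reindex[OF inj_on_codim2]) (auto simp: f_def outer_dihedral_angle_eq intro!: sum.cong)
  also have "{(i, l). i < l \<and> l < 5} = (SIGMA i:{..<5::nat}. {i<..<5})" by auto
  also have "(\<Sum>(i, l)\<in>(SIGMA i:{..<5}. {i<..<5}). f i l) = (\<Sum>i<5. \<Sum>l\<in>{i<..<5}. f i l)"
    by (rule sum.Sigma[symmetric]) auto
  also have "\<dots> = f 0 1 + f 0 2 + f 0 3 + f 0 4 + f 1 2 + f 1 3 + f 1 4 + f 2 3 + f 2 4 + f 3 4"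
  proof -
    have "{0<..<5::nat} = {1, 2, 3, 4}" "{1<..<5::nat} = {2, 3, 4}" "{2<..<5::nat} = {3, 4}" "{3<..<5::nat} = {4}" "{4<..<5::nat} = {}"
      by auto
    then show ?thesis unfolding sum_lessThan_5 by (simp add: add.assoc del: One_nat_def)
  qed
  finally have 1: "(\<Sum>Y\<in>codim2_faces ideal_hull. outer_dihedral_angle ideal_hull Y) = f 0 1 + f 0 2 + f 0 3 + f 0 4 + f 1 2 + f 1 3 + f 1 4 + f 2 3 + f 2 4 + f 3 4" .
  have "(\<Sum>i<5. \<Sum>l\<in>{..<5}-{i}. f i l) = (\<Sum>i<5. \<Sum>l<5. if l = i then 0 else f i l)"
    by (rule sum.cong[OF refl], rule sum.mono_neutral_cong_left) auto
  also have "\<dots> = 2 * (f 0 1 + f 0 2 + f 0 3 + f 0 4 + f 1 2 + f 1 3 + f 1 4 + f 2 3 + f 2 4 + f 3 4)"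
    unfolding sum_lessThan_5 by (simp add: sym del: One_nat_def)
  finally show ?thesis unfolding 1 f_def .
qed

lemma volume_formula:
  "emeasure hyp_measure ideal_hull \<noteq> \<infinity> \<and>
   measure hyp_measure ideal_hull = - 2 * pi\<^sup>2 + pi / 3 * (\<Sum>Y\<in>codim2_faces ideal_hull. outer_dihedral_angle ideal_hull Y)"
proof -
  define S where "S = (\<Sum>Y\<in>codim2_faces ideal_hull. outer_dihedral_angle ideal_hull Y)"
  define W where "W = sqrt (det5 gram) * mom0 gram {..<5}"
  have W: "W = pi * sqrt pi / 16 * (2 * S - 12 * pi)"
    unfolding W_def S_def sum_codim2_faces[symmetric] by (rule gram_volume_formula[OF gram_pos_off_diag cnd_gram])
  \<comment> \<open>Needed to pass from the equation between extended nonnegative reals to one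
    between reals.\<close>
  have "W \<ge> 0"
    unfolding W_def mom0_def abs_det_edge_matrix[symmetric] by (intro mult_nonneg_nonneg abs_ge_zero Bochner_Integration.integral_nonneg) simp
  have K: "3 * sqrt pi / 8 > 0" by simp
  \<comment> \<open>Finiteness comes from \<open>hyp_volume\<close>: a positive multiple of the
    volume equals a real number.\<close>
  have fin: "emeasure hyp_measure ideal_hull \<noteq> \<infinity>"
  proof
    assume "emeasure hyp_measure ideal_hull = \<infinity>"
    then have "ennreal (3 * sqrt pi / 8) * emeasure hyp_measure ideal_hull = \<infinity>"
      using K by (simp add: ennreal_mult_top)
    then show False unfolding hyp_volume by simp
  qed
  have "ennreal (3 * sqrt pi / 8 * measure hyp_measure ideal_hull) = ennreal (3 * sqrt pi / 8) * ennreal (measure hyp_measure ideal_hull)"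
    by (rule ennreal_mult') simp
  also have "\<dots> = ennreal W"
    using hyp_volume emeasure_eq_ennreal_measure[of hyp_measure ideal_hull] fin by (simp add: W_def)
  finally have "ennreal (3 * sqrt pi / 8 * measure hyp_measure ideal_hull) = ennreal W" .
  then have "3 * sqrt pi / 8 * measure hyp_measure ideal_hull = W"
    using \<open>W \<ge> 0\<close> K by (subst (asm) ennreal_inj) auto
  also have "W = 3 * sqrt pi / 8 * (- 2 * pi\<^sup>2 + pi / 3 * S)"
    unfolding W by (simp add: power2_eq_square field_simps)
  finally have "measure hyp_measure ideal_hull = - 2 * pi\<^sup>2 + pi / 3 * S" using K by simp
  then show ?thesis using fin by (simp add: S_def)
qed

end

theorem mainTheorem5:
  fixes M :: "(real ^ 4) set"
  assumes "ideal_simplex M"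
  shows "emeasure hyp_measure M \<noteq> \<infinity> \<and>
    measure hyp_measure M =
      - 2 * pi\<^sup>2 + pi / 3 * (\<Sum>Y\<in>codim2_faces M. outer_dihedral_angle M Y)"
proof -
  obtain V where V: "V \<subseteq> sphere 0 1" "card V = 5" "\<not> affine_dependent V" "M = convex hull V \<inter> ball 0 1"
    using assms unfolding ideal_simplex_def ideal_points_def hyp_space_def by auto
  have "finite V" using V(2) card.infinite by fastforce
  then obtain u where u: "bij_betw u {..<5::nat} V"
    using V(2) ex_bij_betw_nat_finite[of V] by (auto simp: atLeast0LessThan)
  then have uV: "u ` {..<5} = V" "inj_on u {..<5}" by (auto simp: bij_betw_def)
  interpret sphere_simplex u
  proof
    show "norm (u i) = 1" if "i < 5" for i
    proof -
      have "u i \<in> V" using uV(1) that by blast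
      then show ?thesis using V(1) by auto
    qed
  qed (use uV V(3) in simp_all)
  have "M = ideal_hull" unfolding ideal_hull_def vertices_def uV(1) by (rule V(4))
  then show ?thesis using volume_formula by simp
qed

end
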